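(* Let $G$ be a totally disconnected locally compact abelian group, and for each prime $p$ let $G_p$ be its topological $p$-component. Then, for every $\phi\in\mathrm{End}(G)$, $$h_{top}(\phi)=\sum_{p} h_{top}(\phi\restriction_{G_p}),$$ where the sum is over all primes $p$. Moreover: (a) if $AT(G_p)$ holds for every prime $p$, then also $AT(G)$ holds; (b) in case $G$ is periodic, $AT(G)$ holds if and only if $AT(G_p)$ holds for every prime $p$.
   Context: For a topological group $G$, $\mathrm{End}(G)$ is the set of continuous endomorphisms of $G$. For a locally compact group $G$ with left Haar measure $\mu$, let $\mathcal C(G)$ be the family of compact neighborhoods of the identity. For $\phi\in\mathrm{End}(G)$, $U\in\mathcal C(G)$ and $n\ge 1$ put $C_n(\phi,U)=U\cap\phi^{-1}(U)\cap\dots\cap\phi^{-n+1}(U)$, $H_{top}(\phi,U)=\limsup_{n\to\infty}\frac{-\log\mu(C_n(\phi,U))}{n}$, and $h_{top}(\phi)=\sup\{H_{top}(\phi,U)\mid U\in\mathcal C(G)\}\in[0,\infty]$. $AT(G)$ holds means: for every $\phi\in\mathrm{End}(G)$ and every $\phi$-invariant (i.e. $\phi(H)\subseteq H$) closed normal subgroup $H$ of $G$, $h_{top}(\phi)=h_{top}(\phi\restriction_H)+h_{top}(\bar\phi_{G/H})$, where $\bar\phi_{G/H}\in\mathrm{End}(G/H)$ is induced by $\phi$. For a prime $p$, $G_p=\{x\in G\mid p^nx\to 0 \text{ as } n\to\infty\}$ with the subspace topology; for $G$ totally disconnected locally compact abelian it is a closed subgroup, invariant under every continuous endomorphism. A locally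 compact group is periodic if it is totally disconnected and each of its elements is contained in a compact subgroup. *)

theory Defs
  imports "HOL-Analysis.Analysis" "HOL-Computational_Algebra.Primes" "HOL-Algebra.Coset"
begin

(* Groups are written multiplicatively, and a topology on a group G is an abstract topology T
   whose underlying set is the carrier of G.  This allows closed subgroups, with the record
   G\<lparr>carrier := H\<rparr> and the topology "subtopology T H", and quotient groups G Mod H to be treated
   as topological groups in their own right. *)

locale topological_group = group G for G :: "('a, 'b) monoid_scheme" (structure) +
  fixes T :: "'a topology"
  assumes topspace_eq: "topspace T = carrier G"
    and continuous_mult: "continuous_map (prod_topology T T) T (\<lambda>(x, y). x \<otimes> y)"
    and continuous_inv: "continuous_map T T (\<lambda>x. inv x)"

(* Locally compact groups are assumed to be Hausdorff, as usual. *)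
locale locally_compact_group = topological_group +
  assumes locally_compact: "locally_compact_space T"
    and Hausdorff: "Hausdorff_space T"

definition totally_disconnected_space :: "'a topology \<Rightarrow> bool" where
  "totally_disconnected_space T \<longleftrightarrow> (\<forall>C. connectedin T C \<longrightarrow> (\<exists>a. C \<subseteq> {a}))"

locale tdlc_group = locally_compact_group +
  assumes totally_disconnected: "totally_disconnected_space T"

locale tdlc_abelian_group = tdlc_group + comm_group

definition periodic_group :: "('a, 'b) monoid_scheme \<Rightarrow> 'a topology \<Rightarrow> bool" where
  "periodic_group G T \<longleftrightarrow> tdlc_group G T \<and>
     (\<forall>x\<in>carrier G. \<exists>K. subgroup K G \<and> compactin T K \<and> x \<in> K)"

definition End :: "('a, 'b) monoid_scheme \<Rightarrow> 'a topology \<Rightarrow> ('a \<Rightarrow> 'a) set" where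
  "End G T = {\<phi>. \<phi> \<in> hom G G \<and> continuous_map T T \<phi>}"


(* The left Haar measures of G, as left invariant nonzero Radon measures on the Borel sets. *)
definition is_left_haar_measure ::
    "('a, 'b) monoid_scheme \<Rightarrow> 'a topology \<Rightarrow> 'a measure \<Rightarrow> bool" where
  "is_left_haar_measure G T \<mu> \<longleftrightarrow>
     space \<mu> = carrier G \<and>
     sets \<mu> = sigma_sets (carrier G) {U. openin T U} \<and>
     emeasure \<mu> (carrier G) \<noteq> 0 \<and>
     (\<forall>K. compactin T K \<longrightarrow> emeasure \<mu> K < \<infinity>) \<and>
     (\<forall>A\<in>sets \<mu>. emeasure \<mu> A = (INF U\<in>{U. openin T U \<and> A \<subseteq> U}. emeasure \<mu> U)) \<and>
     (\<forall>U. openin T U \<longrightarrow>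
        emeasure \<mu> U = (SUP K\<in>{K. compactin T K \<and> K \<subseteq> U}. emeasure \<mu> K)) \<and>
     (\<forall>x\<in>carrier G. \<forall>A\<in>sets \<mu>. emeasure \<mu> (x <#\<^bsub>G\<^esub> A) = emeasure \<mu> A)"

(* A locally compact group has a left Haar measure, unique up to a positive factor.  The entropy
   below does not depend on that factor, so it does not matter which one is chosen. *)
definition haar_measure :: "('a, 'b) monoid_scheme \<Rightarrow> 'a topology \<Rightarrow> 'a measure" where
  "haar_measure G T = (SOME \<mu>. is_left_haar_measure G T \<mu>)"


definition compact_nhds_one :: "('a, 'b) monoid_scheme \<Rightarrow> 'a topology \<Rightarrow> 'a set set" where
  "compact_nhds_one G T = {U. compactin T U \<and> \<one>\<^bsub>G\<^esub> \<in> T interior_of U}"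

definition cotrajectory ::
    "('a, 'b) monoid_scheme \<Rightarrow> ('a \<Rightarrow> 'a) \<Rightarrow> 'a set \<Rightarrow> nat \<Rightarrow> 'a set" where
  "cotrajectory G \<phi> U n = {x \<in> carrier G. \<forall>k<n. (\<phi> ^^ k) x \<in> U}"

(* For n > 0 the cotrajectory of a compact neighbourhood of the identity is again a compact
   neighbourhood of the identity, so it has finite positive measure and the real logarithm
   is the intended one. *)
definition H_top ::
    "('a, 'b) monoid_scheme \<Rightarrow> 'a topology \<Rightarrow> ('a \<Rightarrow> 'a) \<Rightarrow> 'a set \<Rightarrow> ereal" where
  "H_top G T \<phi> U =
     limsup (\<lambda>n. ereal (- ln (measure (haar_measure G T) (cotrajectory G \<phi> U n)) / real n))"

definition h_top :: "('a, 'b) monoid_scheme \<Rightarrow> 'a topology \<Rightarrow> ('a \<Rightarrow> 'a) \<Rightarrow> ereal" where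
  "h_top G T \<phi> = (SUP U\<in>compact_nhds_one G T. H_top G T \<phi> U)"


definition quotient_group_topology ::
    "('a, 'b) monoid_scheme \<Rightarrow> 'a topology \<Rightarrow> 'a set \<Rightarrow> 'a set topology" where
  "quotient_group_topology G T H =
     topology (\<lambda>W. W \<subseteq> carrier (G Mod H) \<and> openin T {x \<in> carrier G. H #>\<^bsub>G\<^esub> x \<in> W})"

lemma openin_quotient_group_topology:
  "openin (quotient_group_topology G T H) W \<longleftrightarrow>
     W \<subseteq> carrier (G Mod H) \<and> openin T {x \<in> carrier G. H #>\<^bsub>G\<^esub> x \<in> W}"
proof -
  have "istopology (\<lambda>W. W \<subseteq> carrier (G Mod H) \<and> openin T {x \<in> carrier G. H #>\<^bsub>G\<^esub> x \<in> W})"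
    unfolding istopology_def
  proof (intro conjI allI impI)
    fix S S' assume S: "S \<subseteq> carrier (G Mod H) \<and> openin T {x \<in> carrier G. H #>\<^bsub>G\<^esub> x \<in> S}"
      and S': "S' \<subseteq> carrier (G Mod H) \<and> openin T {x \<in> carrier G. H #>\<^bsub>G\<^esub> x \<in> S'}"
    have "{x \<in> carrier G. H #>\<^bsub>G\<^esub> x \<in> S \<inter> S'} =
      {x \<in> carrier G. H #>\<^bsub>G\<^esub> x \<in> S} \<inter> {x \<in> carrier G. H #>\<^bsub>G\<^esub> x \<in> S'}" by auto
    then show "openin T {x \<in> carrier G. H #>\<^bsub>G\<^esub> x \<in> S \<inter> S'}"
      using S S' by auto
    show "S \<inter> S' \<subseteq> carrier (G Mod H)" using S by blast
  next
    fix \<K> assume K: "\<forall>K\<in>\<K>. K \<subseteq> carrier (G Mod H) \<and> openin T {x \<in> carrier G. H #>\<^bsub>G\<^esub> x \<in> K}"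
    have "{x \<in> carrier G. H #>\<^bsub>G\<^esub> x \<in> \<Union>\<K>} =
      \<Union>((\<lambda>K. {x \<in> carrier G. H #>\<^bsub>G\<^esub> x \<in> K}) ` \<K>)" by auto
    then show "openin T {x \<in> carrier G. H #>\<^bsub>G\<^esub> x \<in> \<Union>\<K>}" using K by auto
    show "\<Union>\<K> \<subseteq> carrier (G Mod H)" using K by blast
  qed
  then show ?thesis by (simp add: quotient_group_topology_def)
qed

lemma (in topological_group) quotient_map_quotient_group_topology:
  "quotient_map T (quotient_group_topology G T H) (\<lambda>x. H #> x)"
proof -
  have "{x \<in> carrier G. H #> x \<in> carrier (G Mod H)} = topspace T"
    by (auto simp: carrier_FactGroup topspace_eq)
  then have "openin (quotient_group_topology G T H) (carrier (G Mod H))"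
    by (simp add: openin_quotient_group_topology)
  then have "topspace (quotient_group_topology G T H) = carrier (G Mod H)"
    unfolding topspace_def by (auto simp: openin_quotient_group_topology)
  then show ?thesis
    by (simp add: quotient_map_def openin_quotient_group_topology topspace_eq carrier_FactGroup)
qed

(* The endomorphism of G Mod H induced by phi, sending a coset C to the coset that contains the
   image of C; see the lemma below for its value at H #> x. *)
definition quotient_endo ::
    "('a, 'b) monoid_scheme \<Rightarrow> 'a set \<Rightarrow> ('a \<Rightarrow> 'a) \<Rightarrow> 'a set \<Rightarrow> 'a set" where
  "quotient_endo G H \<phi> C = H <#>\<^bsub>G\<^esub> (\<phi> ` C)"

lemma quotient_endo_r_coset:
  assumes "H \<lhd> G" "\<phi> \<in> hom G G" "\<phi> ` H \<subseteq> H" "x \<in> carrier G"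
  shows "quotient_endo G H \<phi> (H #>\<^bsub>G\<^esub> x) = H #>\<^bsub>G\<^esub> \<phi> x"
proof -
  interpret normal H G by fact
  have px: "\<phi> x \<in> carrier G" using assms(2,4) by (auto simp: hom_def)
  have h: "\<phi> (h \<otimes>\<^bsub>G\<^esub> x) = \<phi> h \<otimes>\<^bsub>G\<^esub> \<phi> x" "\<phi> h \<in> H" if "h \<in> H" for h
    using assms that by (auto simp: hom_def)
  show ?thesis
  proof
    show "quotient_endo G H \<phi> (H #>\<^bsub>G\<^esub> x) \<subseteq> H #>\<^bsub>G\<^esub> \<phi> x"
    proof
      fix y assume "y \<in> quotient_endo G H \<phi> (H #>\<^bsub>G\<^esub> x)"
      then obtain h h' where y: "h \<in> H" "h' \<in> H" "y = h \<otimes>\<^bsub>G\<^esub> \<phi> (h' \<otimes>\<^bsub>G\<^esub> x)"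
        by (auto simp: quotient_endo_def set_mult_def r_coset_def)
      then have "y = (h \<otimes>\<^bsub>G\<^esub> \<phi> h') \<otimes>\<^bsub>G\<^esub> \<phi> x"
        using h px by (simp add: m_assoc)
      moreover have "h \<otimes>\<^bsub>G\<^esub> \<phi> h' \<in> H" using y h by simp
      ultimately show "y \<in> H #>\<^bsub>G\<^esub> \<phi> x" by (auto simp: r_coset_def)
    qed
    have "x \<in> H #>\<^bsub>G\<^esub> x"
      using rcos_self[OF assms(4)] subgroup_axioms by blast
    then show "H #>\<^bsub>G\<^esub> \<phi> x \<subseteq> quotient_endo G H \<phi> (H #>\<^bsub>G\<^esub> x)"
      unfolding quotient_endo_def set_mult_def r_coset_def[of G H "\<phi> x"] by blast
  qed
qed

(* The Addition Theorem AT(G). *)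
definition AT :: "('a, 'b) monoid_scheme \<Rightarrow> 'a topology \<Rightarrow> bool" where
  "AT G T \<longleftrightarrow> (\<forall>\<phi>\<in>End G T. \<forall>H. H \<lhd> G \<and> closedin T H \<and> \<phi> ` H \<subseteq> H \<longrightarrow>
     h_top G T \<phi> =
       h_top (G\<lparr>carrier := H\<rparr>) (subtopology T H) (restrict \<phi> H) +
       h_top (G Mod H) (quotient_group_topology G T H) (quotient_endo G H \<phi>))"


definition p_component :: "('a, 'b) monoid_scheme \<Rightarrow> 'a topology \<Rightarrow> nat \<Rightarrow> 'a set" where
  "p_component G T p =
     {x \<in> carrier G. limitin T (\<lambda>n. x [^]\<^bsub>G\<^esub> (p ^ n)) \<one>\<^bsub>G\<^esub> sequentially}"

abbreviation p_component_group ::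
    "('a, 'b) monoid_scheme \<Rightarrow> 'a topology \<Rightarrow> nat \<Rightarrow> ('a, 'b) monoid_scheme" where
  "p_component_group G T p \<equiv> G\<lparr>carrier := p_component G T p\<rparr>"

abbreviation p_component_topology ::
    "('a, 'b) monoid_scheme \<Rightarrow> 'a topology \<Rightarrow> nat \<Rightarrow> 'a topology" where
  "p_component_topology G T p \<equiv> subtopology T (p_component G T p)"

end

theory Submission
  imports Defs "HOL-Number_Theory.Cong"
begin

text \<open>
  Everything reduces to counting cosets of compact open subgroups.  By van Dantzig's theorem the
  compact open subgroups \<open>W\<close> form a neighbourhood base at the identity, so the entropy is the
  supremum over them.  For such a \<open>W\<close> the cotrajectory \<open>C\<^sub>n\<close> is again a compact open subgroup and its
  Haar measure is that of \<open>W\<close> divided by the index \<open>[W : C\<^sub>n]\<close>; hence the local entropy is the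
  exponential growth rate of \<open>[W : C\<^sub>n]\<close> (\<open>H_top_eq_limit\<close>, \<open>h_top_eq_SUP\<close>).  The indices
  \<open>[C\<^sub>n : C\<^sub>n\<^sub>+\<^sub>1]\<close> are natural numbers that do not increase, so they are eventually constant, and the growth rate is a
  limit (\<open>entropy_sequence_convergent\<close>).  The entropy is defined through a chosen Haar measure; its
  existence is proved first, since otherwise the choice would be arbitrary.

  The algebraic core is \<open>primary_decomposition\<close>: in a compact open subgroup \<open>W\<close> of an abelian group
  every element is the product of an element of the \<open>p\<close>-component and one that has order prime
  to \<open>p\<close> modulo every open subgroup.  Modulo one open subgroup this is the Chinese remainder theorem,
  and compactness makes the choices compatible.  Consequently \<open>[W : C]\<close> is the product over all
  primes of the indices \<open>[W \<inter> G\<^sub>p : C \<inter> G\<^sub>p]\<close>, with only finitely many factors different from \<open>1\<close>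
  (\<open>coset_index_eq_prod\<close>).  The primes that occur for \<open>C\<^sub>2\<close> already suffice for all \<open>C\<^sub>n\<close>, so
  logarithms and limits turn the product into a finite sum of local entropies (\<open>H_top_eq_sum\<close>).
  Taking the supremum over the directed family of all \<open>W\<close> gives the sum formula
  (\<open>h_top_has_sum\<close>).

  For the addition theorem, the sum formula is applied to \<open>G\<close>, to an invariant closed subgroup \<open>H\<close> and
  to \<open>G/H\<close>.  The \<open>p\<close>-component of \<open>H\<close> is \<open>G\<^sub>p \<inter> H\<close>.  The \<open>p\<close>-component of \<open>G/H\<close> can be larger than
  the image of \<open>G\<^sub>p\<close>, as for \<open>G = \<int>\<close>, but \<open>G\<^sub>p/(G\<^sub>p \<inter> H)\<close> is an open subgroup of it, which suffices
  because entropy is a local notion (\<open>h_top_open_embedding\<close>, \<open>h_top_quotient_component\<close>).  Adding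
  over all primes shows that the addition theorem for all \<open>G\<^sub>p\<close> implies the one for \<open>G\<close>.  If \<open>G\<close> is
  periodic, then the decomposition holds in all of \<open>G\<close> and yields a continuous projection onto
  \<open>G\<^sub>p\<close>; composing an endomorphism of \<open>G\<^sub>p\<close> with it does not change the entropies on the whole group, on
  \<open>H \<subseteq> G\<^sub>p\<close> and on the quotient by \<open>H\<close>, as all other components contribute \<open>0\<close>
  (\<open>AT_component_if_AT\<close>).
\<close>

section \<open>Compact open subgroups\<close>

(* The multiset order shares its symbol with left cosets. *)
no_notation subset_mset (infix \<open><#\<close> 50)

definition compact_open_subgroup :: "('a, 'b) monoid_scheme \<Rightarrow> 'a topology \<Rightarrow> 'a set \<Rightarrow> bool" where
  "compact_open_subgroup G T K \<longleftrightarrow> subgroup K G \<and> openin T K \<and> compactin T K"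

context topological_group
begin

lemma openin_complement: "closedin T C \<Longrightarrow> openin T (carrier G - C)"
  using openin_diff[OF openin_topspace, of T C] by (simp add: topspace_eq)

lemma closedin_complement: "openin T U \<Longrightarrow> closedin T (carrier G - U)"
  using closedin_diff[OF closedin_topspace, of T U] by (simp add: topspace_eq)

lemma compact_subset_carrier: "compactin T K \<Longrightarrow> K \<subseteq> carrier G"
  using compactin_subset_topspace[of T K] by (simp add: topspace_eq)

lemma continuous_map_left_translation:
  assumes "a \<in> carrier G"
  shows "continuous_map T T (\<lambda>x. a \<otimes> x)"
proof -
  have "continuous_map T (prod_topology T T) (\<lambda>x. (a, x))"
    using assms by (auto simp: continuous_map_pairwise o_def topspace_eq)
  from continuous_map_compose[OF this continuous_mult] show ?thesis by (simp add: o_def)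
qed

lemma homeomorphic_map_left_translation:
  assumes "a \<in> carrier G"
  shows "homeomorphic_map T T (\<lambda>x. a \<otimes> x)"
proof -
  have "homeomorphic_maps T T (\<lambda>x. a \<otimes> x) (\<lambda>x. inv a \<otimes> x)"
    using assms by (auto simp: homeomorphic_maps_def continuous_map_left_translation topspace_eq
        m_assoc[symmetric])
  then show ?thesis by (rule homeomorphic_maps_map[THEN iffD1, THEN conjunct1])
qed

lemma l_coset_image: "a <# U = (\<lambda>x. a \<otimes> x) ` U"
  by (auto simp: l_coset_def)

lemma openin_l_coset: "a \<in> carrier G \<Longrightarrow> openin T U \<Longrightarrow> openin T (a <# U)"
  using homeomorphic_imp_open_map[OF homeomorphic_map_left_translation, of a]
  by (simp add: l_coset_image open_map_def)

lemma compactin_l_coset: "a \<in> carrier G \<Longrightarrow> compactin T U \<Longrightarrow> compactin T (a <# U)"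
  using image_compactin[OF _ continuous_map_left_translation, of U a]
  by (simp add: l_coset_image)

lemma mem_l_coset_iff:
  assumes "a \<in> carrier G" "x \<in> carrier G" "U \<subseteq> carrier G"
  shows "x \<in> a <# U \<longleftrightarrow> inv a \<otimes> x \<in> U"
proof
  assume "x \<in> a <# U"
  then show "inv a \<otimes> x \<in> U" using assms by (auto simp: l_coset_def m_assoc[symmetric] subset_iff)
next
  assume "inv a \<otimes> x \<in> U"
  moreover have "x = a \<otimes> (inv a \<otimes> x)" using assms by (simp add: m_assoc[symmetric])
  ultimately show "x \<in> a <# U" unfolding l_coset_def by blast
qed

lemma l_coset_subset_carrier: "a \<in> carrier G \<Longrightarrow> U \<subseteq> carrier G \<Longrightarrow> a <# U \<subseteq> carrier G"
  by (auto simp: l_coset_def)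

lemma open_subgroupI:
  assumes S: "subgroup S G" and U: "openin T U" "U \<noteq> {}" "U \<subseteq> S"
  shows "openin T S"
proof -
  obtain u where u: "u \<in> U" using U by auto
  have uS: "u \<in> S" using u U by auto
  have "\<exists>V. openin T V \<and> x \<in> V \<and> V \<subseteq> S" if x: "x \<in> S" for x
  proof (intro exI conjI)
    let ?a = "x \<otimes> inv u"
    have a: "?a \<in> S" using S x uS by (simp add: subgroup.m_closed subgroup.m_inv_closed)
    have aG: "?a \<in> carrier G" "x \<in> carrier G" "u \<in> carrier G"
      using a x uS subgroup.mem_carrier[OF S] by auto
    show "openin T (?a <# U)" using openin_l_coset aG U by simp
    have "x = ?a \<otimes> u" using aG by (simp add: m_assoc)
    then show "x \<in> ?a <# U" using u unfolding l_coset_def by blast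
    show "?a <# U \<subseteq> S" using a U S by (auto simp: l_coset_def intro: subgroup.m_closed)
  qed
  then show ?thesis by (subst openin_subopen) blast
qed

lemma open_subgroup_closed:
  assumes S: "subgroup S G" and "openin T S"
  shows "closedin T S"
proof -
  have SG: "S \<subseteq> carrier G" by (rule subgroup.subset[OF S])
  have "carrier G - S = (\<Union>x\<in>carrier G - S. x <# S)"
  proof (intro equalityI subsetI)
    fix x assume x: "x \<in> carrier G - S"
    then have "x \<in> x <# S" using mem_l_coset_iff[of x x S] SG S by (simp add: subgroup.one_closed)
    then show "x \<in> (\<Union>x\<in>carrier G - S. x <# S)" using x by blast
  next
    fix y assume "y \<in> (\<Union>x\<in>carrier G - S. x <# S)"
    then obtain x s where x: "x \<in> carrier G" "x \<notin> S" and s: "s \<in> S" and y: "y = x \<otimes> s"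
      by (auto simp: l_coset_def)
    have "y \<notin> S"
    proof
      assume "y \<in> S"
      then have "y \<otimes> inv s \<in> S" using S s by (simp add: subgroup.m_closed subgroup.m_inv_closed)
      moreover have "y \<otimes> inv s = x" using x s SG y by (simp add: m_assoc subset_iff)
      ultimately show False using x by simp
    qed
    then show "y \<in> carrier G - S" using y x s SG by auto
  qed
  moreover have "openin T (\<Union>x\<in>carrier G - S. x <# S)"
    using assms by (intro openin_Union) (auto intro: openin_l_coset)
  ultimately show ?thesis using SG by (simp add: closedin_def topspace_eq)
qed

lemma compact_open_subgroupD:
  assumes "compact_open_subgroup G T K"
  shows "subgroup K G" "openin T K" "compactin T K" "closedin T K" "K \<subseteq> carrier G" "\<one> \<in> K"
  using assms open_subgroup_closed
  by (auto simp: compact_open_subgroup_def subgroup.subset subgroup.one_closed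
      dest: subgroup.subset)

lemma compact_open_subgroupI:
  assumes "subgroup S G" "openin T S" "S \<subseteq> K" "compactin T K"
  shows "compact_open_subgroup G T S"
  using assms open_subgroup_closed[of S] closed_compactin[of T K S]
  by (simp add: compact_open_subgroup_def)

lemma compact_open_subgroup_Int_open:
  assumes "compact_open_subgroup G T K" "subgroup S G" "openin T S"
  shows "compact_open_subgroup G T (K \<inter> S)"
  using assms compact_open_subgroupD[OF assms(1)] 
  by (intro compact_open_subgroupI[of _ K]) (auto intro: subgroups_Inter_pair)

lemma compact_open_subgroup_Int:
  assumes "compact_open_subgroup G T K" "compact_open_subgroup G T L"
  shows "compact_open_subgroup G T (K \<inter> L)"
  using assms compact_open_subgroup_Int_open compact_open_subgroupD by blast

text \<open>The \<open>x\<close> that move a point of \<open>B\<close> out of \<open>U\<close> form the first projection of a closed set, and the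
  projection along a compact set is closed (tube lemma).\<close>

lemma openin_translates_inside:
  assumes B: "compactin T B" and U: "openin T U"
  shows "openin T {x \<in> carrier G. x <# B \<subseteq> U}"
proof -
  let ?P = "prod_topology T (subtopology T B)"
  let ?C = "{z \<in> topspace ?P. (case z of (x, y) \<Rightarrow> x \<otimes> y) \<in> carrier G - U}"
  have BG: "B \<subseteq> carrier G" by (rule compact_subset_carrier[OF B])
  have "continuous_map ?P T (\<lambda>(x, y). x \<otimes> y)"
    unfolding prod_topology_subtopology(2) by (rule continuous_map_from_subtopology[OF continuous_mult])
  moreover have "closedin T (carrier G - U)"
    using U by (rule closedin_complement)
  ultimately have "closedin ?P ?C" by (rule closedin_continuous_map_preimage)
  moreover have "closed_map ?P T fst"
    by (rule closed_map_fst) (simp add: B compact_space_subtopology)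
  ultimately have "closedin T (fst ` ?C)" by (simp add: closed_map_def)
  then have "openin T (carrier G - fst ` ?C)" by (rule openin_complement)
  moreover have "{x \<in> carrier G. x <# B \<subseteq> U} = carrier G - fst ` ?C"
    using BG by (force simp: topspace_eq l_coset_def)
  ultimately show ?thesis by simp
qed

lemma subgroup_stabilizer:
  assumes B: "B \<subseteq> carrier G"
  shows "subgroup {x \<in> carrier G. x <# B = B} G"
proof
  show "{x \<in> carrier G. x <# B = B} \<subseteq> carrier G" by auto
  show "\<one> \<in> {x \<in> carrier G. x <# B = B}" using B lcos_mult_one by simp
  fix x assume x: "x \<in> {x \<in> carrier G. x <# B = B}"
  show "inv x \<in> {x \<in> carrier G. x <# B = B}"
    using x B lcos_m_assoc[of B "inv x" x] lcos_mult_one[OF B] by simp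
  fix y assume "y \<in> {x \<in> carrier G. x <# B = B}"
  then show "x \<otimes> y \<in> {x \<in> carrier G. x <# B = B}" 
    using x B lcos_m_assoc[of B x y] by simp
qed

text \<open>The translates that keep \<open>B\<close> inside itself form an open set; intersecting it with its inverse
  leaves exactly the stabilizer.\<close>

lemma openin_stabilizer:
  assumes B: "compactin T B" "openin T B"
  shows "openin T {x \<in> carrier G. x <# B = B}"
proof -
  let ?V = "{x \<in> carrier G. x <# B \<subseteq> B}"
  let ?W = "?V \<inter> {x \<in> topspace T. inv x \<in> ?V}"
  have BG: "B \<subseteq> carrier G" by (rule compact_subset_carrier[OF B(1)])
  have V: "openin T ?V" using openin_translates_inside[OF B] .
  have "openin T ?W"
    using V openin_continuous_map_preimage[OF continuous_inv V] by auto
  moreover have "?W = {x \<in> carrier G. x <# B = B}"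
  proof (intro equalityI subsetI)
    fix x assume x: "x \<in> ?W"
    have "B = x <# (inv x <# B)"
      using x BG lcos_m_assoc[of B x "inv x"] lcos_mult_one[OF BG] by (simp add: topspace_eq)
    also have "\<dots> \<subseteq> x <# B" using x by (auto simp: l_coset_def)
    finally show "x \<in> {x \<in> carrier G. x <# B = B}" using x by auto
  next
    fix x assume x: "x \<in> {x \<in> carrier G. x <# B = B}"
    then have "inv x \<in> {x \<in> carrier G. x <# B = B}"
      using subgroup.m_inv_closed[OF subgroup_stabilizer[OF BG]] by blast
    then show "x \<in> ?W" using x by (auto simp: topspace_eq)
  qed
  ultimately show ?thesis by simp
qed

text \<open>If \<open>B\<close> contains the identity, its stabilizer lies in \<open>B\<close>, as \<open>x = x \<otimes> \<one>\<close>.\<close>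

lemma compact_open_contains_subgroup:
  assumes B: "compactin T B" "openin T B" "\<one> \<in> B"
  shows "\<exists>K. compact_open_subgroup G T K \<and> K \<subseteq> B"
proof -
  let ?K = "{x \<in> carrier G. x <# B = B}"
  have BG: "B \<subseteq> carrier G" by (rule compact_subset_carrier[OF B(1)])
  have "?K \<subseteq> B"
  proof
    fix x assume x: "x \<in> ?K"
    then have "x \<otimes> \<one> \<in> x <# B" using B(3) unfolding l_coset_def by blast
    then show "x \<in> B" using x by auto
  qed
  then show ?thesis
    using compact_open_subgroupI[OF subgroup_stabilizer[OF BG] openin_stabilizer[OF B(1,2)] _ B(1)]
    by blast
qed

end

context tdlc_group
begin

text \<open>In a compact Hausdorff space quasi-components are connected, hence here points; applied to a
  compact neighbourhood, this separates the identity from the boundary by a clopen set, which is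
  then open in the whole group.\<close>

lemma compact_open_neighbourhood:
  assumes U: "openin T U" "\<one> \<in> U"
  shows "\<exists>B. compactin T B \<and> openin T B \<and> \<one> \<in> B \<and> B \<subseteq> U"
proof -
  obtain V K where VK: "openin T V" "compactin T K" "\<one> \<in> V" "V \<subseteq> K"
    using locally_compact unfolding locally_compact_space_def topspace_eq by (meson one_closed)
  have KT: "K \<subseteq> topspace T" by (rule compactin_subset_topspace[OF VK(2)])
  let ?X = "subtopology T K"
  have X: "topspace ?X = K" using KT by auto
  have oX: "openin ?X (U \<inter> V)" using U VK by (auto simp: openin_subtopology)
  have "separated_between ?X {\<one>} (K - (U \<inter> V))"
  proof (rule cut_wire_fence_theorem)
    show "compact_space ?X" using VK by (simp add: compact_space_subtopology)
    show H: "Hausdorff_space ?X" using Hausdorff by (simp add: Hausdorff_space_subtopology)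
    show "closedin ?X {\<one>}" using VK X by (intro closedin_Hausdorff_singleton[OF H]) auto
    show "closedin ?X (K - (U \<inter> V))" using oX X by (metis closedin_diff closedin_topspace)
    fix C assume "connectedin ?X C"
    then have "connectedin T C" by (simp add: connectedin_subtopology)
    then obtain a where "C \<subseteq> {a}"
      using totally_disconnected by (auto simp: totally_disconnected_space_def)
    then show "disjnt C {\<one>} \<or> disjnt C (K - U \<inter> V)" using U VK by (auto simp: disjnt_def)
  qed
  then obtain B where B: "closedin ?X B" "openin ?X B" "{\<one>} \<subseteq> B" "K - (U \<inter> V) \<subseteq> topspace ?X - B"
    unfolding separated_between by blast
  have BUV: "B \<subseteq> U \<inter> V" using B(4) closedin_subset[OF B(1)] X by auto
  have "compactin T B"
    using closed_compactin[of ?X K B] B(1) VK closedin_subset[OF B(1)] X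
    by (metis compactin_subtopology compact_space_def compact_space_subtopology)
  moreover have "openin T B"
  proof -
    obtain W where W: "openin T W" "B = W \<inter> K" using B(2) by (auto simp: openin_subtopology)
    then have "B = W \<inter> V" using BUV VK(4) by auto
    then show ?thesis using W VK(1) by auto
  qed
  ultimately show ?thesis using B(3) BUV by blast
qed

text \<open>The stabilizer of a compact open neighbourhood inside \<open>U\<close> is the required subgroup.\<close>

theorem van_Dantzig:
  assumes U: "openin T U" "\<one> \<in> U"
  shows "\<exists>K. compact_open_subgroup G T K \<and> K \<subseteq> U"
proof -
  obtain B where B: "compactin T B" "openin T B" "\<one> \<in> B" "B \<subseteq> U"
    using compact_open_neighbourhood[OF U] by blast
  then show ?thesis using compact_open_contains_subgroup[OF B(1-3)] by blast
qed

lemma ex_compact_open_subgroup: "\<exists>K. compact_open_subgroup G T K"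
  using van_Dantzig[OF openin_topspace] by (auto simp: topspace_eq)

lemma compact_open_subgroup_avoiding:
  assumes C: "closedin T C" and x: "x \<in> carrier G" "x \<notin> C"
  shows "\<exists>K. compact_open_subgroup G T K \<and> (x <# K) \<inter> C = {}"
proof -
  have xC: "x \<in> carrier G - C" using x by simp
  have oC: "openin T (carrier G - C)" using C by (rule openin_complement)
  have o: "openin T (inv x <# (carrier G - C))"
    using x oC by (intro openin_l_coset) auto
  have one: "\<one> \<in> inv x <# (carrier G - C)"
    unfolding l_coset_def using x xC by (auto intro!: bexI[of _ x])
  obtain K where K: "compact_open_subgroup G T K" "K \<subseteq> inv x <# (carrier G - C)"
    using van_Dantzig[OF o one] by blast
  have "x <# K \<subseteq> x <# (inv x <# (carrier G - C))" using K(2) by (auto simp: l_coset_def)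
  also have "\<dots> = carrier G - C"
    using x lcos_m_assoc[of "carrier G - C" x "inv x"] lcos_mult_one[of "carrier G - C"] by auto
  finally show ?thesis using K by blast
qed

lemma compact_open_subgroups_separate:
  assumes x: "x \<in> carrier G" "x \<noteq> \<one>"
  shows "\<exists>K. compact_open_subgroup G T K \<and> x \<notin> K"
proof -
  have "openin T (carrier G - {x})"
    using x by (intro openin_complement closedin_Hausdorff_singleton[OF Hausdorff]) (simp add: topspace_eq)
  then show ?thesis using van_Dantzig[of "carrier G - {x}"] x by auto
qed

end

text \<open>The converse of van Dantzig's theorem, by which quotients are recognised: distinct points lie in
  different cosets of some compact open subgroup, and these cosets are clopen.\<close>

lemma (in topological_group) tdlc_groupI:
  assumes base: "\<And>U. openin T U \<Longrightarrow> \<one> \<in> U \<Longrightarrow> \<exists>K. compact_open_subgroup G T K \<and> K \<subseteq> U"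
    and sep: "\<And>x. x \<in> carrier G \<Longrightarrow> x \<noteq> \<one> \<Longrightarrow> \<exists>K. compact_open_subgroup G T K \<and> x \<notin> K"
  shows "tdlc_group G T"
proof -
  have self: "x \<in> x <# K" if "compact_open_subgroup G T K" "x \<in> carrier G" for x K
    using that compact_open_subgroupD[OF that(1)] by (simp add: mem_l_coset_iff)
  have sep2: "\<exists>K. compact_open_subgroup G T K \<and> inv x \<otimes> y \<notin> K"
    if "x \<in> carrier G" "y \<in> carrier G" "x \<noteq> y" for x y
    using sep[of "inv x \<otimes> y"] that
    by (metis inv_closed inv_inv inv_equality m_closed)
  have disj: "(x <# K) \<inter> (y <# K) = {}"
    if K: "compact_open_subgroup G T K" and xy: "x \<in> carrier G" "y \<in> carrier G" "inv x \<otimes> y \<notin> K" for x y K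
  proof (rule ccontr)
    note KD = compact_open_subgroupD[OF K]
    assume "(x <# K) \<inter> (y <# K) \<noteq> {}"
    then obtain k l where kl: "k \<in> K" "l \<in> K" "x \<otimes> k = y \<otimes> l" by (auto simp: l_coset_def)
    have "k \<in> carrier G" "l \<in> carrier G" using kl KD by auto
    then have "inv x \<otimes> y = k \<otimes> inv l" using kl(3) xy
      by (metis inv_closed inv_solve_left m_assoc m_closed inv_solve_right)
    moreover have "k \<otimes> inv l \<in> K" using kl KD(1) by (simp add: subgroup.m_closed subgroup.m_inv_closed)
    ultimately show False using xy(3) by simp
  qed
  have clopen: "openin T (x <# K)" "compactin T (x <# K)"
    if "compact_open_subgroup G T K" "x \<in> carrier G" for x K
    using that compact_open_subgroupD[OF that(1)] by (simp_all add: openin_l_coset compactin_l_coset)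
  obtain K0 where K0: "compact_open_subgroup G T K0" using base[OF openin_topspace] by (auto simp: topspace_eq)
  have H: "Hausdorff_space T"
    unfolding Hausdorff_space_def topspace_eq
    using sep2 disj clopen self by (metis disjnt_def)
  show ?thesis
  proof unfold_locales
    show "locally_compact_space T"
      unfolding locally_compact_space_def topspace_eq using clopen[OF K0] self[OF K0] by blast
    show "Hausdorff_space T" by (rule H)
    show "totally_disconnected_space T"
      unfolding totally_disconnected_space_def
    proof (intro allI impI)
      fix C assume C: "connectedin T C"
      have CG: "C \<subseteq> carrier G" using connectedin_subset_topspace[OF C] by (simp add: topspace_eq)
      have "x = y" if xy: "x \<in> C" "y \<in> C" for x y
      proof (rule ccontr)
        assume ne: "x \<noteq> y"
        have xyG: "x \<in> carrier G" "y \<in> carrier G" using xy CG by auto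
        obtain K where K: "compact_open_subgroup G T K" "inv x \<otimes> y \<notin> K"
          using sep2[OF xyG ne] by blast
        let ?A = "x <# K"
        have "openin T ?A" "closedin T ?A"
          using clopen[OF K(1) xyG(1)] compactin_imp_closedin[OF H] by auto
        then have "C \<subseteq> ?A \<or> disjnt C ?A" using C by (metis connectedin_clopen_cases)
        then show False 
          using xy self[OF K(1) xyG(1)] self[OF K(1) xyG(2)] disj[OF K(1) xyG K(2)]
          by (auto simp: disjnt_iff)
      qed
      then show "\<exists>a. C \<subseteq> {a}" by (metis singleton_iff subsetI)
    qed
  qed
qed

section \<open>Subgroups and quotients\<close>

lemma r_coset_carrier_update [simp]: "r_coset (G\<lparr>carrier := H\<rparr>) K x = r_coset G K x"
  by (simp add: r_coset_def)

lemma (in group) r_coset_eq_iff: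
  assumes "subgroup H G" "x \<in> carrier G" "y \<in> carrier G"
  shows "H #> x = H #> y \<longleftrightarrow> x \<otimes> inv y \<in> H"
proof
  assume "H #> x = H #> y"
  then have "x \<in> H #> y" using assms rcos_self by blast
  then obtain h where "h \<in> H" "x = h \<otimes> y" by (auto simp: r_coset_def)
  then show "x \<otimes> inv y \<in> H" using assms subgroup.mem_carrier[OF assms(1)] by (simp add: m_assoc)
next
  assume xy: "x \<otimes> inv y \<in> H"
  have "x = (x \<otimes> inv y) \<otimes> y" using assms by (simp add: m_assoc)
  then have "x \<in> H #> y" unfolding r_coset_def using xy by blast
  then show "H #> x = H #> y" using repr_independence assms by metis
qed

lemmas (in group) r_coset_eqI = r_coset_eq_iff[THEN iffD2]
lemmas (in group) r_coset_eqD = r_coset_eq_iff[THEN iffD1]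

lemma (in topological_group) topological_group_subgroup:
  assumes H: "subgroup H G"
  shows "topological_group (G\<lparr>carrier := H\<rparr>) (subtopology T H)"
proof -
  interpret H: group "G\<lparr>carrier := H\<rparr>" by (rule subgroup.subgroup_is_group[OF H group_axioms])
  have HG: "H \<subseteq> carrier G" by (rule subgroup.subset[OF H])
  show ?thesis
  proof
    show "topspace (subtopology T H) = carrier (G\<lparr>carrier := H\<rparr>)" using HG by (auto simp: topspace_eq)
    have "continuous_map (prod_topology (subtopology T H) (subtopology T H)) T (\<lambda>(x, y). x \<otimes> y)"
      unfolding subtopology_Times[symmetric] by (rule continuous_map_from_subtopology[OF continuous_mult])
    then show "continuous_map (prod_topology (subtopology T H) (subtopology T H)) (subtopology T H)
        (\<lambda>(x, y). x \<otimes>\<^bsub>G\<lparr>carrier := H\<rparr>\<^esub> y)"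
      using H by (auto simp: continuous_map_in_subtopology subgroup.m_closed)
    have "continuous_map (subtopology T H) (subtopology T H) (\<lambda>x. inv x)"
      using H continuous_map_from_subtopology[OF continuous_inv]
      by (auto simp: continuous_map_in_subtopology subgroup.m_inv_closed)
    then show "continuous_map (subtopology T H) (subtopology T H) (\<lambda>x. inv\<^bsub>G\<lparr>carrier := H\<rparr>\<^esub> x)"
      using H by (auto elim!: continuous_map_eq)
  qed
qed

lemma (in tdlc_abelian_group) tdlc_abelian_group_closed_subgroup:
  assumes H: "subgroup H G" and cl: "closedin T H"
  shows "tdlc_abelian_group (G\<lparr>carrier := H\<rparr>) (subtopology T H)"
proof -
  interpret H: topological_group "G\<lparr>carrier := H\<rparr>" "subtopology T H"
    by (rule topological_group_subgroup[OF H])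
  show ?thesis
  proof unfold_locales
    show "locally_compact_space (subtopology T H)"
      using locally_compact cl by (rule locally_compact_space_closed_subset)
    show "Hausdorff_space (subtopology T H)" using Hausdorff by (rule Hausdorff_space_subtopology)
    show "totally_disconnected_space (subtopology T H)"
      using totally_disconnected
      by (simp add: totally_disconnected_space_def connectedin_subtopology)
    show "\<And>x y. x \<in> carrier (G\<lparr>carrier := H\<rparr>) \<Longrightarrow> y \<in> carrier (G\<lparr>carrier := H\<rparr>) \<Longrightarrow>
        x \<otimes>\<^bsub>G\<lparr>carrier := H\<rparr>\<^esub> y = y \<otimes>\<^bsub>G\<lparr>carrier := H\<rparr>\<^esub> x"
      using subgroup.subset[OF H] by (auto intro!: m_comm)
  qed
qed

context topological_group
begin

lemma compact_open_subgroup_restrict: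
  assumes K: "compact_open_subgroup G T K" and H: "subgroup H G" "closedin T H"
  shows "compact_open_subgroup (G\<lparr>carrier := H\<rparr>) (subtopology T H) (K \<inter> H)"
proof -
  note KD = compact_open_subgroupD[OF K]
  have "subgroup (K \<inter> H) G" using subgroups_Inter_pair[OF KD(1) H(1)] .
  then have "subgroup (K \<inter> H) (G\<lparr>carrier := H\<rparr>)" using H(1) subgroup_incl[of "K \<inter> H" H] by simp
  moreover have "openin (subtopology T H) (K \<inter> H)"
    using KD by (auto simp: openin_subtopology)
  moreover have "compactin (subtopology T H) (K \<inter> H)"
    using KD H compact_Int_closedin by (auto simp: compactin_subtopology)
  ultimately show ?thesis by (simp add: compact_open_subgroup_def)
qed

abbreviation quotient_topology :: "'a set \<Rightarrow> 'a set topology" where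
  "quotient_topology H \<equiv> quotient_group_topology G T H"

lemma topspace_quotient_topology: "topspace (quotient_topology H) = carrier (G Mod H)"
  using quotient_map_quotient_group_topology[of H]
  by (auto simp: quotient_map_def carrier_FactGroup topspace_eq)

lemma continuous_map_coset: "continuous_map T (quotient_topology H) (\<lambda>x. H #> x)"
  using quotient_map_quotient_group_topology by (rule quotient_imp_continuous_map)

text \<open>The saturation of an open set is a union of translates of it.\<close>

lemma open_map_coset:
  assumes H: "subgroup H G"
  shows "open_map T (quotient_topology H) (\<lambda>x. H #> x)"
  unfolding open_map_def
proof (intro allI impI)
  fix U assume U: "openin T U"
  have UG: "U \<subseteq> carrier G" using openin_subset[OF U] by (simp add: topspace_eq)
  have HG: "H \<subseteq> carrier G" by (rule subgroup.subset[OF H])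
  have "{x \<in> carrier G. H #> x \<in> (\<lambda>x. H #> x) ` U} = (\<Union>h\<in>H. h <# U)"
  proof (intro equalityI subsetI)
    fix x assume "x \<in> {x \<in> carrier G. H #> x \<in> (\<lambda>x. H #> x) ` U}"
    then obtain u where u: "u \<in> U" "H #> x = H #> u" and x: "x \<in> carrier G" by auto
    then have "x \<in> H #> u" using H rcos_self by blast
    then show "x \<in> (\<Union>h\<in>H. h <# U)" using u by (auto simp: r_coset_def l_coset_def)
  next
    fix x assume "x \<in> (\<Union>h\<in>H. h <# U)"
    then obtain h u where h: "h \<in> H" "u \<in> U" "x = h \<otimes> u" by (auto simp: l_coset_def)
    have hG: "h \<in> carrier G" "u \<in> carrier G" using h HG UG by auto
    then have "H #> x = H #> u" using h H by (simp add: r_coset_eq_iff m_assoc)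
    then show "x \<in> {x \<in> carrier G. H #> x \<in> (\<lambda>x. H #> x) ` U}" using h hG by auto
  qed
  moreover have "openin T (\<Union>h\<in>H. h <# U)"
    using HG U by (intro openin_Union) (auto intro: openin_l_coset)
  ultimately show "openin (quotient_topology H) ((\<lambda>x. H #> x) ` U)"
    using UG by (auto simp: openin_quotient_group_topology carrier_FactGroup)
qed

lemma topological_group_quotient:
  assumes N: "H \<lhd> G"
  shows "topological_group (G Mod H) (quotient_topology H)"
proof -
  interpret N: normal H G by fact
  have H: "subgroup H G" by (rule N.subgroup_axioms)
  interpret Q: group "G Mod H" by (rule N.factorgroup_is_group)
  let ?Q = "quotient_topology H" and ?q = "\<lambda>x. H #> x"
  have car: "carrier (G Mod H) = ?q ` carrier G" by (rule carrier_FactGroup)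
  have qc: "?q x \<in> carrier (G Mod H)" if "x \<in> carrier G" for x using that by (auto simp: car)
  show ?thesis
  proof
    show "topspace ?Q = carrier (G Mod H)" by (rule topspace_quotient_topology)
    show "continuous_map (prod_topology ?Q ?Q) ?Q (\<lambda>(x, y). x \<otimes>\<^bsub>G Mod H\<^esub> y)"
      unfolding continuous_map_def
    proof (intro conjI allI impI)
      show "(\<lambda>(x, y). x \<otimes>\<^bsub>G Mod H\<^esub> y) \<in> topspace (prod_topology ?Q ?Q) \<rightarrow> topspace ?Q"
        by (auto simp: topspace_quotient_topology simp del: mult_FactGroup)
      fix W assume W: "openin ?Q W"
      let ?S = "{z \<in> topspace (prod_topology ?Q ?Q). (case z of (x, y) \<Rightarrow> x \<otimes>\<^bsub>G Mod H\<^esub> y) \<in> W}"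
      let ?P = "{z \<in> topspace (prod_topology T T). (case z of (x, y) \<Rightarrow> ?q (x \<otimes> y)) \<in> W}"
      have "continuous_map (prod_topology T T) ?Q (\<lambda>z. ?q (case z of (x, y) \<Rightarrow> x \<otimes> y))"
        using continuous_map_compose[OF continuous_mult continuous_map_coset[of H]] by (simp add: o_def)
      from openin_continuous_map_preimage[OF this W]
      have P: "openin (prod_topology T T) ?P" by (simp add: case_prod_unfold)
      show "openin (prod_topology ?Q ?Q) ?S"
        unfolding openin_prod_topology_alt
      proof (intro allI impI)
        fix X Y assume XY: "(X, Y) \<in> ?S"
        then have "X \<in> ?q ` carrier G" "Y \<in> ?q ` carrier G"
          by (simp_all add: topspace_quotient_topology car)
        then obtain x y where xy: "x \<in> carrier G" "y \<in> carrier G" "X = ?q x" "Y = ?q y"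
          by blast
        then have "(x, y) \<in> ?P" using XY by (auto simp: topspace_eq N.rcos_sum)
        with P[unfolded openin_prod_topology_alt]
        obtain U V where UV: "openin T U" "openin T V" "x \<in> U" "y \<in> V" "U \<times> V \<subseteq> ?P"
          by meson
        have sub: "U \<subseteq> carrier G" "V \<subseteq> carrier G" using UV(1,2)[THEN openin_subset] by (simp_all add: topspace_eq)
        show "\<exists>U V. openin ?Q U \<and> openin ?Q V \<and> X \<in> U \<and> Y \<in> V \<and> U \<times> V \<subseteq> ?S"
        proof (intro exI conjI)
          show "openin ?Q (?q ` U)" "openin ?Q (?q ` V)"
            using open_map_coset[OF H] UV by (auto simp: open_map_def)
          show "X \<in> ?q ` U" "Y \<in> ?q ` V" using xy UV by auto
          show "?q ` U \<times> ?q ` V \<subseteq> ?S"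
          proof
            fix z assume "z \<in> ?q ` U \<times> ?q ` V"
            then obtain u v where uv: "u \<in> U" "v \<in> V" "z = (?q u, ?q v)" by auto
            then have "(u, v) \<in> ?P" using UV by blast
            then show "z \<in> ?S"
              using uv sub by (auto simp: topspace_quotient_topology qc N.rcos_sum subset_iff)
          qed
        qed
      qed
    qed
    have inv: "inv\<^bsub>G Mod H\<^esub> (?q x) = ?q (inv x)" if "x \<in> carrier G" for x
      using that N.inv_FactGroup[OF qc[OF that]] by (simp add: N.rcos_inv)
    have "continuous_map T ?Q (\<lambda>x. ?q (inv x))"
      using continuous_map_compose[OF continuous_inv continuous_map_coset[of H]] by (simp add: o_def)
    then have "continuous_map T ?Q (\<lambda>x. inv\<^bsub>G Mod H\<^esub> (?q x))"
      by (rule continuous_map_eq) (simp add: inv topspace_eq)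
    then show "continuous_map ?Q ?Q (\<lambda>x. inv\<^bsub>G Mod H\<^esub> x)"
      using continuous_compose_quotient_map[OF quotient_map_quotient_group_topology[of H], of ?Q "\<lambda>x. inv\<^bsub>G Mod H\<^esub> x"]
      by (simp add: o_def)
  qed
qed

lemma compact_open_subgroup_quotient:
  assumes N: "H \<lhd> G" and K: "compact_open_subgroup G T K"
  shows "compact_open_subgroup (G Mod H) (quotient_topology H) ((\<lambda>x. H #> x) ` K)"
proof -
  interpret N: normal H G by fact
  interpret q: group_hom G "G Mod H" "\<lambda>x. H #> x"
    by (intro group_hom.intro group_hom_axioms.intro is_group N.factorgroup_is_group
        N.r_coset_hom_Mod)
  note KD = compact_open_subgroupD[OF K]
  show ?thesis
    unfolding compact_open_subgroup_def
    using q.subgroup_img_is_subgroup[OF KD(1)] open_map_coset[OF N.subgroup_axioms] KD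
      image_compactin[OF KD(3) continuous_map_coset] by (auto simp: open_map_def)
qed

end

lemma (in tdlc_abelian_group) tdlc_abelian_group_quotient:
  assumes H: "subgroup H G" and cl: "closedin T H"
  shows "tdlc_abelian_group (G Mod H) (quotient_topology H)"
proof -
  have N: "H \<lhd> G" by (rule subgroup_imp_normal[OF H])
  interpret N: normal H G by fact
  interpret Q: comm_group "G Mod H" by (rule abelian_FactGroup[OF H])
  interpret Q: topological_group "G Mod H" "quotient_topology H"
    by (rule topological_group_quotient[OF N])
  let ?q = "\<lambda>x. H #> x"
  have "tdlc_group (G Mod H) (quotient_topology H)"
  proof (rule Q.tdlc_groupI)
    fix U assume U: "openin (quotient_topology H) U" "\<one>\<^bsub>G Mod H\<^esub> \<in> U"
    let ?V = "{x \<in> topspace T. ?q x \<in> U}"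
    have "openin T ?V" using openin_continuous_map_preimage[OF continuous_map_coset U(1)] .
    moreover have "?q \<one> = H" using coset_join2[OF one_closed H] H by (simp add: subgroup.one_closed)
    then have "\<one> \<in> ?V" using U by (simp add: topspace_eq)
    ultimately obtain K where "compact_open_subgroup G T K" "K \<subseteq> ?V" using van_Dantzig by blast
    then show "\<exists>K. compact_open_subgroup (G Mod H) (quotient_topology H) K \<and> K \<subseteq> U"
      using compact_open_subgroup_quotient[OF N] by blast
  next
    fix X assume X: "X \<in> carrier (G Mod H)" "X \<noteq> \<one>\<^bsub>G Mod H\<^esub>"
    then obtain x where x: "x \<in> carrier G" "X = ?q x" by (auto simp: carrier_FactGroup)
    then have "x \<notin> H" using X(2) coset_join2[OF _ H] by auto
    then obtain K where K: "compact_open_subgroup G T K" "(x <# K) \<inter> H = {}"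
      using compact_open_subgroup_avoiding[OF cl x(1)] by blast
    note KD = compact_open_subgroupD[OF K(1)]
    have "X \<notin> ?q ` K"
    proof
      assume "X \<in> ?q ` K"
      then obtain k where k: "k \<in> K" "?q x = ?q k" using x by auto
      then have "x \<otimes> inv k \<in> H" using r_coset_eq_iff[OF H x(1), of k] KD by auto
      moreover have "x \<otimes> inv k \<in> x <# K"
        using k KD(1) by (auto simp: l_coset_def subgroup.m_inv_closed)
      ultimately show False using K(2) by blast
    qed
    then show "\<exists>K. compact_open_subgroup (G Mod H) (quotient_topology H) K \<and> X \<notin> K"
      using compact_open_subgroup_quotient[OF N K(1)] by blast
  qed
  then interpret Q: tdlc_group "G Mod H" "quotient_topology H" .
  show ?thesis by unfold_locales
qed

section \<open>Counting cosets\<close>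

definition coset_index :: "('a, 'b) monoid_scheme \<Rightarrow> 'a set \<Rightarrow> 'a set \<Rightarrow> nat" where
  "coset_index G A B = card ((\<lambda>x. B #>\<^bsub>G\<^esub> x) ` A)"

lemma coset_index_carrier_update [simp]:
  "coset_index (G\<lparr>carrier := H\<rparr>) A B = coset_index G A B"
  by (simp add: coset_index_def)

context group
begin

text \<open>\<open>K\<close> need not be a subgroup here, only a union of cosets of \<open>W\<close>: besides the multiplicativity of
  the index, this covers the independence of the Haar content of a compact open set \<open>K\<close> from the
  subgroup used to measure it.\<close>

lemma coset_index_tower:
  assumes V: "subgroup V G" and W: "subgroup W G" and VW: "V \<subseteq> W" and K: "K \<subseteq> carrier G"
    and inv: "\<And>w k. w \<in> W \<Longrightarrow> k \<in> K \<Longrightarrow> w \<otimes> k \<in> K"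
    and fin: "finite ((\<lambda>x. W #> x) ` K)" "finite ((\<lambda>x. V #> x) ` W)"
  shows "coset_index G K V = coset_index G K W * coset_index G W V"
proof -
  let ?v = "\<lambda>x. V #> x" and ?w = "\<lambda>x. W #> x"
  have VG: "V \<subseteq> carrier G" and WG: "W \<subseteq> carrier G" using V W by (auto simp: subgroup.subset)
  have coset: "?w k \<subseteq> K" if "k \<in> K" for k using that inv by (auto simp: r_coset_def)
  have UN: "?v ` K = (\<Union>C\<in>?w ` K. ?v ` C)"
  proof (intro equalityI subsetI)
    fix D assume "D \<in> ?v ` K"
    then obtain k where k: "k \<in> K" "D = ?v k" by auto
    then have "k \<in> ?w k" by (intro rcos_self[OF _ W]) (use K in auto)
    then show "D \<in> (\<Union>C\<in>?w ` K. ?v ` C)" using k by blast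
  next
    fix D assume "D \<in> (\<Union>C\<in>?w ` K. ?v ` C)"
    then obtain k x where "k \<in> K" "x \<in> ?w k" "D = ?v x" by blast
    then show "D \<in> ?v ` K" using coset[of k] by blast
  qed
  have fiber: "?v ` ?w k = (\<lambda>D. D #> k) ` (?v ` W)" if "k \<in> K" for k
  proof -
    have "?v ` ?w k = (\<lambda>w. V #> (w \<otimes> k)) ` W" by (auto simp: r_coset_def)
    also have "\<dots> = (\<lambda>w. (V #> w) #> k) ` W"
      using that K WG VG by (intro image_cong refl) (simp add: coset_mult_assoc subset_iff)
    finally show ?thesis by (simp add: image_image)
  qed
  have card: "finite (?v ` C) \<and> card (?v ` C) = coset_index G W V" if C: "C \<in> ?w ` K" for C
  proof -
    obtain k where k: "k \<in> K" "C = ?w k" using C by auto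
    have kG: "k \<in> carrier G" using k K by auto
    have "inj_on (\<lambda>D. D #> k) (?v ` W)"
    proof (rule inj_onI)
      fix D E assume DE: "D \<in> ?v ` W" "E \<in> ?v ` W" "D #> k = E #> k"
      have sub: "D \<subseteq> carrier G" "E \<subseteq> carrier G"
        using DE(1,2) VG WG by (auto simp: r_coset_def subset_iff)
      then have "(D #> k) #> inv k = D" "(E #> k) #> inv k = E"
        using kG by (simp_all add: coset_mult_assoc)
      then show "D = E" using DE(3) by metis
    qed
    then show ?thesis using fiber[OF k(1)] k fin by (simp add: coset_index_def card_image)
  qed
  have disj: "?v ` C \<inter> ?v ` C' = {}" if C: "C \<in> ?w ` K" "C' \<in> ?w ` K" "C \<noteq> C'" for C C'
  proof (rule ccontr)
    assume "?v ` C \<inter> ?v ` C' \<noteq> {}"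
    then obtain c c' where c: "c \<in> C" "c' \<in> C'" "?v c = ?v c'" by blast
    obtain k k' where k: "k \<in> K" "C = ?w k" "k' \<in> K" "C' = ?w k'" using C by auto
    have cc: "c \<in> carrier G" "c' \<in> carrier G" using coset[OF k(1)] coset[OF k(3)] c k K by auto
    have "c \<otimes> inv c' \<in> W" using r_coset_eqD[OF V cc c(3)] VW by auto
    then have "?w c = ?w c'" using r_coset_eqI[OF W cc] by simp
    moreover have "?w c = C" "?w c' = C'" 
      using repr_independence[OF _ _ W] c k K by auto
    ultimately show False using C by simp
  qed
  have "card (\<Union>C\<in>?w ` K. ?v ` C) = (\<Sum>C\<in>?w ` K. card (?v ` C))"
    by (rule card_UN_disjoint) (use fin card disj in auto)
  also have "\<dots> = (\<Sum>C\<in>?w ` K. coset_index G W V)"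
    by (intro sum.cong refl) (use card in auto)
  finally show ?thesis using UN by (simp add: coset_index_def)
qed

lemma coset_index_self:
  assumes "subgroup W G"
  shows "coset_index G W W = 1"
proof -
  have "(\<lambda>x. W #> x) ` W = {W}"
    using assms coset_join2[OF _ assms] subgroup.one_closed[OF assms] subgroup.mem_carrier[OF assms]
    by auto
  then show ?thesis by (simp add: coset_index_def)
qed

end

lemma (in comm_group) l_coset_eq_r_coset:
  "x \<in> carrier G \<Longrightarrow> U \<subseteq> carrier G \<Longrightarrow> x <# U = U #> x"
  by (auto simp: l_coset_def r_coset_def m_comm subset_iff)

lemma (in comm_group) coset_index_translate:
  assumes W: "subgroup W G" and x: "x \<in> carrier G" and K: "K \<subseteq> carrier G"
  shows "coset_index G (x <# K) W = coset_index G K W"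
proof -
  have WG: "W \<subseteq> carrier G" by (rule subgroup.subset[OF W])
  have "(\<lambda>y. W #> y) ` (x <# K) = (\<lambda>k. W #> (x \<otimes> k)) ` K" by (auto simp: l_coset_def)
  also have "\<dots> = (\<lambda>k. (W #> k) #> x) ` K"
    using x K WG by (intro image_cong refl) (simp add: coset_mult_assoc m_comm subset_iff)
  finally have "(\<lambda>y. W #> y) ` (x <# K) = (\<lambda>D. D #> x) ` ((\<lambda>y. W #> y) ` K)"
    by (simp add: image_image)
  moreover have "inj_on (\<lambda>D. D #> x) ((\<lambda>y. W #> y) ` K)"
  proof (rule inj_onI)
    fix D E assume DE: "D \<in> (\<lambda>y. W #> y) ` K" "E \<in> (\<lambda>y. W #> y) ` K" "D #> x = E #> x"
    have sub: "D \<subseteq> carrier G" "E \<subseteq> carrier G"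
      using DE(1,2) WG K by (auto simp: r_coset_def subset_iff)
    then have "(D #> x) #> inv x = D" "(E #> x) #> inv x = E"
      using x by (simp_all add: coset_mult_assoc)
    then show "D = E" using DE(3) by metis
  qed
  ultimately show ?thesis by (simp add: coset_index_def card_image)
qed

context tdlc_abelian_group
begin

lemma openin_r_coset: "openin T U \<Longrightarrow> x \<in> carrier G \<Longrightarrow> openin T (U #> x)"
  using openin_l_coset[of x U] openin_subset[of T U] l_coset_eq_r_coset[of x U]
  by (simp add: topspace_eq)

lemma finite_cosets:
  assumes K: "compactin T K" and W: "subgroup W G" "openin T W"
  shows "finite ((\<lambda>x. W #> x) ` K)"
proof -
  have KG: "K \<subseteq> carrier G" by (rule compact_subset_carrier[OF K])
  have "K \<subseteq> \<Union>((\<lambda>x. W #> x) ` K)" using rcos_self[OF _ W(1)] KG by blast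
  moreover have "\<And>U. U \<in> (\<lambda>x. W #> x) ` K \<Longrightarrow> openin T U" using openin_r_coset W KG by auto
  ultimately obtain F where F: "finite F" "F \<subseteq> (\<lambda>x. W #> x) ` K" "K \<subseteq> \<Union>F"
    using compactinD[OF K] by metis
  have "(\<lambda>x. W #> x) ` K \<subseteq> F"
  proof
    fix C assume "C \<in> (\<lambda>x. W #> x) ` K"
    then obtain x where x: "x \<in> K" "C = W #> x" by auto
    then obtain D where D: "D \<in> F" "x \<in> D" using F(3) by auto
    then obtain y where y: "y \<in> K" "W #> y \<in> F" "x \<in> W #> y" using F(2) by auto
    have "W #> y = W #> x" by (rule repr_independence[OF y(3) _ W(1)]) (use y KG in auto)
    then show "C \<in> F" using x y by simp
  qed
  then show ?thesis using F(1) finite_subset by blast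
qed

lemma coset_index_pos:
  assumes "compactin T K" "subgroup W G" "openin T W" "K \<noteq> {}"
  shows "0 < coset_index G K W"
  using finite_cosets[OF assms(1-3)] assms(4) by (simp add: coset_index_def card_gt_0_iff)

end

section \<open>Haar measure\<close>

text \<open>The Haar measure of a compact open set \<open>K\<close>, normalised at a compact open subgroup \<open>V\<close>: count
  cosets of a compact open subgroup that is small enough for both.  The choice below is canonical;
  every smaller compact open subgroup gives the same value.\<close>

definition haar_content :: "('a, 'b) monoid_scheme \<Rightarrow> 'a set \<Rightarrow> 'a set \<Rightarrow> ennreal" where
  "haar_content G V K =
     (let W = V \<inter> {x \<in> carrier G. x <#\<^bsub>G\<^esub> K = K}
      in ennreal (real (coset_index G K W) / real (coset_index G V W)))"

text \<open>The usual extension from compact open sets: from inside for open sets, then from outside for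
  all sets.  The detour over open sets matters when the topology has no countable base, because then
  an open set need not be a countable union of compact open ones.\<close>

definition haar_open :: "('a, 'b) monoid_scheme \<Rightarrow> 'a topology \<Rightarrow> 'a set \<Rightarrow> 'a set \<Rightarrow> ennreal" where
  "haar_open G T V U = (SUP K\<in>{K. compactin T K \<and> openin T K \<and> K \<subseteq> U}. haar_content G V K)"

definition haar_outer :: "('a, 'b) monoid_scheme \<Rightarrow> 'a topology \<Rightarrow> 'a set \<Rightarrow> 'a set \<Rightarrow> ennreal" where
  "haar_outer G T V A = (INF U\<in>{U. openin T U \<and> A \<subseteq> U}. haar_open G T V U)"

locale haar_construction = tdlc_abelian_group +
  fixes V :: "'a set"
  assumes V: "compact_open_subgroup G T V"
begin

text \<open>The subgroup used in the definition of the content.\<close>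

definition stab :: "'a set \<Rightarrow> 'a set" where
  "stab K = V \<inter> {x \<in> carrier G. x <# K = K}"


lemma stab_compact_open:
  assumes "compactin T K" "openin T K"
  shows "compact_open_subgroup G T (stab K)"
  unfolding stab_def
  using compact_open_subgroup_Int_open[OF V subgroup_stabilizer openin_stabilizer[OF assms]]
    compact_subset_carrier[OF assms(1)] by simp

lemma content_eq:
  assumes K: "compactin T K" "openin T K" and W: "compact_open_subgroup G T W" "W \<subseteq> stab K"
  shows "haar_content G V K = ennreal (real (coset_index G K W) / real (coset_index G V W))"
proof -
  let ?S = "stab K"
  note S = compact_open_subgroupD[OF stab_compact_open[OF K]]
  note WD = compact_open_subgroupD[OF W(1)]
  note VD = compact_open_subgroupD[OF V]
  have KG: "K \<subseteq> carrier G" by (rule compact_subset_carrier[OF K(1)])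
  have "coset_index G K W = coset_index G K ?S * coset_index G ?S W"
    using finite_cosets K S WD KG W(2)
    by (intro coset_index_tower) (auto simp: stab_def l_coset_def)
  moreover have "coset_index G V W = coset_index G V ?S * coset_index G ?S W"
    using finite_cosets VD S WD KG W(2)
    by (intro coset_index_tower) (auto simp: stab_def subgroup.m_closed)
  moreover have "0 < coset_index G ?S W"
    using coset_index_pos[OF S(3) WD(1,2)] S(6) by auto
  ultimately show ?thesis by (simp add: haar_content_def stab_def Let_def)
qed

lemma content_V: "haar_content G V V = 1"
proof -
  note VD = compact_open_subgroupD[OF V]
  have "V \<subseteq> stab V"
    using VD coset_join3[OF _ VD(1)] by (auto simp: stab_def)
  then show ?thesis using content_eq[OF VD(3,2) V] coset_index_self[OF VD(1)] by simp
qed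

lemma content_finite: "haar_content G V K < \<infinity>"
  by (simp add: haar_content_def Let_def ennreal_less_top)

text \<open>A subgroup that stabilises both sets has no coset that meets both of them.\<close>

lemma content_Un_disjoint:
  assumes K: "compactin T K" "openin T K" and L: "compactin T L" "openin T L" and disj: "K \<inter> L = {}"
  shows "haar_content G V (K \<union> L) = haar_content G V K + haar_content G V L"
proof -
  let ?W = "stab K \<inter> stab L"
  have W: "compact_open_subgroup G T ?W"
    by (rule compact_open_subgroup_Int[OF stab_compact_open[OF K] stab_compact_open[OF L]])
  note WD = compact_open_subgroupD[OF W]
  have KG: "K \<subseteq> carrier G" "L \<subseteq> carrier G" using compact_subset_carrier K L by auto
  have stab_mem: "w \<otimes> k \<in> A" if "w \<in> stab A" "k \<in> A" for w k A
    using that by (auto simp: stab_def l_coset_def)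
  have "?W \<subseteq> stab (K \<union> L)"
    by (auto simp: stab_def l_coset_image image_Un)
  then have KL: "haar_content G V (K \<union> L)
      = ennreal (real (coset_index G (K \<union> L) ?W) / real (coset_index G V ?W))"
    using K L by (intro content_eq W) (auto intro: compactin_Un)
  have "(\<lambda>x. ?W #> x) ` K \<inter> (\<lambda>x. ?W #> x) ` L = {}"
  proof (rule ccontr)
    assume "(\<lambda>x. ?W #> x) ` K \<inter> (\<lambda>x. ?W #> x) ` L \<noteq> {}"
    then obtain k l where kl: "k \<in> K" "l \<in> L" "?W #> k = ?W #> l" by auto
    have klG: "k \<in> carrier G" "l \<in> carrier G" using kl KG by auto
    have "k \<otimes> inv l \<in> ?W" by (rule r_coset_eqD[OF WD(1) klG kl(3)])
    then have "(k \<otimes> inv l) \<otimes> l \<in> L" using stab_mem[OF _ kl(2)] by blast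
    moreover have "(k \<otimes> inv l) \<otimes> l = k" using klG by (simp add: m_assoc)
    ultimately show False using kl(1) disj by auto
  qed
  then have "coset_index G (K \<union> L) ?W = coset_index G K ?W + coset_index G L ?W"
    using finite_cosets K L WD by (simp add: coset_index_def image_Un card_Un_disjoint)
  then show ?thesis using KL content_eq[OF K W] content_eq[OF L W]
    by (simp add: add_divide_distrib)
qed

lemma compact_open_Diff:
  assumes "compactin T K" "openin T K" "compactin T L" "openin T L"
  shows "compactin T (L - K)" "openin T (L - K)"
  using closed_compactin[OF assms(3), of "L - K"]
    closedin_diff[OF compactin_imp_closedin[OF Hausdorff assms(3)] assms(2)]
    openin_diff[OF assms(4) compactin_imp_closedin[OF Hausdorff assms(1)]]
  by auto

lemma content_mono:
  assumes K: "compactin T K" "openin T K" and L: "compactin T L" "openin T L" and sub: "K \<subseteq> L"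
  shows "haar_content G V K \<le> haar_content G V L"
proof -
  have "haar_content G V (K \<union> (L - K)) = haar_content G V K + haar_content G V (L - K)"
    using K compact_open_Diff[OF K L] by (intro content_Un_disjoint) auto
  moreover have "K \<union> (L - K) = L" using sub by auto
  ultimately show ?thesis by simp
qed

lemma content_Un_le:
  assumes K: "compactin T K" "openin T K" and L: "compactin T L" "openin T L"
  shows "haar_content G V (K \<union> L) \<le> haar_content G V K + haar_content G V L"
proof -
  note D = compact_open_Diff[OF K L]
  have "haar_content G V (K \<union> (L - K)) = haar_content G V K + haar_content G V (L - K)"
    using K D by (intro content_Un_disjoint) auto
  also have "\<dots> \<le> haar_content G V K + haar_content G V L"
    by (intro add_left_mono content_mono D L) auto
  finally show ?thesis by simp
qed

lemma content_empty: "haar_content G V {} = 0"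
  by (simp add: haar_content_def Let_def coset_index_def)

lemma content_UN_le:
  assumes "\<And>i. i < (n::nat) \<Longrightarrow> compactin T (K i)" "\<And>i. i < n \<Longrightarrow> openin T (K i)"
  shows "haar_content G V (\<Union>i<n. K i) \<le> (\<Sum>i<n. haar_content G V (K i))"
  using assms
proof (induction n)
  case 0 then show ?case by (simp add: content_empty)
next
  case (Suc n)
  have "haar_content G V (\<Union>i<Suc n. K i) \<le> haar_content G V (\<Union>i<n. K i) + haar_content G V (K n)"
    unfolding lessThan_Suc UN_insert Un_commute[of "K n"]
    using Suc.prems by (intro content_Un_le compactin_Union openin_Union) auto
  also have "\<dots> \<le> (\<Sum>i<Suc n. haar_content G V (K i))"
    using Suc by (simp add: add_right_mono)
  finally show ?case .
qed

lemma content_translate: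
  assumes K: "compactin T K" "openin T K" and x: "x \<in> carrier G"
  shows "haar_content G V (x <# K) = haar_content G V K"
proof -
  have KG: "K \<subseteq> carrier G" by (rule compact_subset_carrier[OF K(1)])
  have xK: "compactin T (x <# K)" "openin T (x <# K)"
    using K x by (simp_all add: compactin_l_coset openin_l_coset)
  have "y <# (x <# K) = x <# (y <# K)" if "y \<in> carrier G" for y
    using that x KG by (simp add: lcos_m_assoc m_comm)
  then have "stab K \<subseteq> stab (x <# K)" by (auto simp: stab_def)
  then have "haar_content G V (x <# K)
      = ennreal (real (coset_index G (x <# K) (stab K)) / real (coset_index G V (stab K)))"
    by (intro content_eq xK stab_compact_open K)
  also have "\<dots> = haar_content G V K"
    using content_eq[OF K stab_compact_open[OF K]] coset_index_translate[OF _ x KG]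
      compact_open_subgroupD(1)[OF stab_compact_open[OF K]] by simp
  finally show ?thesis .
qed

lemma haar_open_mono: "U \<subseteq> U' \<Longrightarrow> haar_open G T V U \<le> haar_open G T V U'"
  unfolding haar_open_def by (intro SUP_subset_mono) auto

lemma haar_open_content:
  assumes "compactin T K" "openin T K"
  shows "haar_open G T V K = haar_content G V K"
  unfolding haar_open_def
  using assms content_mono by (intro antisym SUP_least SUP_upper) auto

text \<open>A compact open \<open>K\<close> in the union is covered by finitely many compact open sets, each inside one of
  the \<open>U i\<close>; collecting them by \<open>i\<close> gives finitely many compact open \<open>L i \<subseteq> U i\<close>.\<close>

lemma haar_open_countable_subadditive:
  fixes U :: "nat \<Rightarrow> 'a set"
  assumes U: "\<And>i. openin T (U i)"
  shows "haar_open G T V (\<Union>i. U i) \<le> (\<Sum>i. haar_open G T V (U i))"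
  unfolding haar_open_def[of _ _ _ "\<Union>i. U i"]
proof (rule SUP_least, clarify)
  fix K assume K: "compactin T K" "openin T K" "K \<subseteq> (\<Union>i. U i)"
  let ?B = "{B. compactin T B \<and> openin T B \<and> (\<exists>i. B \<subseteq> U i)}"
  have "\<exists>B\<in>?B. x \<in> B" if x: "x \<in> K" for x
  proof -
    obtain i where i: "x \<in> U i" using K x by auto
    have xG: "x \<in> carrier G" using x compact_subset_carrier[OF K(1)] by auto
    have "closedin T (carrier G - U i)" by (rule closedin_complement[OF U])
    then obtain W where W: "compact_open_subgroup G T W" "(x <# W) \<inter> (carrier G - U i) = {}"
      using compact_open_subgroup_avoiding[of _ x] xG i by blast
    note WD = compact_open_subgroupD[OF W(1)]
    have "x <# W \<subseteq> U i" using W(2) l_coset_subset_carrier[OF xG WD(5)] by blast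
    moreover have "x \<in> x <# W" using mem_l_coset_iff[OF xG xG WD(5)] WD(6) xG by simp
    ultimately show ?thesis using openin_l_coset[OF xG WD(2)] compactin_l_coset[OF xG WD(3)] by blast
  qed
  then have "K \<subseteq> \<Union>?B" by blast
  then obtain F where F: "finite F" "F \<subseteq> ?B" "K \<subseteq> \<Union>F"
    using compactinD[OF K(1), of ?B] by auto
  have "\<forall>B\<in>F. \<exists>i. B \<subseteq> U i" using F by auto
  then obtain i where i: "\<And>B. B \<in> F \<Longrightarrow> B \<subseteq> U (i B)" by metis
  define L where "L n = \<Union>{B\<in>F. i B = n}" for n
  have L: "compactin T (L n)" "openin T (L n)" for n
    using F by (auto simp: L_def intro!: compactin_Union openin_Union)
  have LU: "L n \<subseteq> U n" for n using i by (fastforce simp: L_def)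
  obtain N where N: "\<And>B. B \<in> F \<Longrightarrow> i B < N"
    using F(1) finite_nat_set_iff_bounded[of "i ` F"] by auto
  have KL: "K \<subseteq> (\<Union>n<N. L n)"
  proof
    fix x assume "x \<in> K"
    then obtain B where B: "B \<in> F" "x \<in> B" using F(3) by auto
    then have "x \<in> L (i B)" by (auto simp: L_def)
    then show "x \<in> (\<Union>n<N. L n)" using N[OF B(1)] by blast
  qed
  have "haar_content G V K \<le> haar_content G V (\<Union>n<N. L n)"
    using K L KL by (intro content_mono compactin_Union openin_Union) auto
  also have "\<dots> \<le> (\<Sum>n<N. haar_content G V (L n))"
    using L by (intro content_UN_le) auto
  also have "\<dots> \<le> (\<Sum>n<N. haar_open G T V (U n))"
    unfolding haar_open_def using L LU by (intro sum_mono SUP_upper) auto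
  also have "\<dots> \<le> (\<Sum>n. haar_open G T V (U n))"
    by (rule sum_le_suminf) auto
  finally show "haar_content G V K \<le> (\<Sum>n. haar_open G T V (U n))" .
qed

lemma haar_outer_open: "openin T U \<Longrightarrow> haar_outer G T V U = haar_open G T V U"
  unfolding haar_outer_def using haar_open_mono by (intro antisym INF_greatest INF_lower) auto

lemma haar_outer_mono: "A \<subseteq> B \<Longrightarrow> haar_outer G T V A \<le> haar_outer G T V B"
  unfolding haar_outer_def by (intro INF_superset_mono) auto

lemma haar_outer_empty: "haar_outer G T V {} = 0"
  using haar_outer_open[of "{}"] haar_open_content[of "{}"] by (simp add: content_empty)

lemma haar_outer_countable_subadditive:
  fixes A :: "nat \<Rightarrow> 'a set"
  shows "haar_outer G T V (\<Union>i. A i) \<le> (\<Sum>i. haar_outer G T V (A i))"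
proof (rule ennreal_le_epsilon)
  let ?O = "haar_outer G T V"
  fix e :: real assume e: "0 < e" and fin: "(\<Sum>n. ?O (A n)) < Orderings.top"
  then have *: "?O (A n) < ?O (A n) + e * (1/2)^Suc n" for n
    by (auto simp add: less_top dest!: ennreal_suminf_lessD)
  have "\<exists>U. openin T U \<and> A n \<subseteq> U \<and> haar_open G T V U \<le> ?O (A n) + e * (1/2)^Suc n" for n
    using *[of n] unfolding haar_outer_def[of _ _ _ "A n"] INF_less_iff by (auto intro: less_imp_le)
  then obtain U where U: "\<And>n. openin T (U n)" "\<And>n. A n \<subseteq> U n"
    "\<And>n. haar_open G T V (U n) \<le> ?O (A n) + e * (1/2)^Suc n" by metis
  have "?O (\<Union>i. A i) \<le> ?O (\<Union>i. U i)" using U by (intro haar_outer_mono) auto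
  also have "\<dots> = haar_open G T V (\<Union>i. U i)" using U by (intro haar_outer_open) auto
  also have "\<dots> \<le> (\<Sum>n. haar_open G T V (U n))" using U by (intro haar_open_countable_subadditive)
  also have "\<dots> \<le> (\<Sum>n. ?O (A n) + e * (1/2) ^ Suc n)"
    using U by (intro suminf_le summableI allI)
  also have "\<dots> = (\<Sum>n. ?O (A n)) + (\<Sum>n. ennreal e * ennreal ((1/2) ^ Suc n))"
    using \<open>0 < e\<close> by (subst suminf_add[symmetric])
                     (auto simp del: ennreal_suminf_cmult simp add: ennreal_mult[symmetric])
  also have "\<dots> = (\<Sum>n. ?O (A n)) + e"
    unfolding ennreal_suminf_cmult
    by (subst suminf_ennreal_eq[OF zero_le_power power_half_series]) auto
  finally show "?O (\<Union>i. A i) \<le> (\<Sum>n. ?O (A n)) + e" .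
qed

lemma outer_measure_space_haar_outer: "outer_measure_space (Pow (carrier G)) (haar_outer G T V)"
  unfolding outer_measure_space_def
proof (intro conjI)
  show "positive (Pow (carrier G)) (haar_outer G T V)" by (simp add: positive_def haar_outer_empty)
  show "increasing (Pow (carrier G)) (haar_outer G T V)"
    by (auto simp: increasing_def intro: haar_outer_mono)
  show "countably_subadditive (Pow (carrier G)) (haar_outer G T V)"
    by (auto simp: countably_subadditive_def intro: haar_outer_countable_subadditive)
qed

lemma haar_outer_Un_le: "haar_outer G T V (A \<union> B) \<le> haar_outer G T V A + haar_outer G T V B"
proof -
  have "(\<Union>i. (binaryset A B) i) = A \<union> B" by (rule UN_binaryset_eq)
  moreover have "(\<Sum>i. haar_outer G T V (binaryset A B i)) = haar_outer G T V A + haar_outer G T V B"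
    by (rule suminf_binaryset_eq) (rule haar_outer_empty)
  ultimately show ?thesis using haar_outer_countable_subadditive[of "binaryset A B"] by simp
qed

text \<open>Open sets are Caratheodory measurable: for open \<open>U \<supseteq> A\<close>, remove a large compact open part of
  \<open>U \<inter> O\<close> from \<open>U\<close>; what remains is open and still contains \<open>A - O\<close>.\<close>

lemma open_measurable:
  assumes W: "openin T W"
  shows "W \<in> lambda_system (carrier G) (Pow (carrier G)) (haar_outer G T V)"
proof -
  let ?O = "haar_outer G T V" and ?m = "haar_open G T V"
  interpret P: sigma_algebra "carrier G" "Pow (carrier G)" by (rule sigma_algebra_Pow)
  have "?O (A \<inter> W) + ?O (A - W) \<le> ?O A" for A
    unfolding haar_outer_def[of _ _ _ A]
  proof (rule INF_greatest, clarify)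
    fix U assume U: "openin T U" "A \<subseteq> U"
    let ?K = "{K. compactin T K \<and> openin T K \<and> K \<subseteq> U \<inter> W}"
    have ne: "{} \<in> ?K" by simp
    have step: "haar_content G V K + ?O (A - W) \<le> ?m U" if K: "K \<in> ?K" for K
    proof -
      have cK: "closedin T K" using compactin_imp_closedin[OF Hausdorff] K by simp
      have oUK: "openin T (U - K)" using openin_diff[OF U(1) cK] .
      have "?O (A - W) \<le> ?O (U - K)" using U K by (intro haar_outer_mono) auto
      also have "\<dots> = ?m (U - K)" using oUK by (rule haar_outer_open)
      finally have "haar_content G V K + ?O (A - W) \<le> haar_content G V K + ?m (U - K)"
        by (rule add_left_mono)
      also have "\<dots> = (SUP L\<in>{L. compactin T L \<and> openin T L \<and> L \<subseteq> U - K}.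
          haar_content G V K + haar_content G V L)"
        unfolding haar_open_def[of _ _ _ "U - K"] by (rule ennreal_SUP_add_right) (auto intro!: exI[of _ "{}"])
      also have "\<dots> \<le> ?m U"
      proof (rule SUP_least, clarify)
        fix L assume L: "compactin T L" "openin T L" "L \<subseteq> U - K"
        have "haar_content G V K + haar_content G V L = haar_content G V (K \<union> L)"
          using K L by (intro content_Un_disjoint[symmetric]) auto
        also have "\<dots> \<le> ?m U"
          unfolding haar_open_def using K L by (intro SUP_upper) (auto intro: compactin_Un)
        finally show "haar_content G V K + haar_content G V L \<le> ?m U" .
      qed
      finally show ?thesis .
    qed
    have "?O (A \<inter> W) \<le> ?O (U \<inter> W)" using U by (intro haar_outer_mono) auto
    also have "\<dots> = ?m (U \<inter> W)" using U W by (intro haar_outer_open) auto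
    finally have "?O (A \<inter> W) + ?O (A - W) \<le> ?m (U \<inter> W) + ?O (A - W)" by (rule add_right_mono)
    also have "\<dots> = (SUP K\<in>?K. haar_content G V K + ?O (A - W))"
      unfolding haar_open_def[of _ _ _ "U \<inter> W"] using ne by (intro ennreal_SUP_add_left[symmetric]) auto
    also have "\<dots> \<le> ?m U" using step by (intro SUP_least)
    finally show "?O (A \<inter> W) + ?O (A - W) \<le> ?m U" .
  qed
  moreover have "?O A \<le> ?O (A \<inter> W) + ?O (A - W)" for A
    using haar_outer_Un_le[of "A \<inter> W" "A - W"] by (simp add: Int_Diff_Un)
  ultimately have "?O (A \<inter> W) + ?O (A - W) = ?O A" for A by (intro antisym)
  then show ?thesis
    using openin_subset[OF W] by (auto simp: P.lambda_system_eq topspace_eq)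
qed

abbreviation "borel_G \<equiv> sigma_sets (carrier G) {U. openin T U}"

lemma opens_Pow: "{U. openin T U} \<subseteq> Pow (carrier G)"
  using openin_subset[of T] by (auto simp: topspace_eq)

lemma measure_space_haar_outer: "measure_space (carrier G) borel_G (haar_outer G T V)"
proof -
  let ?L = "lambda_system (carrier G) (Pow (carrier G)) (haar_outer G T V)"
  interpret P: sigma_algebra "carrier G" "Pow (carrier G)" by (rule sigma_algebra_Pow)
  have ms: "measure_space (carrier G) ?L (haar_outer G T V)"
    by (rule P.caratheodory_lemma[OF outer_measure_space_haar_outer])
  then have "sigma_algebra (carrier G) ?L" by (simp add: measure_space_def)
  then have "borel_G \<subseteq> ?L"
    by (rule sigma_algebra.sigma_sets_subset) (use open_measurable in auto)
  then show ?thesis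
    using measure_down[OF ms sigma_algebra_sigma_sets[OF opens_Pow]] by blast
qed

lemma translate_borel:
  assumes x: "x \<in> carrier G" and A: "A \<in> borel_G"
  shows "x <# A \<in> borel_G"
  using A
proof (induction rule: sigma_sets.induct)
  case (Basic U)
  then show ?case using openin_l_coset[OF x] by (intro sigma_sets.Basic) auto
next
  case Empty
  then show ?case by (simp add: l_coset_def sigma_sets.Empty)
next
  case (Compl A)
  have AG: "A \<subseteq> carrier G" using sigma_sets_into_sp[OF opens_Pow Compl.hyps] .
  have "x <# (carrier G - A) = carrier G - (x <# A)"
  proof (rule Set.set_eqI)
    fix y
    show "y \<in> x <# (carrier G - A) \<longleftrightarrow> y \<in> carrier G - (x <# A)"
      using x AG l_coset_subset_carrier[OF x, of "carrier G - A"] mem_l_coset_iff[OF x _ AG, of y]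
        mem_l_coset_iff[OF x, of y "carrier G - A"]
      by (cases "y \<in> carrier G") auto
  qed
  then show ?case using Compl sigma_sets.Compl by metis
next
  case (Union A)
  have "x <# (\<Union>i. A i) = (\<Union>i. x <# A i)" by (auto simp: l_coset_def)
  then show ?case using Union sigma_sets.Union by metis
qed

lemma l_coset_mono: "A \<subseteq> B \<Longrightarrow> x <# A \<subseteq> x <# B"
  by (auto simp: l_coset_def)

lemma haar_open_translate_le:
  assumes x: "x \<in> carrier G" and U: "U \<subseteq> carrier G"
  shows "haar_open G T V U \<le> haar_open G T V (x <# U)"
  unfolding haar_open_def[of _ _ _ U]
proof (rule SUP_least, clarify)
  fix K assume K: "compactin T K" "openin T K" "K \<subseteq> U"
  have "haar_content G V K = haar_content G V (x <# K)" using content_translate K x by simp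
  also have "\<dots> \<le> haar_open G T V (x <# U)"
    unfolding haar_open_def
    using K x by (intro SUP_upper) (auto simp: compactin_l_coset openin_l_coset l_coset_mono)
  finally show "haar_content G V K \<le> haar_open G T V (x <# U)" .
qed

lemma translate_inverse:
  assumes "x \<in> carrier G" "U \<subseteq> carrier G"
  shows "inv x <# (x <# U) = U"
  using assms by (simp add: lcos_m_assoc lcos_mult_one)

lemma haar_outer_translate_le:
  assumes x: "x \<in> carrier G" and A: "A \<subseteq> carrier G"
  shows "haar_outer G T V (x <# A) \<le> haar_outer G T V A"
  unfolding haar_outer_def[of _ _ _ A]
proof (rule INF_greatest, clarify)
  fix U assume U: "openin T U" "A \<subseteq> U"
  have UG: "U \<subseteq> carrier G" using openin_subset[OF U(1)] by (simp add: topspace_eq)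
  have "haar_outer G T V (x <# A) \<le> haar_open G T V (x <# U)"
    unfolding haar_outer_def using U x
    by (intro INF_lower) (auto simp: openin_l_coset l_coset_mono)
  also have "\<dots> \<le> haar_open G T V (inv x <# (x <# U))"
    using x UG by (intro haar_open_translate_le) (simp_all add: l_coset_subset_carrier)
  finally show "haar_outer G T V (x <# A) \<le> haar_open G T V U"
    using translate_inverse[OF x UG] by simp
qed

lemma haar_outer_translate:
  assumes x: "x \<in> carrier G" and A: "A \<subseteq> carrier G"
  shows "haar_outer G T V (x <# A) = haar_outer G T V A"
proof (rule antisym)
  show "haar_outer G T V (x <# A) \<le> haar_outer G T V A" by (rule haar_outer_translate_le[OF x A])
  have "haar_outer G T V (inv x <# (x <# A)) \<le> haar_outer G T V (x <# A)"
    using x A by (intro haar_outer_translate_le) (simp_all add: l_coset_subset_carrier)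
  then show "haar_outer G T V A \<le> haar_outer G T V (x <# A)" by (simp add: translate_inverse[OF x A])
qed

text \<open>A compact set lies in a finite union of cosets of \<open>V\<close>.\<close>

lemma haar_outer_compact_finite:
  assumes K: "compactin T K"
  shows "haar_outer G T V K < \<infinity>"
proof -
  note VD = compact_open_subgroupD[OF V]
  have KG: "K \<subseteq> carrier G" by (rule compact_subset_carrier[OF K])
  let ?B = "\<Union>((\<lambda>x. V #> x) ` K)"
  have r: "V #> x = x <# V" if "x \<in> K" for x using l_coset_eq_r_coset VD(5) KG that by auto
  have cB: "compactin T ?B"
    using finite_cosets[OF K VD(1,2)] KG VD(3) 
    by (intro compactin_Union) (auto simp: r compactin_l_coset subset_iff)
  have oB: "openin T ?B" using openin_r_coset[OF VD(2)] KG by (intro openin_Union) auto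
  have "K \<subseteq> ?B" using rcos_self[OF _ VD(1)] KG by blast
  then have "haar_outer G T V K \<le> haar_outer G T V ?B" by (rule haar_outer_mono)
  also have "\<dots> = haar_content G V ?B" using cB oB by (simp add: haar_outer_open haar_open_content)
  also have "\<dots> < \<infinity>" by (rule content_finite)
  finally show ?thesis .
qed

lemma haar_measure_exists: "\<exists>\<mu>. is_left_haar_measure G T \<mu>"
proof -
  define \<mu> where "\<mu> = measure_of (carrier G) borel_G (haar_outer G T V)"
  have sa: "sigma_algebra (carrier G) borel_G" by (rule sigma_algebra_sigma_sets[OF opens_Pow])
  have em: "emeasure \<mu> A = haar_outer G T V A" if "A \<in> borel_G" for A
    unfolding \<mu>_def using measure_space_haar_outer that
    by (intro emeasure_measure_of_sigma) (auto simp: measure_space_def)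
  have sets: "sets \<mu> = borel_G"
    unfolding \<mu>_def using sigma_algebra.sets_measure_of_eq[OF sa] .
  have space: "space \<mu> = carrier G"
    unfolding \<mu>_def using sigma_algebra.space_measure_of_eq[OF sa] .
  have open_in: "U \<in> borel_G" if "openin T U" for U using that by auto
  have closed_in: "C \<in> borel_G" if "closedin T C" for C
  proof -
    have "carrier G - (carrier G - C) \<in> borel_G"
      using openin_complement[OF that] by (intro sigma_sets.Compl open_in)
    moreover have "carrier G - (carrier G - C) = C" using closedin_subset[OF that] by (auto simp: topspace_eq)
    ultimately show ?thesis by simp
  qed
  have compact_in: "K \<in> borel_G" if "compactin T K" for K
    using closed_in compactin_imp_closedin[OF Hausdorff that] by simp
  have open_em: "emeasure \<mu> U = haar_open G T V U" if "openin T U" for U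
    using em[OF open_in[OF that]] haar_outer_open[OF that] by simp
  have carrier_open: "openin T (carrier G)" using openin_topspace by (metis topspace_eq)
  note VD = compact_open_subgroupD[OF V]
  have "is_left_haar_measure G T \<mu>"
    unfolding is_left_haar_measure_def
  proof (intro conjI allI impI ballI)
    show "space \<mu> = carrier G" by (rule space)
    show "sets \<mu> = borel_G" by (rule sets)
    have "haar_open G T V V \<le> haar_open G T V (carrier G)" by (rule haar_open_mono[OF VD(5)])
    then show "emeasure \<mu> (carrier G) \<noteq> 0"
      using open_em[OF carrier_open] haar_open_content[OF VD(3,2)] content_V by auto
    show "emeasure \<mu> K < \<infinity>" if "compactin T K" for K
      using em[OF compact_in[OF that]] haar_outer_compact_finite[OF that] by simp
    show "emeasure \<mu> A = (INF U\<in>{U. openin T U \<and> A \<subseteq> U}. emeasure \<mu> U)" if "A \<in> sets \<mu>" for A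
      using em[of A] that open_em unfolding sets haar_outer_def by (auto intro!: INF_cong)
    show "emeasure \<mu> U = (SUP K\<in>{K. compactin T K \<and> K \<subseteq> U}. emeasure \<mu> K)" if U: "openin T U" for U
    proof (rule antisym)
      show "emeasure \<mu> U \<le> (SUP K\<in>{K. compactin T K \<and> K \<subseteq> U}. emeasure \<mu> K)"
        unfolding open_em[OF U] haar_open_def
      proof (rule SUP_least, clarify)
        fix K assume K: "compactin T K" "openin T K" "K \<subseteq> U"
        then have "haar_content G V K = emeasure \<mu> K" by (simp add: open_em haar_open_content)
        also have "\<dots> \<le> (SUP K\<in>{K. compactin T K \<and> K \<subseteq> U}. emeasure \<mu> K)"
          using K by (intro SUP_upper) auto
        finally show "haar_content G V K \<le> (SUP K\<in>{K. compactin T K \<and> K \<subseteq> U}. emeasure \<mu> K)" .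
      qed
      show "(SUP K\<in>{K. compactin T K \<and> K \<subseteq> U}. emeasure \<mu> K) \<le> emeasure \<mu> U"
        using open_in[OF U] by (intro SUP_least emeasure_mono) (auto simp: sets)
    qed
    show "emeasure \<mu> (x <# A) = emeasure \<mu> A" if x: "x \<in> carrier G" and A: "A \<in> sets \<mu>" for x A
    proof -
      have A': "A \<in> borel_G" using A sets by simp
      show ?thesis
        using em[OF A'] em[OF translate_borel[OF x A']] 
          haar_outer_translate[OF x sigma_sets_into_sp[OF opens_Pow A']] by simp
    qed
  qed
  then show ?thesis by blast
qed

end

lemma (in tdlc_abelian_group) is_left_haar_measure_haar_measure:
  "is_left_haar_measure G T (haar_measure G T)"
proof -
  obtain V where "compact_open_subgroup G T V" using ex_compact_open_subgroup by blast
  then interpret haar_construction G T V by unfold_locales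
  show ?thesis unfolding haar_measure_def using haar_measure_exists by (rule someI_ex)
qed

section \<open>Entropy through coset indices\<close>

text \<open>Cosets are compared through representatives: if the \<open>g\<close>-class of \<open>h x\<close> determines the
  \<open>f\<close>-class of \<open>x\<close>, there are at most as many \<open>f\<close>-classes as \<open>g\<close>-classes.\<close>

lemma card_image_le_of_factor:
  assumes h: "h ` A \<subseteq> B" and fin: "finite (g ` B)"
    and eq: "\<And>x y. x \<in> A \<Longrightarrow> y \<in> A \<Longrightarrow> g (h x) = g (h y) \<Longrightarrow> f x = f y"
  shows "card (f ` A) \<le> card (g ` B)"
proof -
  let ?k = "\<lambda>c. f (SOME x. x \<in> A \<and> g (h x) = c)"
  have "f ` A \<subseteq> ?k ` (g ` B)"
  proof
    fix y assume "y \<in> f ` A"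
    then obtain x where x: "x \<in> A" "y = f x" by auto
    have "(SOME x'. x' \<in> A \<and> g (h x') = g (h x)) \<in> A \<and> g (h (SOME x'. x' \<in> A \<and> g (h x') = g (h x))) = g (h x)"
      by (rule someI[of _ x]) (use x in simp)
    then have "?k (g (h x)) = y" using eq x by blast
    then show "y \<in> ?k ` (g ` B)" using x h by blast
  qed
  then show ?thesis using fin by (rule surj_card_le[rotated])
qed

lemma nonincreasing_nat_seq_eventually_const:
  fixes a :: "nat \<Rightarrow> nat"
  assumes "\<And>n. n \<ge> 1 \<Longrightarrow> a (Suc n) \<le> a n"
  obtains N where "N \<ge> 1" "\<And>n. n \<ge> N \<Longrightarrow> a n = a N"
proof -
  obtain N where N: "N \<ge> 1" "\<And>n. n \<ge> 1 \<Longrightarrow> a N \<le> a n"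
    using ex_has_least_nat[of "\<lambda>n. n \<ge> 1" 1 a] by auto
  have "a n \<le> a N" if "n \<ge> N" for n
    using that by (induction rule: dec_induct) (use assms N(1) order_trans le_trans in force)+
  then have "a n = a N" if "n \<ge> N" for n using N that by (meson le_antisym le_trans)
  then show ?thesis using that N(1) by blast
qed

lemma cotrajectory_cong:
  assumes eq: "\<And>x. x \<in> carrier G \<Longrightarrow> \<phi> x = \<psi> x" and closed: "\<And>x. x \<in> carrier G \<Longrightarrow> \<phi> x \<in> carrier G"
  shows "cotrajectory G \<phi> U n = cotrajectory G \<psi> U n"
proof -
  have "(\<phi> ^^ k) x \<in> carrier G \<and> (\<phi> ^^ k) x = (\<psi> ^^ k) x" if "x \<in> carrier G" for k x
    using that
  proof (induction k)
    case (Suc k)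
    then have "(\<phi> ^^ k) x \<in> carrier G" "(\<phi> ^^ k) x = (\<psi> ^^ k) x" by auto
    then show ?case using eq[of "(\<phi> ^^ k) x"] closed[of "(\<phi> ^^ k) x"] by simp
  qed simp
  then show ?thesis by (auto simp: cotrajectory_def)
qed

lemma h_top_cong:
  assumes "\<And>x. x \<in> carrier G \<Longrightarrow> \<phi> x = \<psi> x" "\<And>x. x \<in> carrier G \<Longrightarrow> \<phi> x \<in> carrier G"
  shows "h_top G T \<phi> = h_top G T \<psi>"
  unfolding h_top_def H_top_def using cotrajectory_cong[OF assms] by simp

context tdlc_abelian_group
begin

lemma EndD:
  assumes "\<phi> \<in> End G T"
  shows "\<phi> \<in> hom G G" "continuous_map T T \<phi>" "\<And>x. x \<in> carrier G \<Longrightarrow> \<phi> x \<in> carrier G"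
    "\<And>x y. x \<in> carrier G \<Longrightarrow> y \<in> carrier G \<Longrightarrow> \<phi> (x \<otimes> y) = \<phi> x \<otimes> \<phi> y" "\<phi> \<one> = \<one>"
    "\<And>x. x \<in> carrier G \<Longrightarrow> \<phi> (inv x) = inv (\<phi> x)"
  using assms hom_one[of \<phi> G G]
    group_hom.hom_inv[of G G \<phi>]
  by (auto simp: End_def hom_def group_hom_def group_hom_axioms_def is_group)

lemma End_funpow:
  assumes "\<phi> \<in> End G T"
  shows "\<phi> ^^ n \<in> End G T"
proof (induction n)
  case 0
  show ?case by (simp add: End_def hom_def id_def)
next
  case (Suc n)
  then show ?case using assms
    by (auto simp: End_def hom_def Pi_iff o_def intro: continuous_map_compose[unfolded o_def])
qed

lemma preimage_open_subgroup:
  assumes \<phi>: "\<phi> \<in> End G T" and S: "subgroup S G" "openin T S"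
  shows "subgroup {x \<in> carrier G. \<phi> x \<in> S} G" "openin T {x \<in> carrier G. \<phi> x \<in> S}"
proof -
  show "subgroup {x \<in> carrier G. \<phi> x \<in> S} G"
    using EndD[OF \<phi>] S(1)
    by unfold_locales (auto simp: subgroup.m_closed subgroup.one_closed subgroup.m_inv_closed)
  show "openin T {x \<in> carrier G. \<phi> x \<in> S}"
    using openin_continuous_map_preimage[OF EndD(2)[OF \<phi>] S(2)] by (simp add: topspace_eq)
qed

lemma cotrajectory_Suc:
  "cotrajectory G \<phi> U (Suc n) = cotrajectory G \<phi> U n \<inter> {x \<in> carrier G. (\<phi> ^^ n) x \<in> U}"
  by (auto simp: cotrajectory_def less_Suc_eq)

lemma cotrajectory_0: "cotrajectory G \<phi> U 0 = carrier G"
  by (simp add: cotrajectory_def)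

lemma cotrajectory_subset: "n \<ge> 1 \<Longrightarrow> cotrajectory G \<phi> U n \<subseteq> U"
  by (force simp: cotrajectory_def)

lemma cotrajectory_one: "U \<subseteq> carrier G \<Longrightarrow> cotrajectory G \<phi> U (Suc 0) = U"
  by (auto simp: cotrajectory_def)

lemma cotrajectory_mono: "U \<subseteq> U' \<Longrightarrow> cotrajectory G \<phi> U n \<subseteq> cotrajectory G \<phi> U' n"
  by (auto simp: cotrajectory_def)

lemma compact_open_subgroup_cotrajectory:
  assumes \<phi>: "\<phi> \<in> End G T" and W: "compact_open_subgroup G T W" and n: "n \<ge> 1"
  shows "compact_open_subgroup G T (cotrajectory G \<phi> W n)"
  using n
proof (induction n rule: dec_induct)
  case base
  show ?case using cotrajectory_one[of W] W compact_open_subgroupD(5)[OF W] by simp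
next
  case (step n)
  then show ?case
    unfolding cotrajectory_Suc
    using preimage_open_subgroup[OF End_funpow[OF \<phi>]] compact_open_subgroupD[OF W]
    by (intro compact_open_subgroup_Int_open)
qed

lemma cotrajectory_image:
  assumes \<phi>: "\<phi> \<in> End G T" and x: "x \<in> cotrajectory G \<phi> U (Suc n)"
  shows "\<phi> x \<in> cotrajectory G \<phi> U n"
proof -
  have "(\<phi> ^^ k) (\<phi> x) \<in> U" if "k < n" for k
    using x that by (auto simp: cotrajectory_def funpow_swap1 dest: spec[of _ "Suc k"])
  then show ?thesis using x EndD(3)[OF \<phi>] by (auto simp: cotrajectory_def)
qed

lemma cotrajectory_Suc_iff:
  assumes \<phi>: "\<phi> \<in> End G T" and x: "x \<in> carrier G"
  shows "x \<in> cotrajectory G \<phi> U (Suc n) \<longleftrightarrow> x \<in> U \<and> \<phi> x \<in> cotrajectory G \<phi> U n"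
proof -
  have "(\<forall>k<Suc n. (\<phi> ^^ k) x \<in> U) \<longleftrightarrow> x \<in> U \<and> (\<forall>k<n. (\<phi> ^^ k) (\<phi> x) \<in> U)"
    by (auto simp: funpow_swap1 less_Suc_eq_0_disj)
  then show ?thesis using x EndD(3)[OF \<phi>] by (simp add: cotrajectory_def)
qed

text \<open>The successive indices of the cotrajectory do not increase, because \<open>\<phi>\<close> induces an injection
  from the cosets at one stage to the cosets at the previous one.\<close>

lemma cotrajectory_index_decreasing:
  assumes \<phi>: "\<phi> \<in> End G T" and W: "compact_open_subgroup G T W" and n: "n \<ge> 1"
  defines "C \<equiv> cotrajectory G \<phi> W"
  shows "coset_index G (C (Suc n)) (C (Suc (Suc n))) \<le> coset_index G (C n) (C (Suc n))"
  unfolding coset_index_def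
proof (rule card_image_le_of_factor[where h = \<phi>])
  have c: "compact_open_subgroup G T (C m)" if "m \<ge> 1" for m
    unfolding C_def using compact_open_subgroup_cotrajectory[OF \<phi> W that] .
  note c1 = compact_open_subgroupD[OF c[OF n]]
  have "Suc n \<ge> 1" "Suc (Suc n) \<ge> 1" by auto
  note c2 = compact_open_subgroupD[OF c[OF this(1)]] and c3 = compact_open_subgroupD[OF c[OF this(2)]]
  show "\<phi> ` C (Suc n) \<subseteq> C n" using cotrajectory_image[OF \<phi>] by (auto simp: C_def)
  show "finite ((\<lambda>x. C (Suc n) #> x) ` C n)" using finite_cosets[OF c1(3) c2(1,2)] .
  fix x y assume xy: "x \<in> C (Suc n)" "y \<in> C (Suc n)" "C (Suc n) #> \<phi> x = C (Suc n) #> \<phi> y"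
  have xyG: "x \<in> carrier G" "y \<in> carrier G" using xy c2(5) by auto
  have "\<phi> x \<otimes> inv (\<phi> y) \<in> C (Suc n)" using r_coset_eqD[OF c2(1) _ _ xy(3)] EndD[OF \<phi>] xyG by auto
  then have "\<phi> (x \<otimes> inv y) \<in> C (Suc n)" using EndD[OF \<phi>] xyG by simp
  moreover have "x \<otimes> inv y \<in> C (Suc n)"
    using xy c2(1) by (simp add: subgroup.m_closed subgroup.m_inv_closed)
  then have "x \<otimes> inv y \<in> W" using cotrajectory_subset[of "Suc n"] unfolding C_def by auto
  ultimately have "x \<otimes> inv y \<in> C (Suc (Suc n))"
    unfolding C_def using cotrajectory_Suc_iff[OF \<phi>, of "x \<otimes> inv y"] xyG by simp
  then show "C (Suc (Suc n)) #> x = C (Suc (Suc n)) #> y" using r_coset_eqI[OF c3(1) xyG] by simp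
qed

lemma coset_index_chain:
  assumes "compact_open_subgroup G T W" "compact_open_subgroup G T D" "compact_open_subgroup G T C"
    "C \<subseteq> D" "D \<subseteq> W"
  shows "coset_index G W C = coset_index G W D * coset_index G D C"
  using assms compact_open_subgroupD[OF assms(1)] compact_open_subgroupD[OF assms(2)]
    compact_open_subgroupD[OF assms(3)] finite_cosets
  by (intro coset_index_tower) (auto simp: subgroup.m_closed subset_iff)

lemma coset_index_cotrajectory_Suc:
  assumes \<phi>: "\<phi> \<in> End G T" and W: "compact_open_subgroup G T W" and n: "n \<ge> 1"
  defines "C \<equiv> cotrajectory G \<phi> W"
  shows "coset_index G W (C (Suc n)) = coset_index G W (C n) * coset_index G (C n) (C (Suc n))"
  unfolding C_def
proof (rule coset_index_chain[OF W])
  show "compact_open_subgroup G T (cotrajectory G \<phi> W n)"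
    "compact_open_subgroup G T (cotrajectory G \<phi> W (Suc n))"
    using n by (auto intro: compact_open_subgroup_cotrajectory[OF \<phi> W])
qed (use cotrajectory_subset[OF n] in \<open>auto simp: cotrajectory_Suc\<close>)

lemma coset_index_compact_open_pos:
  assumes "compact_open_subgroup G T W" "compact_open_subgroup G T C"
  shows "0 < coset_index G W C"
  using coset_index_pos[of W C] compact_open_subgroupD[OF assms(1)] compact_open_subgroupD[OF assms(2)]
  by auto

text \<open>The successive indices are eventually a constant \<open>a\<close>, so \<open>[W : C\<^sub>n]\<close> is eventually geometric with
  ratio \<open>a\<close> and the limit is \<open>ln a\<close>.\<close>

lemma entropy_sequence_convergent:
  assumes \<phi>: "\<phi> \<in> End G T" and W: "compact_open_subgroup G T W"
  obtains L :: real where "0 \<le> L"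
    "(\<lambda>n. ln (real (coset_index G W (cotrajectory G \<phi> W n))) / real n) \<longlonglongrightarrow> L"
proof -
  define C where "C = cotrajectory G \<phi> W"
  define b where "b n = coset_index G W (C n)" for n
  define a where "a n = coset_index G (C n) (C (Suc n))" for n
  have c: "compact_open_subgroup G T (C m)" if "m \<ge> 1" for m
    unfolding C_def using compact_open_subgroup_cotrajectory[OF \<phi> W that] .
  obtain N where N: "N \<ge> 1" "\<And>n. n \<ge> N \<Longrightarrow> a n = a N"
    using nonincreasing_nat_seq_eventually_const[of a]
      cotrajectory_index_decreasing[OF \<phi> W] unfolding a_def C_def by metis
  have aN: "a N > 0" and bN: "b N > 0"
    using coset_index_compact_open_pos c N(1) W by (simp_all add: a_def b_def)
  have b: "b n = b N * a N ^ (n - N)" if "n \<ge> N" for n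
    using that
  proof (induction n rule: dec_induct)
    case (step n)
    have "b (Suc n) = b n * a n"
      using coset_index_cotrajectory_Suc[OF \<phi> W, of n] step.hyps N(1) by (simp add: a_def b_def C_def)
    then show ?case using step N(2)[of n] by (simp add: Suc_diff_le)
  qed simp
  let ?c = "ln (real (b N)) - real N * ln (real (a N))"
  have "(\<lambda>n. ?c / real n + ln (real (a N))) \<longlonglongrightarrow> 0 + ln (real (a N))"
    by (intro tendsto_add lim_const_over_n tendsto_const)
  moreover have "\<forall>\<^sub>F n in sequentially. ?c / real n + ln (real (a N)) = ln (real (b n)) / real n"
    using eventually_ge_at_top[of N]
  proof eventually_elim
    case (elim n)
    have "ln (real (b n)) = ln (real (b N)) + real (n - N) * ln (real (a N))"
      using aN bN by (simp add: b[OF elim] ln_mult ln_realpow)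
    then have "ln (real (b n)) = ?c + real n * ln (real (a N))"
      using elim by (simp add: of_nat_diff algebra_simps)
    then show ?case using elim N(1) by (simp add: add_divide_distrib)
  qed
  ultimately have "(\<lambda>n. ln (real (b n)) / real n) \<longlonglongrightarrow> 0 + ln (real (a N))"
    by (rule Lim_transform_eventually)
  then have "(\<lambda>n. ln (real (b n)) / real n) \<longlonglongrightarrow> ln (real (a N))" by simp
  moreover have "0 \<le> ln (real (a N))" using aN by simp
  ultimately show ?thesis using that by (simp add: b_def C_def)
qed

lemma haar_measure_properties:
  defines "\<mu> \<equiv> haar_measure G T"
  shows "space \<mu> = carrier G" "sets \<mu> = sigma_sets (carrier G) {U. openin T U}"
    "emeasure \<mu> (carrier G) \<noteq> 0"
    "\<And>K. compactin T K \<Longrightarrow> emeasure \<mu> K < \<infinity>"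
    "\<And>U. openin T U \<Longrightarrow> emeasure \<mu> U = (SUP K\<in>{K. compactin T K \<and> K \<subseteq> U}. emeasure \<mu> K)"
    "\<And>x A. x \<in> carrier G \<Longrightarrow> A \<in> sets \<mu> \<Longrightarrow> emeasure \<mu> (x <# A) = emeasure \<mu> A"
  using is_left_haar_measure_haar_measure unfolding is_left_haar_measure_def \<mu>_def by blast+

lemma open_haar_measurable: "openin T U \<Longrightarrow> U \<in> sets (haar_measure G T)"
  by (simp add: haar_measure_properties(2) sigma_sets.Basic)

lemma closed_haar_measurable:
  assumes "closedin T C" shows "C \<in> sets (haar_measure G T)"
proof -
  have "space (haar_measure G T) - (carrier G - C) \<in> sets (haar_measure G T)"
    using open_haar_measurable[OF openin_complement[OF assms]] by (rule sets.compl_sets)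
  moreover have "carrier G - (carrier G - C) = C"
    using closedin_subset[OF assms] by (auto simp: topspace_eq)
  ultimately show ?thesis by (simp add: haar_measure_properties(1))
qed

lemma emeasure_UN_cosets:
  assumes C: "compact_open_subgroup G T C" and K: "compactin T K"
  shows "emeasure (haar_measure G T) (\<Union>x\<in>K. C #> x)
    = of_nat (coset_index G K C) * emeasure (haar_measure G T) C"
proof -
  let ?\<mu> = "haar_measure G T" and ?I = "(\<lambda>x. C #> x) ` K"
  note CD = compact_open_subgroupD[OF C]
  have KG: "K \<subseteq> carrier G" by (rule compact_subset_carrier[OF K])
  have each: "emeasure ?\<mu> D = emeasure ?\<mu> C \<and> D \<in> sets ?\<mu>" if D: "D \<in> ?I" for D
  proof -
    obtain x where x: "x \<in> K" "D = C #> x" using D by auto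
    have xG: "x \<in> carrier G" using x KG by auto
    have "D = x <# C" using x l_coset_eq_r_coset[OF xG CD(5)] by simp
    then show ?thesis 
      using haar_measure_properties(6)[OF xG open_haar_measurable[OF CD(2)]]
        open_haar_measurable[OF openin_l_coset[OF xG CD(2)]] by simp
  qed
  have disj: "disjoint_family_on (\<lambda>D. D) ?I"
    unfolding disjoint_family_on_def
  proof (intro ballI impI)
    fix D E assume "D \<in> ?I" "E \<in> ?I" "D \<noteq> E"
    then show "D \<inter> E = {}"
      using rcos_disjoint[OF CD(1)] KG by (fastforce simp: pairwise_def disjnt_def RCOSETS_def)
  qed
  have "(\<Union>x\<in>K. C #> x) = (\<Union>D\<in>?I. D)" by auto
  then have "emeasure ?\<mu> (\<Union>x\<in>K. C #> x) = (\<Sum>D\<in>?I. emeasure ?\<mu> D)"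
    using sum_emeasure[of "\<lambda>D. D" ?I ?\<mu>] each disj finite_cosets[OF K CD(1,2)] by (simp add: image_subset_iff)
  also have "\<dots> = (\<Sum>D\<in>?I. emeasure ?\<mu> C)" using each by (intro sum.cong) auto
  finally show ?thesis by (simp add: coset_index_def)
qed

text \<open>If a compact open subgroup were null, so would be every compact set, being covered by finitely
  many cosets, and by inner regularity the whole group.\<close>

lemma haar_measure_compact_open_subgroup:
  assumes C: "compact_open_subgroup G T C"
  shows "0 < measure (haar_measure G T) C"
proof -
  let ?\<mu> = "haar_measure G T"
  note CD = compact_open_subgroupD[OF C]
  have carrier_open: "openin T (carrier G)" using openin_topspace by (metis topspace_eq)
  have "emeasure ?\<mu> C \<noteq> 0"
  proof
    assume 0: "emeasure ?\<mu> C = 0"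
    have "emeasure ?\<mu> K = 0" if K: "compactin T K" for K
    proof -
      have KG: "K \<subseteq> carrier G" by (rule compact_subset_carrier[OF K])
      have "K \<subseteq> (\<Union>x\<in>K. C #> x)"
      proof
        fix x assume x: "x \<in> K"
        then have "x \<in> C #> x" using KG by (intro rcos_self[OF _ CD(1)]) auto
        then show "x \<in> (\<Union>x\<in>K. C #> x)" using x by blast
      qed
      moreover have "openin T (\<Union>x\<in>K. C #> x)" using KG CD by (auto intro!: openin_Union openin_r_coset)
      ultimately have "emeasure ?\<mu> K \<le> emeasure ?\<mu> (\<Union>x\<in>K. C #> x)"
        by (intro emeasure_mono open_haar_measurable)
      then show ?thesis by (simp add: emeasure_UN_cosets[OF C K] 0)
    qed
    then have "emeasure ?\<mu> (carrier G) = (SUP K\<in>{K. compactin T K \<and> K \<subseteq> carrier G}. 0)"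
      unfolding haar_measure_properties(5)[OF carrier_open] by (intro SUP_cong) auto
    also have "\<dots> \<le> 0" by (intro SUP_least) simp
    finally show False using haar_measure_properties(3) by simp
  qed
  then show ?thesis using haar_measure_properties(4)[OF CD(3)]
    by (simp add: measure_def enn2real_positive_iff zero_less_iff_neq_zero)
qed

lemma haar_measure_index:
  assumes W: "compact_open_subgroup G T W" and C: "compact_open_subgroup G T C" and sub: "C \<subseteq> W"
  shows "measure (haar_measure G T) W = real (coset_index G W C) * measure (haar_measure G T) C"
proof -
  note CD = compact_open_subgroupD[OF C] and WD = compact_open_subgroupD[OF W]
  have "(\<Union>x\<in>W. C #> x) = W"
  proof (intro equalityI subsetI)
    fix x assume x: "x \<in> W"
    then have "x \<in> C #> x" using WD(5) by (intro rcos_self[OF _ CD(1)]) auto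
    then show "x \<in> (\<Union>x\<in>W. C #> x)" using x by blast
  qed (use sub WD(1) in \<open>auto simp: r_coset_def subgroup.m_closed subset_iff\<close>)
  then show ?thesis using emeasure_UN_cosets[OF C WD(3)]
    by (simp add: measure_def enn2real_mult)
qed

text \<open>The measure of \<open>W\<close> itself is a constant that disappears after division by \<open>n\<close>.\<close>

theorem H_top_eq_limit:
  assumes \<phi>: "\<phi> \<in> End G T" and W: "compact_open_subgroup G T W"
    and L: "(\<lambda>n. ln (real (coset_index G W (cotrajectory G \<phi> W n))) / real n) \<longlonglongrightarrow> L"
  shows "H_top G T \<phi> W = ereal L"
proof -
  let ?\<mu> = "haar_measure G T" and ?C = "cotrajectory G \<phi> W"
  let ?c = "- ln (measure ?\<mu> W)"
  have "(\<lambda>n. ?c / real n + ln (real (coset_index G W (?C n))) / real n) \<longlonglongrightarrow> 0 + L"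
    by (intro tendsto_add L lim_const_over_n)
  moreover have "\<forall>\<^sub>F n in sequentially. ?c / real n + ln (real (coset_index G W (?C n))) / real n
      = - ln (measure ?\<mu> (?C n)) / real n"
    using eventually_ge_at_top[of 1]
  proof eventually_elim
    case (elim n)
    have C: "compact_open_subgroup G T (?C n)" by (rule compact_open_subgroup_cotrajectory[OF \<phi> W elim])
    have "measure ?\<mu> W = real (coset_index G W (?C n)) * measure ?\<mu> (?C n)"
      by (rule haar_measure_index[OF W C cotrajectory_subset[OF elim]])
    then have "ln (measure ?\<mu> W) = ln (real (coset_index G W (?C n))) + ln (measure ?\<mu> (?C n))"
      using coset_index_compact_open_pos[OF W C] haar_measure_compact_open_subgroup[OF C] by (simp add: ln_mult)
    then show ?case by (simp add: add_divide_distrib[symmetric])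
  qed
  ultimately have "(\<lambda>n. - ln (measure ?\<mu> (?C n)) / real n) \<longlonglongrightarrow> 0 + L"
    by (rule Lim_transform_eventually)
  then have "(\<lambda>n. ereal (- ln (measure ?\<mu> (?C n)) / real n)) \<longlonglongrightarrow> ereal L" by (simp add: tendsto_ereal)
  then show ?thesis unfolding H_top_def by (intro lim_imp_Limsup) auto
qed

lemma H_top_nonneg:
  assumes "\<phi> \<in> End G T" "compact_open_subgroup G T W"
  shows "0 \<le> H_top G T \<phi> W"
  using entropy_sequence_convergent[OF assms] H_top_eq_limit[OF assms] by (metis ereal_less_eq(5))

lemma closedin_cotrajectory:
  assumes \<phi>: "\<phi> \<in> End G T" and U: "closedin T U"
  shows "closedin T (cotrajectory G \<phi> U n)"
proof (induction n)
  case 0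
  show ?case using closedin_topspace[of T] by (simp add: cotrajectory_0 topspace_eq)
next
  case (Suc n)
  have "closedin T {x \<in> topspace T. (\<phi> ^^ n) x \<in> U}"
    by (rule closedin_continuous_map_preimage[OF EndD(2)[OF End_funpow[OF \<phi>]] U])
  then show ?case using Suc by (simp add: cotrajectory_Suc topspace_eq closedin_Int)
qed

text \<open>\<open>U\<close> is only a compact set here, so its cotrajectory is closed but need not be open; it has finite
  measure because it lies in \<open>U\<close>, and positive measure because it contains that of \<open>W\<close>.\<close>

lemma H_top_antimono:
  assumes \<phi>: "\<phi> \<in> End G T" and U: "compactin T U" and W: "compact_open_subgroup G T W" "W \<subseteq> U"
  shows "H_top G T \<phi> U \<le> H_top G T \<phi> W"
  unfolding H_top_def
proof (rule Limsup_mono)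
  let ?\<mu> = "haar_measure G T"
  have cU: "closedin T U" using compactin_imp_closedin[OF Hausdorff U] .
  show "\<forall>\<^sub>F n in sequentially. ereal (- ln (measure ?\<mu> (cotrajectory G \<phi> U n)) / real n)
      \<le> ereal (- ln (measure ?\<mu> (cotrajectory G \<phi> W n)) / real n)"
    using eventually_ge_at_top[of 1]
  proof eventually_elim
    case (elim n)
    let ?W = "cotrajectory G \<phi> W n" and ?U = "cotrajectory G \<phi> U n"
    have C: "compact_open_subgroup G T ?W" by (rule compact_open_subgroup_cotrajectory[OF \<phi> W(1) elim])
    have clU: "closedin T ?U" by (rule closedin_cotrajectory[OF \<phi> cU])
    have "compactin T ?U" using closed_compactin[OF U cotrajectory_subset[OF elim] clU] .
    then have "measure ?\<mu> ?W \<le> measure ?\<mu> ?U"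
      using haar_measure_properties(4)[of ?U] closed_haar_measurable[OF clU]
        open_haar_measurable[OF compact_open_subgroupD(2)[OF C]] cotrajectory_mono[OF W(2)]
      by (intro measure_mono_fmeasurable) (auto simp: fmeasurable_def)
    then have "ln (measure ?\<mu> ?W) \<le> ln (measure ?\<mu> ?U)"
      using haar_measure_compact_open_subgroup[OF C] by simp
    then show ?case by (simp add: divide_right_mono)
  qed
qed

theorem h_top_eq_SUP:
  assumes \<phi>: "\<phi> \<in> End G T" and B: "\<And>W. W \<in> B \<Longrightarrow> compact_open_subgroup G T W"
    and cofinal: "\<And>K. compact_open_subgroup G T K \<Longrightarrow> \<exists>W\<in>B. W \<subseteq> K"
  shows "h_top G T \<phi> = (SUP W\<in>B. H_top G T \<phi> W)"
  unfolding h_top_def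
proof (intro antisym SUP_least)
  fix U assume "U \<in> compact_nhds_one G T"
  then have U: "compactin T U" "\<one> \<in> T interior_of U" by (auto simp: compact_nhds_one_def)
  obtain K where K: "compact_open_subgroup G T K" "K \<subseteq> T interior_of U"
    using van_Dantzig[OF openin_interior_of U(2)] by blast
  obtain W where W: "W \<in> B" "W \<subseteq> K" using cofinal[OF K(1)] by blast
  have "W \<subseteq> U" using W K interior_of_subset by fastforce
  then have "H_top G T \<phi> U \<le> H_top G T \<phi> W" by (rule H_top_antimono[OF \<phi> U(1) B[OF W(1)]])
  also have "\<dots> \<le> (SUP W\<in>B. H_top G T \<phi> W)" using W by (intro SUP_upper)
  finally show "H_top G T \<phi> U \<le> (SUP W\<in>B. H_top G T \<phi> W)" .
next
  fix W assume "W \<in> B"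
  note WD = compact_open_subgroupD[OF B[OF this]]
  have "W \<in> compact_nhds_one G T" using WD by (simp add: compact_nhds_one_def interior_of_openin)
  then show "H_top G T \<phi> W \<le> (SUP U\<in>compact_nhds_one G T. H_top G T \<phi> U)" by (intro SUP_upper)
qed

lemma h_top_eq_SUP_all:
  assumes "\<phi> \<in> End G T"
  shows "h_top G T \<phi> = (SUP W\<in>Collect (compact_open_subgroup G T). H_top G T \<phi> W)"
  by (rule h_top_eq_SUP[OF assms]) auto

lemma h_top_nonneg:
  assumes \<phi>: "\<phi> \<in> End G T"
  shows "0 \<le> h_top G T \<phi>"
proof -
  obtain K where K: "compact_open_subgroup G T K" using ex_compact_open_subgroup by blast
  have "H_top G T \<phi> K \<le> h_top G T \<phi>"
    unfolding h_top_eq_SUP_all[OF \<phi>]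
    using K by (intro SUP_upper) auto
  then show ?thesis using H_top_nonneg[OF \<phi> K] by order
qed

lemma h_top_trivial:
  assumes \<phi>: "\<phi> \<in> End G T" and trivial: "\<And>x. x \<in> carrier G \<Longrightarrow> \<phi> x = \<one>"
  shows "h_top G T \<phi> = 0"
proof -
  have "H_top G T \<phi> W = 0" if W: "compact_open_subgroup G T W" for W
  proof -
    note WD = compact_open_subgroupD[OF W]
    have k: "(\<phi> ^^ k) x \<in> W" if x: "x \<in> W" for x k
    proof (cases k)
      case (Suc m)
      have "(\<phi> ^^ m) x \<in> carrier G" using EndD(3)[OF End_funpow[OF \<phi>]] x WD(5) by auto
      then show ?thesis using Suc trivial WD(6) by simp
    qed (use x in simp)
    have *: "cotrajectory G \<phi> W n = W" if n: "n \<ge> 1" for n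
      using cotrajectory_subset[OF n] k WD(5) by (auto simp: cotrajectory_def)
    have "\<forall>\<^sub>F n in sequentially. 0 = ln (real (coset_index G W (cotrajectory G \<phi> W n))) / real n"
      by (rule eventually_mono[OF eventually_ge_at_top[of 1]])
        (simp add: * coset_index_self[OF WD(1)])
    then have "(\<lambda>n. ln (real (coset_index G W (cotrajectory G \<phi> W n))) / real n) \<longlonglongrightarrow> 0"
      by (rule Lim_transform_eventually[OF tendsto_const])
    then show ?thesis by (simp add: H_top_eq_limit[OF \<phi> W] zero_ereal_def)
  qed
  then show ?thesis
    unfolding h_top_eq_SUP_all[OF \<phi>]
    using ex_compact_open_subgroup by (intro SUP_eq_const) auto
qed

end

text \<open>Entropy is invariant under open embeddings: it only depends on the action near the
  identity.\<close>

theorem h_top_open_embedding: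
  assumes A: "tdlc_abelian_group A S" and B: "tdlc_abelian_group B R"
    and \<phi>: "\<phi> \<in> End A S" and \<psi>: "\<psi> \<in> End B R"
    and f: "f \<in> hom A B" "inj_on f (carrier A)" "continuous_map S R f" "open_map S R f"
    and comm: "\<And>x. x \<in> carrier A \<Longrightarrow> f (\<phi> x) = \<psi> (f x)"
  shows "h_top A S \<phi> = h_top B R \<psi>"
proof -
  interpret A: tdlc_abelian_group A S by fact
  interpret B: tdlc_abelian_group B R by fact
  interpret f: group_hom A B f by (intro group_hom.intro group_hom_axioms.intro A.is_group B.is_group f(1))
  have fW: "compact_open_subgroup B R (f ` W)" if W: "compact_open_subgroup A S W" for W
    using A.compact_open_subgroupD[OF W] f(4) image_compactin[OF _ f(3)] f.subgroup_img_is_subgroup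
    by (simp add: compact_open_subgroup_def open_map_def)
  have pow: "f ((\<phi> ^^ k) x) = (\<psi> ^^ k) (f x)" if "x \<in> carrier A" for k x
    using that comm A.EndD(3)[OF A.End_funpow[OF \<phi>]] by (induction k) auto
  have cot: "cotrajectory B \<psi> (f ` W) n = f ` cotrajectory A \<phi> W n"
    if W: "compact_open_subgroup A S W" and n: "n \<ge> 1" for W n
  proof (intro equalityI subsetI)
    note WD = A.compact_open_subgroupD[OF W]
    fix y assume y: "y \<in> cotrajectory B \<psi> (f ` W) n"
    then have "y \<in> f ` W" using B.cotrajectory_subset[OF n] by blast
    then obtain x where x: "x \<in> W" "y = f x" by auto
    have xA: "x \<in> carrier A" using x WD by auto
    have "(\<phi> ^^ k) x \<in> W" if "k < n" for k
    proof -
      have "(\<psi> ^^ k) (f x) \<in> f ` W" using y x that by (simp add: cotrajectory_def)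
      then have "f ((\<phi> ^^ k) x) \<in> f ` W" using pow[OF xA] by simp
      then show ?thesis 
        using inj_on_image_mem_iff[OF f(2) _ WD(5)] A.EndD(3)[OF A.End_funpow[OF \<phi>] xA] by blast
    qed
    then show "y \<in> f ` cotrajectory A \<phi> W n" using x xA by (auto simp: cotrajectory_def)
  next
    fix y assume "y \<in> f ` cotrajectory A \<phi> W n"
    then obtain x where x: "x \<in> carrier A" "y = f x" "\<And>k. k < n \<Longrightarrow> (\<phi> ^^ k) x \<in> W"
      by (auto simp: cotrajectory_def)
    then show "y \<in> cotrajectory B \<psi> (f ` W) n"
      using pow[OF x(1)] by (auto simp: cotrajectory_def simp flip: pow)
  qed
  have index: "coset_index B (f ` W) (f ` C) = coset_index A W C"
    if "W \<subseteq> carrier A" "C \<subseteq> carrier A" for W C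
  proof -
    have img: "(\<lambda>y. f ` C #>\<^bsub>B\<^esub> y) ` f ` W = (\<lambda>D. f ` D) ` (\<lambda>x. C #>\<^bsub>A\<^esub> x) ` W"
    proof -
      have "f ` C #>\<^bsub>B\<^esub> f x = f ` (C #>\<^bsub>A\<^esub> x)" if "x \<in> W" for x
      proof -
        have "f ` (C #>\<^bsub>A\<^esub> x) = (\<lambda>c. f (c \<otimes>\<^bsub>A\<^esub> x)) ` C" by (auto simp: r_coset_def)
        also have "\<dots> = (\<lambda>c. f c \<otimes>\<^bsub>B\<^esub> f x) ` C"
          using \<open>W \<subseteq> carrier A\<close> \<open>C \<subseteq> carrier A\<close> that
          by (intro image_cong refl f.hom_mult) auto
        finally show ?thesis by (auto simp: r_coset_def)
      qed
      then show ?thesis by (simp add: image_image)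
    qed
    have "inj_on (\<lambda>D. f ` D) ((\<lambda>x. C #>\<^bsub>A\<^esub> x) ` W)"
    proof (rule inj_onI)
      fix D E assume DE: "D \<in> (\<lambda>x. C #>\<^bsub>A\<^esub> x) ` W" "E \<in> (\<lambda>x. C #>\<^bsub>A\<^esub> x) ` W" "f ` D = f ` E"
      then have "D \<subseteq> carrier A" "E \<subseteq> carrier A" using that by (auto simp: r_coset_def subset_iff)
      then show "D = E" using inj_on_image_eq_iff[OF f(2)] DE(3) by blast
    qed
    then show ?thesis by (simp add: coset_index_def img card_image)
  qed
  have H: "H_top B R \<psi> (f ` W) = H_top A S \<phi> W" if W: "compact_open_subgroup A S W" for W
  proof -
    obtain L where L: "(\<lambda>n. ln (real (coset_index A W (cotrajectory A \<phi> W n))) / real n) \<longlonglongrightarrow> L"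
      using A.entropy_sequence_convergent[OF \<phi> W] by blast
    have "\<forall>\<^sub>F n in sequentially. ln (real (coset_index A W (cotrajectory A \<phi> W n))) / real n
        = ln (real (coset_index B (f ` W) (cotrajectory B \<psi> (f ` W) n))) / real n"
      using eventually_ge_at_top[of 1]
    proof eventually_elim
      case (elim n)
      have "cotrajectory A \<phi> W n \<subseteq> carrier A" by (auto simp: cotrajectory_def)
      then show ?case using index[OF A.compact_open_subgroupD(5)[OF W]] cot[OF W elim] by simp
    qed
    then have "(\<lambda>n. ln (real (coset_index B (f ` W) (cotrajectory B \<psi> (f ` W) n))) / real n) \<longlonglongrightarrow> L"
      by (rule Lim_transform_eventually[OF L])
    then show ?thesis using A.H_top_eq_limit[OF \<phi> W L] B.H_top_eq_limit[OF \<psi> fW[OF W]] by simp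
  qed
  let ?A = "Collect (compact_open_subgroup A S)"
  have "h_top B R \<psi> = (SUP W\<in>(\<lambda>W. f ` W) ` ?A. H_top B R \<psi> W)"
  proof (rule B.h_top_eq_SUP[OF \<psi>])
    fix K assume K: "compact_open_subgroup B R K"
    note KD = B.compact_open_subgroupD[OF K]
    have "openin S {x \<in> topspace S. f x \<in> K}" by (rule openin_continuous_map_preimage[OF f(3) KD(2)])
    moreover have "\<one>\<^bsub>A\<^esub> \<in> {x \<in> topspace S. f x \<in> K}" using KD(6) by (simp add: A.topspace_eq)
    ultimately obtain W where "compact_open_subgroup A S W" "W \<subseteq> {x \<in> topspace S. f x \<in> K}"
      using A.van_Dantzig by blast
    then show "\<exists>W\<in>(\<lambda>W. f ` W) ` ?A. W \<subseteq> K" by blast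
  qed (use fW in auto)
  also have "\<dots> = (SUP W\<in>?A. H_top A S \<phi> W)"
    unfolding image_image using H by (intro SUP_cong) auto
  also have "\<dots> = h_top A S \<phi>" by (rule A.h_top_eq_SUP[OF \<phi>, symmetric]) auto
  finally show ?thesis by simp
qed

section \<open>Topological primary components\<close>

text \<open>The \<open>p\<close>-component and its complement are treated together: \<open>M\<close> is a multiplicative set of
  exponents, the powers of \<open>p\<close> or the numbers prime to \<open>p\<close>, and the component consists of the elements
  that modulo each compact open subgroup are killed by some exponent in \<open>M\<close>.\<close>

definition radical :: "('a, 'b) monoid_scheme \<Rightarrow> nat set \<Rightarrow> 'a set \<Rightarrow> 'a set" where
  "radical G M D = {x \<in> carrier G. \<exists>m\<in>M. x [^]\<^bsub>G\<^esub> m \<in> D}"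

definition radical_component :: "('a, 'b) monoid_scheme \<Rightarrow> 'a topology \<Rightarrow> nat set \<Rightarrow> 'a set" where
  "radical_component G T M =
     {x \<in> carrier G. \<forall>D. compact_open_subgroup G T D \<longrightarrow> x \<in> radical G M D}"

abbreviation prime_powers :: "nat \<Rightarrow> nat set" where
  "prime_powers p \<equiv> range (\<lambda>n. p ^ n)"

abbreviation coprime_numbers :: "nat \<Rightarrow> nat set" where
  "coprime_numbers p \<equiv> {m. coprime m p}"

abbreviation coprime_component :: "('a, 'b) monoid_scheme \<Rightarrow> 'a topology \<Rightarrow> nat \<Rightarrow> 'a set" where
  "coprime_component G T p \<equiv> radical_component G T (coprime_numbers p)"

lemma (in group) subgroup_nat_pow_closed:
  "subgroup D G \<Longrightarrow> x \<in> D \<Longrightarrow> x [^] (n::nat) \<in> D"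
  by (induction n) (auto simp: subgroup.one_closed subgroup.m_closed)

lemma (in comm_group) mult_inv_cancel_left:
  "x \<in> carrier G \<Longrightarrow> y \<in> carrier G \<Longrightarrow> (x \<otimes> y) \<otimes> inv x = y"
  by (simp add: m_comm[of x y] m_assoc)

lemma (in comm_group) nat_pow_mult_distrib:
  "x \<in> carrier G \<Longrightarrow> y \<in> carrier G \<Longrightarrow> (x \<otimes> y) [^] (n::nat) = x [^] n \<otimes> y [^] n"
  by (induction n) (simp_all add: m_ac)

lemma (in comm_group) mem_subgroup_if_coprime_powers:
  assumes D: "subgroup D G" and x: "x \<in> carrier G" and mn: "coprime m (n::nat)"
    and m: "x [^] m \<in> D" and n: "x [^] n \<in> D"
  shows "x \<in> D"
proof (cases "m = 0")
  case True
  then show ?thesis using mn n x by simp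
next
  case False
  then obtain a b where ab: "m * a = n * b + 1" using bezout_nat[of m n] mn by auto
  have "(x [^] m) [^] a = (x [^] n) [^] b \<otimes> x"
    using x by (simp add: nat_pow_pow ab)
  then have "x = inv ((x [^] n) [^] b) \<otimes> (x [^] m) [^] a" using x by (simp add: inv_solve_left m_assoc[symmetric])
  moreover have "inv ((x [^] n) [^] b) \<otimes> (x [^] m) [^] a \<in> D"
    using D m n by (simp add: subgroup.m_closed subgroup.m_inv_closed subgroup_nat_pow_closed)
  ultimately show ?thesis by simp
qed

locale mult_closed_set =
  fixes M :: "nat set"
  assumes one_mem: "1 \<in> M" and mult_mem: "m \<in> M \<Longrightarrow> n \<in> M \<Longrightarrow> m * n \<in> M"

lemma mult_closed_prime_powers: "mult_closed_set (prime_powers p)"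
proof
  show "1 \<in> prime_powers p" by (rule range_eqI[of _ _ 0]) simp
  fix m n assume "m \<in> prime_powers p" "n \<in> prime_powers p"
  then show "m * n \<in> prime_powers p" by (auto simp: power_add[symmetric])
qed

lemma mult_closed_coprime: "mult_closed_set (coprime_numbers p)"
  by unfold_locales auto

context comm_group
begin

lemma subgroup_radical:
  assumes M: "mult_closed_set M" and D: "subgroup D G"
  shows "subgroup (radical G M D) G"
proof -
  interpret mult_closed_set M by fact
  show ?thesis
  proof
    show "radical G M D \<subseteq> carrier G" by (auto simp: radical_def)
    show "\<one> \<in> radical G M D" using one_mem D by (auto simp: radical_def subgroup.one_closed)
    fix x assume x: "x \<in> radical G M D"
    then obtain k where k: "k \<in> M" "x [^] k \<in> D" "x \<in> carrier G" by (auto simp: radical_def)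
    then have "inv x [^] k \<in> D" using D by (simp add: nat_pow_inv subgroup.m_inv_closed)
    then show "inv x \<in> radical G M D" using k by (auto simp: radical_def)
    fix y assume y: "y \<in> radical G M D"
    obtain m n where mn: "m \<in> M" "n \<in> M" "x [^] m \<in> D" "y [^] n \<in> D" and xy: "x \<in> carrier G" "y \<in> carrier G"
      using x y by (auto simp: radical_def)
    have "(x \<otimes> y) [^] (m * n) = (x [^] m) [^] n \<otimes> (y [^] n) [^] m"
      using xy by (simp add: nat_pow_mult_distrib nat_pow_pow mult.commute[of n m])
    also have "\<dots> \<in> D" using D mn by (simp add: subgroup.m_closed subgroup_nat_pow_closed)
    finally show "x \<otimes> y \<in> radical G M D" using xy mult_mem[OF mn(1,2)] by (auto simp: radical_def)
  qed
qed

lemma subset_radical: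
  assumes M: "mult_closed_set M" and D: "D \<subseteq> carrier G"
  shows "D \<subseteq> radical G M D"
  using mult_closed_set.one_mem[OF M] D by (force simp: radical_def intro!: bexI[of _ 1])

lemma radical_mono: "D \<subseteq> E \<Longrightarrow> radical G M D \<subseteq> radical G M E"
  by (auto simp: radical_def)

end

context tdlc_abelian_group
begin

lemma openin_radical:
  assumes M: "mult_closed_set M" and D: "compact_open_subgroup G T D"
  shows "openin T (radical G M D)"
proof -
  note DD = compact_open_subgroupD[OF D]
  have "D \<noteq> {}" using DD(6) by blast
  then show ?thesis
    by (rule open_subgroupI[OF subgroup_radical[OF M DD(1)] DD(2) _ subset_radical[OF M DD(5)]])
qed

lemma radical_component_eq_Inter:
  assumes M: "mult_closed_set M"
  shows "radical_component G T M = (\<Inter>D\<in>Collect (compact_open_subgroup G T). radical G M D)"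
  using ex_compact_open_subgroup unfolding radical_component_def radical_def by blast

lemma subgroup_radical_component:
  assumes M: "mult_closed_set M"
  shows "subgroup (radical_component G T M) G"
  unfolding radical_component_eq_Inter[OF M]
proof (rule subgroups_Inter)
  show "radical G M ` Collect (compact_open_subgroup G T) \<noteq> {}"
    using ex_compact_open_subgroup by blast
  fix S assume "S \<in> radical G M ` Collect (compact_open_subgroup G T)"
  then obtain D where D: "compact_open_subgroup G T D" "S = radical G M D" by blast
  then show "subgroup S G" using subgroup_radical[OF M compact_open_subgroupD(1)[OF D(1)]] by simp
qed

lemma closedin_radical:
  assumes M: "mult_closed_set M" and D: "compact_open_subgroup G T D"
  shows "closedin T (radical G M D)"
  by (rule open_subgroup_closed[OF subgroup_radical[OF M compact_open_subgroupD(1)[OF D]]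
      openin_radical[OF M D]])

lemma closedin_radical_component:
  assumes M: "mult_closed_set M"
  shows "closedin T (radical_component G T M)"
  unfolding radical_component_eq_Inter[OF M]
proof (rule closedin_Inter)
  show "radical G M ` Collect (compact_open_subgroup G T) \<noteq> {}"
    using ex_compact_open_subgroup by blast
  fix S assume "S \<in> radical G M ` Collect (compact_open_subgroup G T)"
  then show "closedin T S" using closedin_radical[OF M] by blast
qed

text \<open>Convergence of \<open>x [^] (p ^ n)\<close> to the identity can be tested on compact open subgroups, and there one
  power inside the subgroup keeps all later ones inside.\<close>

lemma p_component_eq: "p_component G T p = radical_component G T (prime_powers p)"
proof (intro equalityI subsetI)
  fix x assume x: "x \<in> p_component G T p"
  then have xG: "x \<in> carrier G" by (simp add: p_component_def)
  have "\<exists>n. x [^] (p ^ n) \<in> D" if D: "compact_open_subgroup G T D" for D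
  proof -
    have "\<forall>\<^sub>F n in sequentially. x [^] (p ^ n) \<in> D"
      using x compact_open_subgroupD(2,6)[OF D] unfolding p_component_def limitin_def by blast
    then show ?thesis by (auto simp: eventually_sequentially)
  qed
  then show "x \<in> radical_component G T (prime_powers p)"
    using xG by (auto simp: radical_component_def radical_def)
next
  fix x assume x: "x \<in> radical_component G T (prime_powers p)"
  then have xG: "x \<in> carrier G" by (simp add: radical_component_def)
  have "\<forall>\<^sub>F n in sequentially. x [^] (p ^ n) \<in> U" if U: "openin T U" "\<one> \<in> U" for U
  proof -
    obtain D where D: "compact_open_subgroup G T D" "D \<subseteq> U" using van_Dantzig[OF U] by blast
    obtain n where n: "x [^] (p ^ n) \<in> D"
      using x D(1) by (auto simp: radical_component_def radical_def)
    have "x [^] (p ^ m) \<in> U" if m: "m \<ge> n" for m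
    proof -
      have "x [^] (p ^ m) = (x [^] (p ^ n)) [^] (p ^ (m - n))"
        using xG m by (simp add: nat_pow_pow power_add[symmetric])
      then show ?thesis
        using subgroup_nat_pow_closed[OF compact_open_subgroupD(1)[OF D(1)] n] D(2) by auto
    qed
    then show ?thesis by (auto simp: eventually_sequentially)
  qed
  then show "x \<in> p_component G T p" using xG by (simp add: p_component_def limitin_def topspace_eq)
qed

lemma subgroup_p_component: "subgroup (p_component G T p) G"
  unfolding p_component_eq by (rule subgroup_radical_component[OF mult_closed_prime_powers])

lemma closedin_p_component: "closedin T (p_component G T p)"
  unfolding p_component_eq by (rule closedin_radical_component[OF mult_closed_prime_powers])

lemma p_componentD:
  assumes "x \<in> p_component G T p" "compact_open_subgroup G T D"
  obtains n where "x [^] (p ^ n) \<in> D"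
  using assms unfolding p_component_eq by (auto simp: radical_component_def radical_def)

lemma p_component_subset: "p_component G T p \<subseteq> carrier G"
  by (auto simp: p_component_def)

lemma coprime_componentD:
  assumes "x \<in> coprime_component G T p" "compact_open_subgroup G T D"
  obtains m where "coprime m p" "x [^] m \<in> D"
  using assms by (auto simp: radical_component_def radical_def)

lemma p_component_Int_coprime_component:
  assumes "x \<in> p_component G T p" "x \<in> coprime_component G T p"
  shows "x = \<one>"
proof (rule ccontr)
  assume ne: "x \<noteq> \<one>"
  have xG: "x \<in> carrier G" using assms by (auto simp: p_component_def)
  obtain D where D: "compact_open_subgroup G T D" "x \<notin> D"
    using compact_open_subgroups_separate[OF xG ne] by blast
  obtain n where n: "x [^] (p ^ n) \<in> D" using p_componentD[OF assms(1) D(1)] .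
  obtain m :: nat where m: "coprime m p" "x [^] m \<in> D" using coprime_componentD[OF assms(2) D(1)] .
  have "coprime (p ^ n) m" using m by (simp add: coprime_commute)
  then have "x \<in> D"
    using mem_subgroup_if_coprime_powers[OF compact_open_subgroupD(1)[OF D(1)] xG _ n m(2)] by simp
  then show False using D by simp
qed

text \<open>The powers of \<open>x\<close> meet only finitely many cosets of \<open>D\<close>.\<close>

lemma ex_pow_mem_open_subgroup:
  assumes W: "compact_open_subgroup G T W" and D: "subgroup D G" "openin T D" and x: "x \<in> W"
  shows "\<exists>d>0. x [^] (d::nat) \<in> D"
proof -
  note WD = compact_open_subgroupD[OF W]
  have xG: "x \<in> carrier G" using x WD by auto
  have "range (\<lambda>n::nat. D #> x [^] n) \<subseteq> (\<lambda>y. D #> y) ` W"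
    using subgroup_nat_pow_closed[OF WD(1) x] by (intro image_subsetI imageI)
  then have "finite (range (\<lambda>n::nat. D #> x [^] n))"
    using finite_cosets[OF WD(3) D] finite_subset by blast
  then have "\<not> inj (\<lambda>n::nat. D #> x [^] n)" using finite_imageD by blast
  then obtain m n :: nat where mn: "m < n" "D #> x [^] n = D #> x [^] m"
    unfolding inj_def by (metis linorder_neqE_nat)
  have "x [^] n \<otimes> inv (x [^] m) \<in> D" using r_coset_eqD[OF D(1) _ _ mn(2)] xG by simp
  moreover have "x [^] n = x [^] (n - m) \<otimes> x [^] m" using mn(1) xG by (simp add: nat_pow_mult)
  then have "x [^] n \<otimes> inv (x [^] m) = x [^] (n - m)" using xG by (simp add: m_assoc)
  ultimately show ?thesis using mn(1) by (intro exI[of _ "n - m"]) simp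
qed

text \<open>Modulo an open subgroup every element of a compact subgroup has finite order, so it splits
  there into a power whose order is a power of \<open>p\<close> and one whose order is prime to \<open>p\<close>.\<close>

lemma primary_split_mod_open:
  assumes p: "prime p" and W: "compact_open_subgroup G T W" and D: "compact_open_subgroup G T D"
    and x: "x \<in> W"
  shows "\<exists>y\<in>W. y \<in> radical G (prime_powers p) D \<and> x \<otimes> inv y \<in> radical G (coprime_numbers p) D"
proof -
  note WD = compact_open_subgroupD[OF W] and DD = compact_open_subgroupD[OF D]
  have xG: "x \<in> carrier G" using x WD by auto
  obtain d :: nat where d: "d > 0" "x [^] d \<in> D" using ex_pow_mem_open_subgroup[OF W DD(1,2) x] by blast
  obtain d' where d': "d = p ^ multiplicity p d * d'" "\<not> p dvd d'"
    by (rule multiplicity_decompose'[of d p]) (use d(1) p not_prime_unit in auto)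
  define q where "q = p ^ multiplicity p d"
  have dq: "d = q * d'" using d'(1) by (simp add: q_def)
  have cop: "coprime d' p" using prime_imp_coprime[OF p d'(2)] by (simp add: coprime_commute)
  have "coprime q d'" using cop by (simp add: q_def coprime_commute)
  \<comment> \<open>The exponent \<open>e\<close> is \<open>1\<close> modulo \<open>q\<close> and \<open>0\<close> modulo \<open>d'\<close>; adding \<open>q * d'\<close> makes it positive, so that
    \<open>e - 1\<close> is a true difference.\<close>
  then obtain z where z: "[z = 1] (mod q)" "[z = 0] (mod d')"
    using binary_chinese_remainder_nat by blast
  define e where "e = z + q * d'"
  have pos: "q > 0" "d' > 0" using d(1) dq by auto
  have "[e = 1] (mod q)" using z(1) by (simp add: e_def cong_def)
  moreover have e1: "e \<ge> 1" unfolding e_def using mult_pos_pos[OF pos] by linarith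
  ultimately have "q dvd e - 1" by (simp add: cong_altdef_nat)
  then obtain c where c: "e = 1 + q * c" using e1 by (metis dvd_def le_add_diff_inverse)
  have "d' dvd e" using z(2) by (simp add: e_def cong_0_iff)
  then obtain k where k: "e = d' * k" by blast
  let ?y = "x [^] e"
  have "?y [^] q = (x [^] d) [^] k" using xG by (simp add: nat_pow_pow k dq mult_ac)
  then have "?y [^] q \<in> D" using subgroup_nat_pow_closed[OF DD(1) d(2)] by simp
  then have y1: "?y \<in> radical G (prime_powers p) D" using xG by (auto simp: radical_def q_def)
  have "?y = x \<otimes> x [^] (q * c)" using xG by (simp add: c m_comm)
  then have "x \<otimes> inv ?y = inv (x [^] (q * c))" using xG by (simp add: inv_mult m_assoc[symmetric])
  then have "(x \<otimes> inv ?y) [^] d' = inv ((x [^] d) [^] c)"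
    using xG by (simp add: nat_pow_inv nat_pow_pow dq mult_ac)
  then have "(x \<otimes> inv ?y) [^] d' \<in> D"
    using subgroup_nat_pow_closed[OF DD(1) d(2)] DD(1) by (simp add: subgroup.m_inv_closed)
  then have "x \<otimes> inv ?y \<in> radical G (coprime_numbers p) D"
    using xG cop by (auto simp: radical_def)
  then show ?thesis using y1 subgroup_nat_pow_closed[OF WD(1) x] by blast
qed

lemma compact_open_subgroup_finite_Inter:
  assumes "finite \<D>" "compact_open_subgroup G T W" "\<And>D. D \<in> \<D> \<Longrightarrow> compact_open_subgroup G T D"
  shows "compact_open_subgroup G T (W \<inter> \<Inter>\<D>)"
  using assms
proof (induction \<D>)
  case (insert D \<D>)
  have "compact_open_subgroup G T (W \<inter> \<Inter>\<D>)" using insert by blast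
  then have "compact_open_subgroup G T ((W \<inter> \<Inter>\<D>) \<inter> D)"
    by (rule compact_open_subgroup_Int) (simp add: insert.prems)
  moreover have "(W \<inter> \<Inter>\<D>) \<inter> D = W \<inter> \<Inter>(insert D \<D>)" by auto
  ultimately show ?case by simp
qed simp

text \<open>By compactness the splittings modulo all open subgroups come from a single one.\<close>

theorem primary_decomposition:
  assumes p: "prime p" and W: "compact_open_subgroup G T W" and x: "x \<in> W"
  shows "\<exists>y\<in>W \<inter> p_component G T p. \<exists>z\<in>W \<inter> coprime_component G T p. x = y \<otimes> z"
proof -
  note WD = compact_open_subgroupD[OF W]
  have xG: "x \<in> carrier G" using x WD by auto
  let ?P = "\<lambda>D. radical G (prime_powers p) D" and ?Q = "\<lambda>D. radical G (coprime_numbers p) D"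
  define F where "F D = ?P D \<inter> {y \<in> topspace T. x \<otimes> inv y \<in> ?Q D}" for D
  let ?C = "Collect (compact_open_subgroup G T)"
  have closed: "closedin T (F D)" if D: "D \<in> ?C" for D
  proof -
    have clo: "closedin T (radical G M D)" if "mult_closed_set M" for M
      using closedin_radical[OF that] D by simp
    have "continuous_map T T (\<lambda>y. x \<otimes> inv y)"
      using continuous_map_compose[OF continuous_inv continuous_map_left_translation[OF xG]]
      by (simp add: o_def)
    then have "closedin T {y \<in> topspace T. x \<otimes> inv y \<in> ?Q D}"
      using closedin_continuous_map_preimage clo[OF mult_closed_coprime] by blast
    then show ?thesis unfolding F_def using clo[OF mult_closed_prime_powers] by blast
  qed
  have "W \<inter> \<Inter>\<F> \<noteq> {}" if \<F>: "finite \<F>" "\<F> \<subseteq> F ` ?C" for \<F>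
  proof -
    obtain \<D> where \<D>: "\<D> \<subseteq> ?C" "finite \<D>" "\<F> = F ` \<D>"
      using finite_subset_image[OF \<F>] by blast
    have E: "compact_open_subgroup G T (W \<inter> \<Inter>\<D>)"
      using \<D> by (intro compact_open_subgroup_finite_Inter W) auto
    obtain y where y: "y \<in> W" "y \<in> ?P (W \<inter> \<Inter>\<D>)" "x \<otimes> inv y \<in> ?Q (W \<inter> \<Inter>\<D>)"
      using primary_split_mod_open[OF p W E x] by blast
    have "y \<in> F D" if "D \<in> \<D>" for D
    proof -
      have "W \<inter> \<Inter>\<D> \<subseteq> D" using that by auto
      then have "y \<in> ?P D" "x \<otimes> inv y \<in> ?Q D" using y radical_mono by blast+
      then show ?thesis using y(1) WD(5) by (auto simp: F_def topspace_eq)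
    qed
    then show ?thesis using y(1) \<D>(3) by auto
  qed
  then have "W \<inter> \<Inter>(F ` ?C) \<noteq> {}"
    using WD(3) closed unfolding compactin_fip by (metis (no_types, lifting) imageE)
  then obtain y where y: "y \<in> W" "\<And>D. compact_open_subgroup G T D \<Longrightarrow> y \<in> F D" by auto
  have yG: "y \<in> carrier G" using y(1) WD(5) by auto
  have "y \<in> p_component G T p"
    unfolding p_component_eq radical_component_def using y(2) yG by (auto simp: F_def)
  moreover have "x \<otimes> inv y \<in> coprime_component G T p"
    unfolding radical_component_def using y(2) yG xG by (auto simp: F_def)
  moreover have "x \<otimes> inv y \<in> W" using x y(1) WD(1) by (simp add: subgroup.m_closed subgroup.m_inv_closed)
  moreover have "x = y \<otimes> (x \<otimes> inv y)" using xG yG by (simp add: m_lcomm)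
  ultimately show ?thesis using y(1) by blast
qed

text \<open>An element of a compact open subgroup that is \<open>p\<close>-primary modulo a closed subgroup \<open>H\<close> agrees
  modulo \<open>H\<close> with an element of the \<open>p\<close>-component: its part prime to \<open>p\<close> lies in \<open>H\<close>.\<close>

theorem p_component_lift:
  assumes p: "prime p" and W: "compact_open_subgroup G T W" and H: "subgroup H G" "closedin T H"
    and x: "x \<in> W" and primary: "\<And>D. compact_open_subgroup G T D \<Longrightarrow> \<exists>n. x [^] (p ^ n) \<in> D <#> H"
  shows "\<exists>y\<in>W \<inter> p_component G T p. \<exists>h\<in>H. x = y \<otimes> h"
proof -
  note WD = compact_open_subgroupD[OF W]
  have xG: "x \<in> carrier G" using x WD by auto
  obtain y z where y: "y \<in> W" "y \<in> p_component G T p" and z: "z \<in> W" "z \<in> coprime_component G T p"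
    and xyz: "x = y \<otimes> z" using primary_decomposition[OF p W x] by blast
  have yzG: "y \<in> carrier G" "z \<in> carrier G" using y z WD(5) by auto
  \<comment> \<open>Modulo \<open>D <#> H\<close> the factor \<open>z\<close> is killed both by a power of \<open>p\<close> and by a number prime to \<open>p\<close>.\<close>
  have zDH: "z \<in> D <#> H" if D: "compact_open_subgroup G T D" for D
  proof -
    note DD = compact_open_subgroupD[OF D]
    have S: "subgroup (D <#> H) G" by (rule mult_subgroups[OF DD(1) H(1)])
    have sub: "D \<subseteq> D <#> H"
    proof
      fix u assume u: "u \<in> D"
      then have "u = u \<otimes> \<one>" using DD(5) by auto
      then show "u \<in> D <#> H" unfolding set_mult_def using u subgroup.one_closed[OF H(1)] by blast
    qed
    obtain n where n: "x [^] (p ^ n) \<in> D <#> H" using primary[OF D] by blast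
    obtain m where m: "y [^] (p ^ m) \<in> D" using p_componentD[OF y(2) D] .
    obtain k where k: "coprime k p" "z [^] k \<in> D" using coprime_componentD[OF z(2) D] .
    let ?R = "radical G (prime_powers p) (D <#> H)"
    have R: "subgroup ?R G" by (rule subgroup_radical[OF mult_closed_prime_powers S])
    have "x \<in> ?R" using n xG by (auto simp: radical_def)
    moreover have "y \<in> ?R" using m sub yzG by (auto simp: radical_def)
    ultimately have "inv y \<otimes> x \<in> ?R" using R by (simp add: subgroup.m_closed subgroup.m_inv_closed)
    moreover have "inv y \<otimes> x = z" using yzG by (simp add: xyz m_assoc[symmetric])
    ultimately obtain j where j: "z [^] (p ^ j) \<in> D <#> H" by (auto simp: radical_def)
    have "coprime (p ^ j) k" using k(1) by (simp add: coprime_commute)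
    then show ?thesis
      using mem_subgroup_if_coprime_powers[OF S yzG(2) _ j] k(2) sub by blast
  qed
  have "z \<in> H"
  proof (rule ccontr)
    assume "z \<notin> H"
    then obtain D where D: "compact_open_subgroup G T D" "(z <# D) \<inter> H = {}"
      using compact_open_subgroup_avoiding[OF H(2) yzG(2)] by blast
    note DD = compact_open_subgroupD[OF D(1)]
    obtain u h where uh: "u \<in> D" "h \<in> H" "z = u \<otimes> h" using zDH[OF D(1)] by (auto simp: set_mult_def)
    have G: "u \<in> carrier G" "h \<in> carrier G" using uh DD(5) subgroup.subset[OF H(1)] by auto
    have "z \<otimes> inv u = h" using mult_inv_cancel_left[OF G] uh(3) by simp
    moreover have "z \<otimes> inv u \<in> z <# D"
      using uh(1) DD(1) by (auto simp: l_coset_def subgroup.m_inv_closed)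
    ultimately show False using D(2) uh(2) by auto
  qed
  then show ?thesis using y xyz by blast
qed

section \<open>The index as a product over primes\<close>

abbreviation component_index :: "nat \<Rightarrow> 'a set \<Rightarrow> 'a set \<Rightarrow> nat" where
  "component_index p W C \<equiv> coset_index G (W \<inter> p_component G T p) (C \<inter> p_component G T p)"

lemma tdlc_abelian_group_p_component:
  "tdlc_abelian_group (p_component_group G T p) (p_component_topology G T p)"
  by (rule tdlc_abelian_group_closed_subgroup[OF subgroup_p_component closedin_p_component])

lemma compact_open_subgroup_p_component:
  "compact_open_subgroup G T W \<Longrightarrow>
    compact_open_subgroup (p_component_group G T p) (p_component_topology G T p) (W \<inter> p_component G T p)"
  by (rule compact_open_subgroup_restrict[OF _ subgroup_p_component closedin_p_component])

lemma component_index_chain: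
  assumes "compact_open_subgroup G T W" "compact_open_subgroup G T D" "compact_open_subgroup G T C"
    "C \<subseteq> D" "D \<subseteq> W"
  shows "component_index p W C = component_index p W D * component_index p D C"
  using tdlc_abelian_group.coset_index_chain[OF tdlc_abelian_group_p_component[of p]
      compact_open_subgroup_p_component[OF assms(1), of p] compact_open_subgroup_p_component[OF assms(2), of p]
      compact_open_subgroup_p_component[OF assms(3), of p]] assms(4,5) by auto

lemma coset_index_eq_1D:
  assumes C: "subgroup C G" and W: "W \<subseteq> carrier G" "\<one> \<in> W" and 1: "coset_index G W C = 1"
  shows "W \<subseteq> C"
proof
  fix x assume x: "x \<in> W"
  obtain D where D: "(\<lambda>x. C #> x) ` W = {D}"
    using 1 by (auto simp: coset_index_def card_1_singleton_iff)
  then have "C #> x = C #> \<one>" using x W(2) by blast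
  then show "x \<in> C" using r_coset_eqD[OF C _ one_closed, of x] x W(1) by auto
qed

text \<open>All of \<open>D/C\<close> is \<open>q\<close>-primary, so it is covered by the \<open>q\<close>-component of \<open>D\<close>
  (\<open>p_component_lift\<close>); an element of another component is killed modulo \<open>C\<close> by two coprime
  exponents.\<close>

lemma component_index_exponent:
  assumes q: "prime q" and D: "compact_open_subgroup G T D" and C: "compact_open_subgroup G T C"
    and CD: "C \<subseteq> D" and exponent: "\<And>x. x \<in> D \<Longrightarrow> x [^] q \<in> C"
  shows "component_index q D C = coset_index G D C"
    and "\<And>p. prime p \<Longrightarrow> p \<noteq> q \<Longrightarrow> component_index p D C = 1"
proof -
  note DD = compact_open_subgroupD[OF D] and CC = compact_open_subgroupD[OF C]
  let ?G = "p_component G T q"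
  note GG = subgroup_p_component[of q]
  have S: "subgroup (C \<inter> ?G) G" by (rule subgroups_Inter_pair[OF CC(1) GG])
  have "(\<lambda>x. C #> x) ` D = (\<lambda>x. C #> x) ` (D \<inter> ?G)"
  proof (intro equalityI subsetI)
    fix K assume "K \<in> (\<lambda>x. C #> x) ` D"
    then obtain x where x: "x \<in> D" "K = C #> x" by auto
    have "\<exists>n. x [^] (q ^ n) \<in> E <#> C" if E: "compact_open_subgroup G T E" for E
    proof -
      have "x [^] q = \<one> \<otimes> x [^] q" using x DD(5) by auto
      then have "x [^] (q ^ 1) \<in> E <#> C"
        unfolding set_mult_def using compact_open_subgroupD(6)[OF E] exponent[OF x(1)] by auto
      then show ?thesis by blast
    qed
    then obtain y c where yc: "y \<in> D" "y \<in> ?G" "c \<in> C" "x = y \<otimes> c"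
      using p_component_lift[OF q D CC(1,4) x(1)] by blast
    have G: "y \<in> carrier G" "c \<in> carrier G" using yc DD CC by auto
    then have "x \<otimes> inv y = c" using mult_inv_cancel_left[OF G] yc(4) by simp
    then have "C #> x = C #> y" using r_coset_eqI[OF CC(1), of x y] G yc by simp
    then show "K \<in> (\<lambda>x. C #> x) ` (D \<inter> ?G)" using x yc by blast
  qed auto
  then have "coset_index G D C = coset_index G (D \<inter> ?G) C" by (simp add: coset_index_def)
  also have "\<dots> = component_index q D C"
  proof -
    have fin: "finite ((\<lambda>x. C #> x) ` (D \<inter> ?G))"
      using finite_subset[OF image_mono finite_cosets[OF DD(3) CC(1,2)]] by auto
    interpret P: tdlc_abelian_group "p_component_group G T q" "p_component_topology G T q"
      by (rule tdlc_abelian_group_p_component)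
    have fin': "finite ((\<lambda>x. (C \<inter> ?G) #> x) ` (D \<inter> ?G))"
      using P.finite_cosets[of "D \<inter> ?G" "C \<inter> ?G"]
        P.compact_open_subgroupD[OF compact_open_subgroup_p_component[OF D]]
        P.compact_open_subgroupD[OF compact_open_subgroup_p_component[OF C]] by simp
    have iff: "C #> x = C #> y \<longleftrightarrow> (C \<inter> ?G) #> x = (C \<inter> ?G) #> y"
      if xy: "x \<in> D \<inter> ?G" "y \<in> D \<inter> ?G" for x y
    proof -
      have G: "x \<in> carrier G" "y \<in> carrier G" using xy DD(5) by auto
      have "x \<otimes> inv y \<in> ?G" using xy GG by (simp add: subgroup.m_closed subgroup.m_inv_closed)
      then show ?thesis
        using r_coset_eq_iff[OF CC(1) G] r_coset_eq_iff[OF S G] by blast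
    qed
    show ?thesis unfolding coset_index_def
      using card_image_le_of_factor[of "\<lambda>x. x" "D \<inter> ?G" "D \<inter> ?G" "\<lambda>x. C #> x" "\<lambda>x. (C \<inter> ?G) #> x"]
        card_image_le_of_factor[of "\<lambda>x. x" "D \<inter> ?G" "D \<inter> ?G" "\<lambda>x. (C \<inter> ?G) #> x" "\<lambda>x. C #> x"]
        fin fin' iff by (intro antisym) auto
  qed
  finally show "component_index q D C = coset_index G D C" by simp
next
  fix p :: nat assume p: "prime p" "p \<noteq> q"
  note DD = compact_open_subgroupD[OF D] and CC = compact_open_subgroupD[OF C]
  have "x \<in> C" if x: "x \<in> D" "x \<in> p_component G T p" for x
  proof -
    obtain n where n: "x [^] (p ^ n) \<in> C" using p_componentD[OF x(2) C] .
    have "coprime (p ^ n) q" using p q by (simp add: primes_coprime)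
    then show ?thesis
      using mem_subgroup_if_coprime_powers[OF CC(1) _ _ n exponent[OF x(1)]] x DD(5) by auto
  qed
  then have "D \<inter> p_component G T p = C \<inter> p_component G T p" using CD by auto
  then show "component_index p D C = 1"
    using coset_index_self[OF subgroups_Inter_pair[OF CC(1) subgroup_p_component]] by simp
qed

text \<open>Take a prime divisor \<open>q\<close> of the order of some element of \<open>W/C\<close>, and for \<open>D/C\<close> all of the
  \<open>q\<close>-torsion of \<open>W/C\<close>.\<close>

lemma ex_prime_exponent_step:
  assumes W: "compact_open_subgroup G T W" and C: "compact_open_subgroup G T C"
    and CW: "C \<subseteq> W" "C \<noteq> W"
  shows "\<exists>(q::nat) D. prime q \<and> compact_open_subgroup G T D \<and> C \<subseteq> D \<and> C \<noteq> D \<and> D \<subseteq> W \<and>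
    (\<forall>x\<in>D. x [^] q \<in> C)"
proof -
  note WD = compact_open_subgroupD[OF W] and CC = compact_open_subgroupD[OF C]
  obtain x where x: "x \<in> W" "x \<notin> C" using CW by blast
  have xG: "x \<in> carrier G" using x WD by auto
  define d where "d = (LEAST d. d > 0 \<and> x [^] (d::nat) \<in> C)"
  have d: "d > 0 \<and> x [^] d \<in> C"
    unfolding d_def using ex_pow_mem_open_subgroup[OF W CC(1,2) x(1)] by (rule LeastI_ex)
  have least: "d \<le> k" if "k > 0" "x [^] k \<in> C" for k
    unfolding d_def using that by (intro Least_le) auto
  have "d \<noteq> 1" using d x xG by auto
  then obtain q :: nat where q: "prime q" "q dvd d" using prime_factor_nat by blast
  then obtain k where k: "d = q * k" by blast
  have k0: "0 < k" "k < d" using d k prime_gt_1_nat[OF q(1)] by auto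
  let ?D = "W \<inter> {y \<in> carrier G. y [^] q \<in> C}"
  have sub: "subgroup {y \<in> carrier G. y [^] q \<in> C} G"
    using CC(1) by unfold_locales
      (auto simp: nat_pow_mult_distrib nat_pow_inv subgroup.m_closed subgroup.one_closed subgroup.m_inv_closed)
  have CD: "C \<subseteq> {y \<in> carrier G. y [^] q \<in> C}"
    using CC(5) subgroup_nat_pow_closed[OF CC(1)] by blast
  have "C \<noteq> {}" using CC(6) by blast
  then have "openin T {y \<in> carrier G. y [^] q \<in> C}"
    by (rule open_subgroupI[OF sub CC(2) _ CD])
  then have D: "compact_open_subgroup G T ?D" by (rule compact_open_subgroup_Int_open[OF W sub])
  have "(x [^] k) [^] q = x [^] d" using xG by (simp add: nat_pow_pow k mult.commute[of k q])
  then have "x [^] k \<in> ?D" using subgroup_nat_pow_closed[OF WD(1) x(1)] xG d by simp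
  moreover have "x [^] k \<notin> C" using least[of k] k0 by auto
  ultimately have "C \<noteq> ?D" by blast
  moreover have "C \<subseteq> ?D" using CD CW(1) by blast
  moreover have "\<forall>x\<in>?D. x [^] q \<in> C" by blast
  ultimately show ?thesis using q(1) D by blast
qed

text \<open>Climb from \<open>C\<close> to \<open>W\<close> through steps of prime exponent; each step changes the component index at
  one prime only, and there by the full index.\<close>

theorem coset_index_eq_prod:
  assumes W: "compact_open_subgroup G T W" and C: "compact_open_subgroup G T C" and CW: "C \<subseteq> W"
  shows "\<exists>F. finite F \<and> (\<forall>p\<in>F. prime p) \<and> coset_index G W C = (\<Prod>p\<in>F. component_index p W C) \<and>
    (\<forall>p. prime p \<longrightarrow> p \<notin> F \<longrightarrow> component_index p W C = 1)"
  using C CW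
proof (induction "coset_index G W C" arbitrary: C rule: less_induct)
  case less
  note CC = compact_open_subgroupD[OF less.prems(1)]
  show ?case
  proof (cases "C = W")
    case True
    have "component_index p W W = 1" for p
      by (rule coset_index_self)
        (rule subgroups_Inter_pair[OF compact_open_subgroupD(1)[OF W] subgroup_p_component])
    then show ?thesis using True coset_index_self[OF CC(1)] by (intro exI[of _ "{}"]) auto
  next
    case False
    then obtain q :: nat and D where q: "prime q" and D: "compact_open_subgroup G T D"
      and CD: "C \<subseteq> D" "C \<noteq> D" and DW: "D \<subseteq> W" and exponent: "\<And>x. x \<in> D \<Longrightarrow> x [^] q \<in> C"
      using ex_prime_exponent_step[OF W less.prems] by blast
    note DD = compact_open_subgroupD[OF D]
    have chain: "coset_index G W C = coset_index G W D * coset_index G D C"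
      by (rule coset_index_chain[OF W D less.prems(1) CD(1) DW])
    have "coset_index G D C \<noteq> 1" using coset_index_eq_1D[OF CC(1) DD(5,6)] CD by blast
    then have "coset_index G W D < coset_index G W C"
      using chain coset_index_compact_open_pos[OF D less.prems(1)] coset_index_compact_open_pos[OF W D] by simp
    from less.hyps[OF this D DW] obtain F where F: "finite F" "\<forall>p\<in>F. prime p"
      "coset_index G W D = (\<Prod>p\<in>F. component_index p W D)"
      "\<And>p. prime p \<Longrightarrow> p \<notin> F \<Longrightarrow> component_index p W D = 1" by blast
    have cc: "component_index p W C = component_index p W D * component_index p D C" for p
      by (rule component_index_chain[OF W D less.prems(1) CD(1) DW])
    note step = component_index_exponent[OF q D less.prems(1) CD(1) exponent]
    show ?thesis
    proof (intro exI[of _ "insert q F"] conjI)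
      have "(\<Prod>p\<in>insert q F. component_index p W C)
          = (\<Prod>p\<in>insert q F. component_index p W D) * (\<Prod>p\<in>insert q F. component_index p D C)"
        by (simp add: cc prod.distrib)
      also have "(\<Prod>p\<in>insert q F. component_index p W D) = (\<Prod>p\<in>F. component_index p W D)"
        using F q by (cases "q \<in> F") (auto simp: insert_absorb)
      also have "(\<Prod>p\<in>insert q F. component_index p D C) = (\<Prod>p\<in>{q}. component_index p D C)"
        using F q step(2) by (intro prod.mono_neutral_right) auto
      finally show "coset_index G W C = (\<Prod>p\<in>insert q F. component_index p W C)"
        using chain F(3) step(1) by simp
      show "\<forall>p. prime p \<longrightarrow> p \<notin> insert q F \<longrightarrow> component_index p W C = 1"
        using F(4) step(2) cc by simp
    qed (use F q in auto)
  qed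
qed

end

section \<open>Entropy as the sum over the primary components\<close>

lemma cotrajectory_restrict:
  assumes H: "H \<subseteq> carrier G" and inv: "\<phi> ` H \<subseteq> H"
  shows "cotrajectory (G\<lparr>carrier := H\<rparr>) (restrict \<phi> H) (W \<inter> H) n = cotrajectory G \<phi> W n \<inter> H"
proof -
  have "(restrict \<phi> H ^^ k) x = (\<phi> ^^ k) x \<and> (\<phi> ^^ k) x \<in> H" if "x \<in> H" for k x
    using that inv by (induction k) auto
  then show ?thesis using H by (auto simp: cotrajectory_def)
qed

lemma has_sum_add_ereal_nonneg:
  fixes f g :: "'a \<Rightarrow> ereal"
  assumes f: "(f has_sum a) A" and g: "(g has_sum b) A" and ab: "0 \<le> a" "0 \<le> b"
  shows "((\<lambda>x. f x + g x) has_sum (a + b)) A"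
proof -
  have "((\<lambda>F. sum f F + sum g F) \<longlongrightarrow> a + b) (finite_subsets_at_top A)"
    using f g ab by (intro tendsto_add_ereal_nonneg) (auto simp: has_sum_def)
  then show ?thesis by (simp add: has_sum_def sum.distrib[abs_def])
qed

lemma has_sum_single:
  fixes f :: "'a \<Rightarrow> ereal"
  assumes f: "(f has_sum a) A" and p: "p \<in> A" and zero: "\<And>q. q \<in> A \<Longrightarrow> q \<noteq> p \<Longrightarrow> f q = 0"
  shows "a = f p"
proof -
  have "(f has_sum sum f {p}) {p}" by (rule has_sum_finite) simp
  then have "(f has_sum f p) A"
    by (subst has_sum_cong_neutral[of "{p}" A f f]) (use p zero in auto)
  from infsumI[OF this] show ?thesis using infsumI[OF f] by simp
qed

context tdlc_abelian_group
begin

lemma restrict_End: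
  assumes \<phi>: "\<phi> \<in> End G T" and H: "subgroup H G" and inv: "\<phi> ` H \<subseteq> H"
  shows "restrict \<phi> H \<in> End (G\<lparr>carrier := H\<rparr>) (subtopology T H)"
proof -
  have HG: "H \<subseteq> carrier G" by (rule subgroup.subset[OF H])
  have "restrict \<phi> H \<in> hom (G\<lparr>carrier := H\<rparr>) (G\<lparr>carrier := H\<rparr>)"
    using EndD(4)[OF \<phi>] HG inv H by (auto simp: hom_def subgroup.m_closed subset_iff image_subset_iff)
  moreover have "continuous_map (subtopology T H) (subtopology T H) \<phi>"
    using continuous_map_from_subtopology[OF EndD(2)[OF \<phi>]] inv
    by (auto simp: continuous_map_in_subtopology)
  then have "continuous_map (subtopology T H) (subtopology T H) (restrict \<phi> H)"
    by (rule continuous_map_eq) simp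
  ultimately show ?thesis by (simp add: End_def)
qed

lemma p_component_invariant:
  assumes \<phi>: "\<phi> \<in> End G T"
  shows "\<phi> ` p_component G T p \<subseteq> p_component G T p"
proof
  fix y assume "y \<in> \<phi> ` p_component G T p"
  then obtain x where x: "x \<in> p_component G T p" "y = \<phi> x" by auto
  have xG: "x \<in> carrier G" using x p_component_subset by auto
  have "\<exists>n. y [^] (p ^ n) \<in> D" if D: "compact_open_subgroup G T D" for D
  proof -
    note DD = compact_open_subgroupD[OF D]
    note S = preimage_open_subgroup[OF \<phi> DD(1,2)]
    have "\<one> \<in> {x \<in> carrier G. \<phi> x \<in> D}" using subgroup.one_closed[OF S(1)] .
    then obtain E where E: "compact_open_subgroup G T E" "E \<subseteq> {x \<in> carrier G. \<phi> x \<in> D}"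
      using van_Dantzig[OF S(2)] by blast
    obtain n where "x [^] (p ^ n) \<in> E" using p_componentD[OF x(1) E(1)] .
    then have "\<phi> (x [^] (p ^ n)) \<in> D" using E(2) by blast
    moreover have "\<phi> (x [^] (p ^ n)) = y [^] (p ^ n)"
      unfolding x(2) by (rule hom_nat_pow[OF EndD(1)[OF \<phi>] xG is_group is_group])
    ultimately show ?thesis by auto
  qed
  then show "y \<in> p_component G T p"
    using EndD(3)[OF \<phi> xG] x(2)
    unfolding p_component_eq radical_component_def radical_def by auto
qed

abbreviation component_endo :: "('a \<Rightarrow> 'a) \<Rightarrow> nat \<Rightarrow> 'a \<Rightarrow> 'a" where
  "component_endo \<phi> p \<equiv> restrict \<phi> (p_component G T p)"

abbreviation component_H :: "('a \<Rightarrow> 'a) \<Rightarrow> nat \<Rightarrow> 'a set \<Rightarrow> ereal" where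
  "component_H \<phi> p W \<equiv> H_top (p_component_group G T p) (p_component_topology G T p)
     (component_endo \<phi> p) (W \<inter> p_component G T p)"

abbreviation component_h :: "('a \<Rightarrow> 'a) \<Rightarrow> nat \<Rightarrow> ereal" where
  "component_h \<phi> p \<equiv> h_top (p_component_group G T p) (p_component_topology G T p) (component_endo \<phi> p)"

lemma component_endo_End:
  "\<phi> \<in> End G T \<Longrightarrow> component_endo \<phi> p \<in> End (p_component_group G T p) (p_component_topology G T p)"
  by (rule restrict_End[OF _ subgroup_p_component p_component_invariant])

text \<open>The first step of the cotrajectory already decides which primes matter: if \<open>W\<close> and its second
  cotrajectory agree on the \<open>p\<close>-component, then \<open>\<phi>\<close> maps the \<open>p\<close>-component of \<open>W\<close> into itself.\<close>

lemma component_cotrajectory_trivial: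
  assumes \<phi>: "\<phi> \<in> End G T" and W: "compact_open_subgroup G T W"
    and 1: "component_index p W (cotrajectory G \<phi> W 2) = 1" and n: "n \<ge> 1"
  shows "cotrajectory G \<phi> W n \<inter> p_component G T p = W \<inter> p_component G T p"
proof (intro equalityI subsetI)
  let ?G = "p_component G T p"
  note WD = compact_open_subgroupD[OF W]
  have C2: "compact_open_subgroup G T (cotrajectory G \<phi> W 2)"
    by (rule compact_open_subgroup_cotrajectory[OF \<phi> W]) simp
  have "W \<inter> ?G \<subseteq> cotrajectory G \<phi> W 2 \<inter> ?G"
    by (rule coset_index_eq_1D[OF subgroups_Inter_pair[OF compact_open_subgroupD(1)[OF C2] subgroup_p_component] _ _ 1])
      (use WD subgroup.one_closed[OF subgroup_p_component] in auto)
  then have step: "\<phi> x \<in> W \<inter> ?G" if x: "x \<in> W \<inter> ?G" for x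
  proof -
    have "x \<in> cotrajectory G \<phi> W 2" using x \<open>W \<inter> ?G \<subseteq> cotrajectory G \<phi> W 2 \<inter> ?G\<close> by blast
    then have "(\<phi> ^^ 1) x \<in> W" by (auto simp: cotrajectory_def dest: spec[of _ 1])
    then show ?thesis using x p_component_invariant[OF \<phi>] by auto
  qed
  fix x assume x: "x \<in> W \<inter> ?G"
  have "(\<phi> ^^ k) x \<in> W \<inter> ?G" for k using x step by (induction k) auto
  then show "x \<in> cotrajectory G \<phi> W n \<inter> ?G" using x WD(5) by (auto simp: cotrajectory_def)
next
  fix x assume "x \<in> cotrajectory G \<phi> W n \<inter> p_component G T p"
  then show "x \<in> W \<inter> p_component G T p" using cotrajectory_subset[OF n] by blast
qed

lemma component_H_limit:
  assumes \<phi>: "\<phi> \<in> End G T" and W: "compact_open_subgroup G T W"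
  obtains L :: real where "0 \<le> L"
    "(\<lambda>n. ln (real (component_index p W (cotrajectory G \<phi> W n))) / real n) \<longlonglongrightarrow> L"
    "component_H \<phi> p W = ereal L"
proof -
  interpret P: tdlc_abelian_group "p_component_group G T p" "p_component_topology G T p"
    by (rule tdlc_abelian_group_p_component)
  note \<phi>p = component_endo_End[OF \<phi>, of p]
  note Wp = compact_open_subgroup_p_component[OF W, of p]
  have "cotrajectory (p_component_group G T p) (component_endo \<phi> p) (W \<inter> p_component G T p) n
      = cotrajectory G \<phi> W n \<inter> p_component G T p" for n
    by (rule cotrajectory_restrict[OF p_component_subset p_component_invariant[OF \<phi>]])
  then show ?thesis
    using P.entropy_sequence_convergent[OF \<phi>p Wp] P.H_top_eq_limit[OF \<phi>p Wp] that by auto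
qed

text \<open>By \<open>component_cotrajectory_trivial\<close> the finite set of primes with a nontrivial factor in \<open>[W : C\<^sub>2]\<close> contains
  those of \<open>[W : C\<^sub>n]\<close> for all \<open>n\<close>, so the sum and the limit can be exchanged.\<close>

theorem H_top_eq_sum:
  assumes \<phi>: "\<phi> \<in> End G T" and W: "compact_open_subgroup G T W"
  obtains F where "finite F" "F \<subseteq> {p. prime p}" "H_top G T \<phi> W = (\<Sum>p\<in>F. component_H \<phi> p W)"
    "\<And>p. prime p \<Longrightarrow> p \<notin> F \<Longrightarrow> component_H \<phi> p W = 0"
proof -
  let ?C = "cotrajectory G \<phi> W"
  have c: "compact_open_subgroup G T (?C n)" if "n \<ge> 1" for n
    using compact_open_subgroup_cotrajectory[OF \<phi> W that] .
  have "\<exists>F. finite F \<and> (\<forall>p\<in>F. prime p) \<and> coset_index G W (?C 2) = (\<Prod>p\<in>F. component_index p W (?C 2)) \<and>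
    (\<forall>p. prime p \<longrightarrow> p \<notin> F \<longrightarrow> component_index p W (?C 2) = 1)"
    by (rule coset_index_eq_prod[OF W c cotrajectory_subset]) simp_all
  then obtain F where F: "finite F" "\<And>p. p \<in> F \<Longrightarrow> prime p"
    "\<And>p. prime p \<Longrightarrow> p \<notin> F \<Longrightarrow> component_index p W (?C 2) = 1" by blast
  have pos: "component_index p W (?C n) > 0" if "n \<ge> 1" for p n
  proof -
    interpret P: tdlc_abelian_group "p_component_group G T p" "p_component_topology G T p"
      by (rule tdlc_abelian_group_p_component)
    show ?thesis
      using P.coset_index_compact_open_pos[OF compact_open_subgroup_p_component[OF W]
          compact_open_subgroup_p_component[OF c[OF that]]] by simp
  qed
  have one: "component_index p W (?C n) = 1" if "prime p" "p \<notin> F" "n \<ge> 1" for p n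
    using component_cotrajectory_trivial[OF \<phi> W F(3)[OF that(1,2)] that(3)]
      coset_index_self[OF subgroups_Inter_pair[OF compact_open_subgroupD(1)[OF W] subgroup_p_component]]
    by simp
  have prod: "coset_index G W (?C n) = (\<Prod>p\<in>F. component_index p W (?C n))" if n: "n \<ge> 1" for n
  proof -
    obtain F' where F': "finite F'" "\<And>p. p \<in> F' \<Longrightarrow> prime p"
      "coset_index G W (?C n) = (\<Prod>p\<in>F'. component_index p W (?C n))"
      "\<And>p. prime p \<Longrightarrow> p \<notin> F' \<Longrightarrow> component_index p W (?C n) = 1"
      using coset_index_eq_prod[OF W c[OF n] cotrajectory_subset[OF n]] by blast
    have "(\<Prod>p\<in>F'. component_index p W (?C n)) = (\<Prod>p\<in>F' \<union> F. component_index p W (?C n))"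
      using F F' by (intro prod.mono_neutral_left) auto
    also have "\<dots> = (\<Prod>p\<in>F. component_index p W (?C n))"
      using F F' one n by (intro prod.mono_neutral_right) auto
    finally show ?thesis using F'(3) by simp
  qed
  define L where "L p = (SOME l::real. (\<lambda>n. ln (real (component_index p W (?C n))) / real n) \<longlonglongrightarrow> l
      \<and> component_H \<phi> p W = ereal l)" for p
  have L: "(\<lambda>n. ln (real (component_index p W (?C n))) / real n) \<longlonglongrightarrow> L p"
    "component_H \<phi> p W = ereal (L p)" for p
  proof -
    have "\<exists>l::real. (\<lambda>n. ln (real (component_index p W (?C n))) / real n) \<longlonglongrightarrow> l
        \<and> component_H \<phi> p W = ereal l"
      using component_H_limit[OF \<phi> W, of p] by blast
    from someI_ex[OF this] show "(\<lambda>n. ln (real (component_index p W (?C n))) / real n) \<longlonglongrightarrow> L p"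
      "component_H \<phi> p W = ereal (L p)" unfolding L_def by blast+
  qed
  have "(\<lambda>n. \<Sum>p\<in>F. ln (real (component_index p W (?C n))) / real n) \<longlonglongrightarrow> (\<Sum>p\<in>F. L p)"
    by (intro tendsto_sum L)
  moreover have "\<forall>\<^sub>F n in sequentially. (\<Sum>p\<in>F. ln (real (component_index p W (?C n))) / real n)
      = ln (real (coset_index G W (?C n))) / real n"
  proof (rule eventually_mono[OF eventually_ge_at_top[of 1]])
    fix n :: nat assume n: "1 \<le> n"
    have "ln (real (coset_index G W (?C n))) = (\<Sum>p\<in>F. ln (real (component_index p W (?C n))))"
      unfolding prod[OF n] of_nat_prod using pos[OF n] F(1) by (subst ln_prod) auto
    then show "(\<Sum>p\<in>F. ln (real (component_index p W (?C n))) / real n)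
      = ln (real (coset_index G W (?C n))) / real n" by (simp add: sum_divide_distrib)
  qed
  ultimately have "(\<lambda>n. ln (real (coset_index G W (?C n))) / real n) \<longlonglongrightarrow> (\<Sum>p\<in>F. L p)"
    by (rule Lim_transform_eventually)
  then have "H_top G T \<phi> W = ereal (\<Sum>p\<in>F. L p)" by (rule H_top_eq_limit[OF \<phi> W])
  then have "H_top G T \<phi> W = (\<Sum>p\<in>F. component_H \<phi> p W)" by (simp add: L)
  moreover have "component_H \<phi> p W = 0" if p: "prime p" "p \<notin> F" for p
  proof -
    have "\<forall>\<^sub>F n in sequentially. 0 = ln (real (component_index p W (?C n))) / real n"
      by (rule eventually_mono[OF eventually_ge_at_top[of 1]]) (simp add: one[OF p])
    then have "(\<lambda>n. ln (real (component_index p W (?C n))) / real n) \<longlonglongrightarrow> 0"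
      by (rule Lim_transform_eventually[OF tendsto_const])
    then have "L p = 0" using L(1) LIMSEQ_unique by blast
    then show ?thesis by (simp add: L(2) zero_ereal_def)
  qed
  ultimately show ?thesis using that[of F] F by blast
qed

lemma component_H_nonneg:
  assumes "\<phi> \<in> End G T" "compact_open_subgroup G T W"
  shows "0 \<le> component_H \<phi> p W"
  using component_H_limit[OF assms, of p] by (metis ereal_less_eq(5))

lemma component_H_antimono:
  assumes \<phi>: "\<phi> \<in> End G T" and W: "compact_open_subgroup G T W" and V: "compact_open_subgroup G T V"
    and sub: "V \<subseteq> W"
  shows "component_H \<phi> p W \<le> component_H \<phi> p V"
proof -
  interpret P: tdlc_abelian_group "p_component_group G T p" "p_component_topology G T p"
    by (rule tdlc_abelian_group_p_component)
  show ?thesis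
    using sub by (intro P.H_top_antimono component_endo_End[OF \<phi>] compact_open_subgroup_p_component V
        P.compact_open_subgroupD(3)[OF compact_open_subgroup_p_component[OF W]]) auto
qed

text \<open>The traces of the compact open subgroups of \<open>G\<close> are cofinal among those of the component.\<close>

lemma component_h_eq_SUP:
  assumes \<phi>: "\<phi> \<in> End G T"
  shows "component_h \<phi> p = (SUP W\<in>Collect (compact_open_subgroup G T). component_H \<phi> p W)"
proof -
  let ?G = "p_component G T p"
  interpret P: tdlc_abelian_group "p_component_group G T p" "p_component_topology G T p"
    by (rule tdlc_abelian_group_p_component)
  have "component_h \<phi> p = (SUP W\<in>(\<lambda>W. W \<inter> ?G) ` Collect (compact_open_subgroup G T).
      H_top (p_component_group G T p) (p_component_topology G T p) (component_endo \<phi> p) W)"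
  proof (rule P.h_top_eq_SUP[OF component_endo_End[OF \<phi>]])
    fix K assume K: "compact_open_subgroup (p_component_group G T p) (p_component_topology G T p) K"
    note KD = P.compact_open_subgroupD[OF K]
    obtain U where U: "openin T U" "K = U \<inter> ?G" using KD(2) by (auto simp: openin_subtopology)
    then have "\<one> \<in> U" using KD(6) by simp
    then obtain W where W: "compact_open_subgroup G T W" "W \<subseteq> U" using van_Dantzig[OF U(1)] by blast
    then have "W \<inter> ?G \<subseteq> K" using U(2) by auto
    then show "\<exists>W\<in>(\<lambda>W. W \<inter> ?G) ` Collect (compact_open_subgroup G T). W \<subseteq> K" using W(1) by auto
  qed (use compact_open_subgroup_p_component in auto)
  then show ?thesis by (simp add: image_image)
qed

lemma component_H_le_component_h:
  assumes \<phi>: "\<phi> \<in> End G T" and W: "compact_open_subgroup G T W"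
  shows "component_H \<phi> p W \<le> component_h \<phi> p"
  unfolding component_h_eq_SUP[OF \<phi>] by (rule SUP_upper) (simp add: W)

text \<open>Both sides are suprema of finite sums of local entropies.  A finite sum of suprema over all \<open>W\<close> is
  the supremum of the sums, because local entropies grow as \<open>W\<close> shrinks and the compact open
  subgroups are directed downwards.\<close>

theorem h_top_has_sum:
  assumes \<phi>: "\<phi> \<in> End G T"
  shows "(component_h \<phi> has_sum h_top G T \<phi>) {p. prime p}"
proof -
  let ?C = "Collect (compact_open_subgroup G T)"
  let ?P = "{p::nat. prime p}"
  have nonneg: "0 \<le> component_h \<phi> p" for p
    by (rule tdlc_abelian_group.h_top_nonneg[OF tdlc_abelian_group_p_component component_endo_End[OF \<phi>]])
  have "h_top G T \<phi> = (SUP F\<in>{F. finite F \<and> F \<subseteq> ?P}. \<Sum>p\<in>F. component_h \<phi> p)"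
  proof (rule antisym)
    show "h_top G T \<phi> \<le> (SUP F\<in>{F. finite F \<and> F \<subseteq> ?P}. \<Sum>p\<in>F. component_h \<phi> p)"
      unfolding h_top_eq_SUP_all[OF \<phi>]
    proof (rule SUP_least)
      fix W assume "W \<in> ?C"
      then have W: "compact_open_subgroup G T W" by simp
      obtain F where F: "finite F" "F \<subseteq> ?P" "H_top G T \<phi> W = (\<Sum>p\<in>F. component_H \<phi> p W)"
        "\<And>p. prime p \<Longrightarrow> p \<notin> F \<Longrightarrow> component_H \<phi> p W = 0"
        by (rule H_top_eq_sum[OF \<phi> W]) (rule that)
      have "(\<Sum>p\<in>F. component_H \<phi> p W) \<le> (\<Sum>p\<in>F. component_h \<phi> p)"
        by (intro sum_mono component_H_le_component_h[OF \<phi> W])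
      also have "\<dots> \<le> (SUP F\<in>{F. finite F \<and> F \<subseteq> ?P}. \<Sum>p\<in>F. component_h \<phi> p)"
        using F by (intro SUP_upper) auto
      finally show "H_top G T \<phi> W \<le> (SUP F\<in>{F. finite F \<and> F \<subseteq> ?P}. \<Sum>p\<in>F. component_h \<phi> p)"
        using F(3) by simp
    qed
    show "(SUP F\<in>{F. finite F \<and> F \<subseteq> ?P}. \<Sum>p\<in>F. component_h \<phi> p) \<le> h_top G T \<phi>"
    proof (rule SUP_least)
      fix F assume F: "F \<in> {F. finite F \<and> F \<subseteq> ?P}"
      have "(\<Sum>p\<in>F. component_h \<phi> p) = (SUP W\<in>?C. \<Sum>p\<in>F. component_H \<phi> p W)"
        unfolding component_h_eq_SUP[OF \<phi>]
      proof (rule SUP_ereal_sum_directed[symmetric])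
        show "?C \<noteq> {}" using ex_compact_open_subgroup by blast
        fix N W V assume "W \<in> ?C" "V \<in> ?C"
        then have WV: "compact_open_subgroup G T W" "compact_open_subgroup G T V" by auto
        have I: "compact_open_subgroup G T (W \<inter> V)" by (rule compact_open_subgroup_Int[OF WV])
        then show "\<exists>K\<in>?C. \<forall>p\<in>N. component_H \<phi> p W \<le> component_H \<phi> p K
            \<and> component_H \<phi> p V \<le> component_H \<phi> p K"
          using component_H_antimono[OF \<phi> WV(1) I] component_H_antimono[OF \<phi> WV(2) I]
          by (intro bexI[of _ "W \<inter> V"]) auto
      qed (use component_H_nonneg[OF \<phi>] in auto)
      also have "\<dots> \<le> (SUP W\<in>?C. H_top G T \<phi> W)"
      proof (rule SUP_mono)
        fix W assume "W \<in> ?C"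
        then have W: "compact_open_subgroup G T W" by simp
        obtain F' where F': "finite F'" "F' \<subseteq> ?P" "H_top G T \<phi> W = (\<Sum>p\<in>F'. component_H \<phi> p W)"
          "\<And>p. prime p \<Longrightarrow> p \<notin> F' \<Longrightarrow> component_H \<phi> p W = 0"
          by (rule H_top_eq_sum[OF \<phi> W]) (rule that)
        have "(\<Sum>p\<in>F. component_H \<phi> p W) \<le> (\<Sum>p\<in>F \<union> F'. component_H \<phi> p W)"
          using F F'(1) component_H_nonneg[OF \<phi> W] by (intro sum_mono2) auto
        also have "\<dots> = (\<Sum>p\<in>F'. component_H \<phi> p W)"
          using F F' by (intro sum.mono_neutral_right) auto
        finally show "\<exists>V\<in>?C. (\<Sum>p\<in>F. component_H \<phi> p W) \<le> H_top G T \<phi> V"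
          using F'(3) W by auto
      qed
      finally show "(\<Sum>p\<in>F. component_h \<phi> p) \<le> h_top G T \<phi>"
        unfolding h_top_eq_SUP_all[OF \<phi>] .
    qed
  qed
  then show ?thesis using nonneg_has_sum_complete[of ?P "component_h \<phi>"] nonneg by simp
qed

section \<open>Sums for subgroups and quotients\<close>

lemma p_component_of_subgroup:
  assumes H: "subgroup H G"
  shows "p_component (G\<lparr>carrier := H\<rparr>) (subtopology T H) p = p_component G T p \<inter> H"
proof -
  have "x [^] n \<in> H" if "x \<in> H" for x and n :: nat
    using subgroup_nat_pow_closed[OF H that] .
  then show ?thesis
    using subgroup.one_closed[OF H] subgroup.subset[OF H]
    by (auto simp: p_component_def limitin_subtopology simp flip: nat_pow_consistent)
qed

abbreviation component_subgroup_h :: "('a \<Rightarrow> 'a) \<Rightarrow> 'a set \<Rightarrow> nat \<Rightarrow> ereal" where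
  "component_subgroup_h \<phi> H p \<equiv> h_top (G\<lparr>carrier := p_component G T p \<inter> H\<rparr>) (subtopology T (p_component G T p \<inter> H))
      (restrict \<phi> (p_component G T p \<inter> H))"

abbreviation component_quotient_h :: "('a \<Rightarrow> 'a) \<Rightarrow> 'a set \<Rightarrow> nat \<Rightarrow> ereal" where
  "component_quotient_h \<phi> H p \<equiv> h_top (p_component_group G T p Mod (p_component G T p \<inter> H))
      (quotient_group_topology (p_component_group G T p) (p_component_topology G T p) (p_component G T p \<inter> H))
      (quotient_endo (p_component_group G T p) (p_component G T p \<inter> H) (component_endo \<phi> p))"

lemma h_top_subgroup_has_sum:
  assumes \<phi>: "\<phi> \<in> End G T" and H: "subgroup H G" "closedin T H" and inv: "\<phi> ` H \<subseteq> H"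
  shows "(component_subgroup_h \<phi> H
    has_sum h_top (G\<lparr>carrier := H\<rparr>) (subtopology T H) (restrict \<phi> H)) {p. prime p}"
proof -
  interpret H: tdlc_abelian_group "G\<lparr>carrier := H\<rparr>" "subtopology T H"
    by (rule tdlc_abelian_group_closed_subgroup[OF H])
  have "restrict (restrict \<phi> H) (K \<inter> H) = restrict \<phi> (K \<inter> H)" for K by auto
  moreover have "H \<inter> (K \<inter> H) = K \<inter> H" for K by auto
  ultimately show ?thesis
    using H.h_top_has_sum[OF restrict_End[OF \<phi> H(1) inv]]
    by (simp add: p_component_of_subgroup[OF H(1)] subtopology_subtopology)
qed

lemma quotient_endo_End:
  assumes \<phi>: "\<phi> \<in> End G T" and H: "subgroup H G" and inv: "\<phi> ` H \<subseteq> H"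
  shows "quotient_endo G H \<phi> \<in> End (G Mod H) (quotient_topology H)"
proof -
  have N: "H \<lhd> G" by (rule subgroup_imp_normal[OF H])
  interpret N: normal H G by fact
  note val = quotient_endo_r_coset[OF N EndD(1)[OF \<phi>] inv]
  have "quotient_endo G H \<phi> \<in> hom (G Mod H) (G Mod H)"
  proof (rule homI)
    fix X assume "X \<in> carrier (G Mod H)"
    then show "quotient_endo G H \<phi> X \<in> carrier (G Mod H)"
      using val EndD(3)[OF \<phi>] by (auto simp: carrier_FactGroup)
    fix Y assume "Y \<in> carrier (G Mod H)"
    then obtain x y where xy: "x \<in> carrier G" "y \<in> carrier G" "X = H #> x" "Y = H #> y"
      using \<open>X \<in> carrier (G Mod H)\<close> by (auto simp: carrier_FactGroup)
    show "quotient_endo G H \<phi> (X \<otimes>\<^bsub>G Mod H\<^esub> Y) = quotient_endo G H \<phi> X \<otimes>\<^bsub>G Mod H\<^esub> quotient_endo G H \<phi> Y"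
      using xy val EndD(3,4)[OF \<phi>] by (simp add: N.rcos_sum)
  qed
  moreover have "continuous_map T (quotient_topology H) (\<lambda>x. H #> \<phi> x)"
    using continuous_map_compose[OF EndD(2)[OF \<phi>] continuous_map_coset[of H]] by (simp add: o_def)
  then have "continuous_map T (quotient_topology H) (\<lambda>x. quotient_endo G H \<phi> (H #> x))"
    by (rule continuous_map_eq) (simp add: val topspace_eq)
  then have "continuous_map (quotient_topology H) (quotient_topology H) (quotient_endo G H \<phi>)"
    using continuous_compose_quotient_map[OF quotient_map_quotient_group_topology[of H]]
    by (simp add: o_def)
  ultimately show ?thesis by (simp add: End_def)
qed

end

text \<open>By translation, openness needs to be checked at the identity only.\<close>

lemma (in tdlc_group) hom_open_mapI:
  assumes B: "topological_group B R" and f: "f \<in> hom G B"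
    and nbhd: "\<And>K. compact_open_subgroup G T K \<Longrightarrow> \<exists>V. openin R V \<and> \<one>\<^bsub>B\<^esub> \<in> V \<and> V \<subseteq> f ` K"
  shows "open_map T R f"
  unfolding open_map_def
proof (intro allI impI)
  interpret B: topological_group B R by fact
  fix U assume U: "openin T U"
  have "\<exists>U'. openin R U' \<and> y \<in> U' \<and> U' \<subseteq> f ` U" if y: "y \<in> f ` U" for y
  proof -
    obtain x where x: "x \<in> U" "y = f x" using y by auto
    have xG: "x \<in> carrier G" using x openin_subset[OF U] by (auto simp: topspace_eq)
    have yB: "y \<in> carrier B" using f xG x by (auto simp: hom_def)
    have "\<one> \<in> inv x <# U" using x xG by (auto simp: l_coset_def intro!: bexI[of _ x])
    then obtain K where K: "compact_open_subgroup G T K" "K \<subseteq> inv x <# U"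
      using van_Dantzig openin_l_coset[OF inv_closed[OF xG] U] by blast
    obtain V where V: "openin R V" "\<one>\<^bsub>B\<^esub> \<in> V" "V \<subseteq> f ` K" using nbhd[OF K(1)] by blast
    have KG: "K \<subseteq> carrier G" using compact_open_subgroupD(5)[OF K(1)] .
    have "x \<otimes> k \<in> U" if "k \<in> K" for k
    proof -
      obtain u where u: "u \<in> U" "k = inv x \<otimes> u" using K(2) \<open>k \<in> K\<close> by (auto simp: l_coset_def)
      have "u \<in> carrier G" using u openin_subset[OF U] by (auto simp: topspace_eq)
      then show ?thesis using u xG by (simp add: m_assoc[symmetric])
    qed
    then have "y <#\<^bsub>B\<^esub> V \<subseteq> f ` U"
    proof (intro subsetI)
      fix z assume xk: "\<And>k. k \<in> K \<Longrightarrow> x \<otimes> k \<in> U" and "z \<in> y <#\<^bsub>B\<^esub> V"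
      then obtain k where k: "k \<in> K" "z = y \<otimes>\<^bsub>B\<^esub> f k" using V(3) by (auto simp: l_coset_def)
      then have "z = f (x \<otimes> k)" using f xG KG x by (auto simp: hom_def)
      then show "z \<in> f ` U" using xk[OF k(1)] by blast
    qed
    moreover have "y \<in> y <#\<^bsub>B\<^esub> V" using V(2) yB unfolding l_coset_def by force
    ultimately show ?thesis using B.openin_l_coset[OF yB V(1)] by blast
  qed
  then show "openin R (f ` U)" by (subst openin_subopen) blast
qed

context tdlc_abelian_group
begin

text \<open>The canonical map from \<open>G\<^sub>p/(G\<^sub>p \<inter> H)\<close> to the \<open>p\<close>-component of \<open>G/H\<close> need not be onto, but it
  is an open embedding because elements of the \<open>p\<close>-component of the quotient that are close to the
  identity can be lifted to \<open>G\<^sub>p\<close>.\<close>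

theorem h_top_quotient_component:
  assumes \<phi>: "\<phi> \<in> End G T" and H: "subgroup H G" "closedin T H" and inv: "\<phi> ` H \<subseteq> H" and p: "prime p"
  shows "component_quotient_h \<phi> H p
    = h_top (p_component_group (G Mod H) (quotient_topology H) p)
      (p_component_topology (G Mod H) (quotient_topology H) p)
      (restrict (quotient_endo G H \<phi>) (p_component (G Mod H) (quotient_topology H) p))"
proof -
  define K where "K = p_component G T p \<inter> H"
  let ?Gp = "p_component G T p" and ?q = "\<lambda>x. H #> x"
  let ?Qp = "p_component (G Mod H) (quotient_topology H) p"
  let ?A = "p_component_group G T p Mod K"
  let ?S = "quotient_group_topology (p_component_group G T p) (p_component_topology G T p) K"
  let ?B = "p_component_group (G Mod H) (quotient_topology H) p"
  let ?R = "p_component_topology (G Mod H) (quotient_topology H) p"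
  have N: "H \<lhd> G" by (rule subgroup_imp_normal[OF H(1)])
  interpret N: normal H G by fact
  interpret P: tdlc_abelian_group "p_component_group G T p" "p_component_topology G T p"
    by (rule tdlc_abelian_group_p_component)
  interpret Q: tdlc_abelian_group "G Mod H" "quotient_topology H"
    by (rule tdlc_abelian_group_quotient[OF H])
  interpret B: tdlc_abelian_group ?B ?R by (rule Q.tdlc_abelian_group_p_component)
  have KG: "subgroup K G" unfolding K_def by (rule subgroups_Inter_pair[OF subgroup_p_component H(1)])
  have KP: "subgroup K (p_component_group G T p)"
    using subgroup_incl[OF KG subgroup_p_component] by (simp add: K_def)
  have clK: "closedin (p_component_topology G T p) K"
    unfolding K_def using H(2) by (auto simp: closedin_subtopology)
  interpret A: tdlc_abelian_group ?A ?S by (rule P.tdlc_abelian_group_quotient[OF KP clK])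
  have NK: "K \<lhd> p_component_group G T p" by (rule P.subgroup_imp_normal[OF KP])
  interpret NK: normal K "p_component_group G T p" by fact
  have HG: "H \<subseteq> carrier G" by (rule subgroup.subset[OF H(1)])
  have GpG: "?Gp \<subseteq> carrier G" by (rule p_component_subset)
  have carA: "carrier ?A = (\<lambda>x. K #> x) ` ?Gp" by (simp add: carrier_FactGroup)
  have qhom: "?q \<in> hom G (G Mod H)" by (rule N.r_coset_hom_Mod)
  have qpow: "?q (x [^] n) = ?q x [^]\<^bsub>G Mod H\<^esub> n" if "x \<in> carrier G" for x and n :: nat
    by (rule hom_nat_pow[OF qhom that is_group Q.is_group])
  have qGp: "?q x \<in> ?Qp" if x: "x \<in> ?Gp" for x
  proof -
    have xG: "x \<in> carrier G" using x GpG by auto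
    have "\<exists>n. ?q x [^]\<^bsub>G Mod H\<^esub> (p ^ n) \<in> D"
      if D: "compact_open_subgroup (G Mod H) (quotient_topology H) D" for D
    proof -
      note DD = Q.compact_open_subgroupD[OF D]
      have "openin T {x \<in> topspace T. ?q x \<in> D}"
        by (rule openin_continuous_map_preimage[OF continuous_map_coset DD(2)])
      moreover have "\<one> \<in> {x \<in> topspace T. ?q x \<in> D}"
        using DD(6) coset_join2[OF one_closed H(1)] subgroup.one_closed[OF H(1)] by (simp add: topspace_eq)
      ultimately obtain E where E: "compact_open_subgroup G T E" "E \<subseteq> {x \<in> topspace T. ?q x \<in> D}"
        using van_Dantzig by blast
      obtain n where "x [^] (p ^ n) \<in> E" using p_componentD[OF x E(1)] .
      then have "?q (x [^] (p ^ n)) \<in> D" using E(2) by blast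
      then show ?thesis using qpow[OF xG] by auto
    qed
    moreover have "?q x \<in> carrier (G Mod H)" using xG by (auto simp: carrier_FactGroup)
    ultimately show ?thesis
      unfolding Q.p_component_eq radical_component_def radical_def by auto
  qed
  define f where "f C = H <#> C" for C
  have f: "f (K #> x) = ?q x" if x: "x \<in> ?Gp" for x
  proof -
    have xG: "x \<in> carrier G" using x GpG by auto
    show ?thesis
    proof (intro equalityI subsetI)
      fix z assume "z \<in> f (K #> x)"
      then obtain h k where hk: "h \<in> H" "k \<in> K" "z = h \<otimes> (k \<otimes> x)"
        by (auto simp: f_def set_mult_def r_coset_def)
      have hk': "h \<otimes> k \<in> H" using hk H(1) by (auto simp: K_def subgroup.m_closed)
      have "z = (h \<otimes> k) \<otimes> x" using hk HG xG by (auto simp: K_def m_assoc subset_iff)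
      then show "z \<in> ?q x" using hk' by (auto simp: r_coset_def)
    next
      fix z assume "z \<in> ?q x"
      then obtain h where h: "h \<in> H" "z = h \<otimes> x" by (auto simp: r_coset_def)
      moreover have "x \<in> K #> x" by (rule rcos_self[OF xG KG])
      ultimately show "z \<in> f (K #> x)" by (auto simp: f_def set_mult_def)
    qed
  qed
  have fhom: "f \<in> hom ?A ?B"
  proof (rule homI)
    fix X assume X: "X \<in> carrier ?A"
    then show "f X \<in> carrier ?B" using f qGp by (auto simp: carA)
    fix Y assume "Y \<in> carrier ?A"
    then obtain x y where xy: "x \<in> ?Gp" "y \<in> ?Gp" "X = K #> x" "Y = K #> y"
      using X by (auto simp: carA)
    have G: "x \<in> carrier G" "y \<in> carrier G" using xy GpG by auto
    have "X \<otimes>\<^bsub>?A\<^esub> Y = K #> (x \<otimes> y)" using NK.rcos_sum[of x y] xy by simp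
    moreover have "x \<otimes> y \<in> ?Gp" using xy subgroup_p_component by (simp add: subgroup.m_closed)
    ultimately show "f (X \<otimes>\<^bsub>?A\<^esub> Y) = f X \<otimes>\<^bsub>?B\<^esub> f Y"
      using xy G by (simp add: f N.rcos_sum)
  qed
  have finj: "inj_on f (carrier ?A)"
  proof (rule inj_onI)
    fix X Y assume XY: "X \<in> carrier ?A" "Y \<in> carrier ?A" "f X = f Y"
    then obtain x y where xy: "x \<in> ?Gp" "y \<in> ?Gp" "X = K #> x" "Y = K #> y" by (auto simp: carA)
    have G: "x \<in> carrier G" "y \<in> carrier G" using xy GpG by auto
    have "x \<otimes> inv y \<in> H" using r_coset_eqD[OF H(1) G] XY(3) xy f by simp
    moreover have "x \<otimes> inv y \<in> ?Gp"
      using xy subgroup_p_component by (simp add: subgroup.m_closed subgroup.m_inv_closed)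
    ultimately show "X = Y" using r_coset_eqI[OF KG G] xy by (simp add: K_def)
  qed
  have fcont: "continuous_map ?S ?R f"
  proof -
    have "continuous_map (p_component_topology G T p) ?R ?q"
      using continuous_map_from_subtopology[OF continuous_map_coset[of H]] qGp
      by (auto simp: continuous_map_in_subtopology)
    then have "continuous_map (p_component_topology G T p) ?R (\<lambda>x. f (K #> x))"
      by (rule continuous_map_eq) (simp add: f)
    then show ?thesis
      using continuous_compose_quotient_map[OF P.quotient_map_quotient_group_topology[of K]]
      by (simp add: o_def)
  qed
  have fopen: "open_map ?S ?R f"
  proof (rule A.hom_open_mapI[OF B.topological_group_axioms fhom])
    fix L assume L: "compact_open_subgroup ?A ?S L"
    note LD = A.compact_open_subgroupD[OF L]
    have "openin (p_component_topology G T p) {x \<in> topspace (p_component_topology G T p). K #> x \<in> L}"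
      using openin_continuous_map_preimage[OF P.continuous_map_coset LD(2)] by simp
    then obtain U where U: "openin T U" "{x \<in> topspace (p_component_topology G T p). K #> x \<in> L} = U \<inter> ?Gp"
      by (auto simp: openin_subtopology)
    have "\<one> \<in> ?Gp" using subgroup.one_closed[OF subgroup_p_component] .
    moreover have "K #> \<one> \<in> L" using LD(6) coset_join2[OF one_closed KG subgroup.one_closed[OF KG]] by simp
    ultimately have "\<one> \<in> U" using U(2) by (auto simp: topspace_eq)
    then obtain W where W: "compact_open_subgroup G T W" "W \<subseteq> U" using van_Dantzig[OF U(1)] by blast
    note WD = compact_open_subgroupD[OF W(1)]
    note qW = Q.compact_open_subgroupD[OF compact_open_subgroup_quotient[OF N W(1)]]
    show "\<exists>V. openin ?R V \<and> \<one>\<^bsub>?B\<^esub> \<in> V \<and> V \<subseteq> f ` L"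
    proof (intro exI[of _ "?q ` W \<inter> ?Qp"] conjI)
      show "openin ?R (?q ` W \<inter> ?Qp)" using qW(2) by (auto simp: openin_subtopology)
      show "\<one>\<^bsub>?B\<^esub> \<in> ?q ` W \<inter> ?Qp"
        using qW(6) subgroup.one_closed[OF Q.subgroup_p_component] by simp
      show "?q ` W \<inter> ?Qp \<subseteq> f ` L"
      proof
        fix X assume X: "X \<in> ?q ` W \<inter> ?Qp"
        then obtain x where x: "x \<in> W" "X = ?q x" by auto
        have xG: "x \<in> carrier G" using x WD by auto
        have "\<exists>n. x [^] (p ^ n) \<in> D <#> H" if D: "compact_open_subgroup G T D" for D
        proof -
          note DD = compact_open_subgroupD[OF D]
          obtain n where "X [^]\<^bsub>G Mod H\<^esub> (p ^ n) \<in> ?q ` D"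
            using Q.p_componentD[of X p, OF _ compact_open_subgroup_quotient[OF N D]] X by blast
          then obtain u where u: "u \<in> D" "?q (x [^] (p ^ n)) = ?q u"
            using qpow[OF xG] x(2) by auto
          have uG: "u \<in> carrier G" using u DD by auto
          have "x [^] (p ^ n) \<otimes> inv u \<in> H" using r_coset_eqD[OF H(1) _ uG u(2)] xG by simp
          moreover have "x [^] (p ^ n) = u \<otimes> (x [^] (p ^ n) \<otimes> inv u)"
            using mult_inv_cancel_left[OF uG, of "x [^] (p ^ n)"] uG xG by (simp add: m_assoc)
          ultimately show ?thesis using u(1) unfolding set_mult_def by blast
        qed
        then obtain y h where y: "y \<in> W" "y \<in> ?Gp" "h \<in> H" "x = y \<otimes> h"
          using p_component_lift[OF p W(1) H x(1)] by blast
        have G: "y \<in> carrier G" "h \<in> carrier G" using y WD HG by auto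
        have "x \<otimes> inv y \<in> H" using mult_inv_cancel_left[OF G] y by simp
        then have "X = ?q y" using r_coset_eqI[OF H(1) xG G(1)] x by simp
        then have "X = f (K #> y)" using f[OF y(2)] by simp
        moreover have "K #> y \<in> L" using U(2) W(2) y by blast
        ultimately show "X \<in> f ` L" by blast
      qed
    qed
  qed
  have Kinv: "component_endo \<phi> p ` K \<subseteq> K"
    using inv p_component_invariant[OF \<phi>, of p] by (auto simp: K_def)
  have endA: "quotient_endo (p_component_group G T p) K (component_endo \<phi> p) \<in> End ?A ?S"
    by (rule P.quotient_endo_End[OF component_endo_End[OF \<phi>] KP Kinv])
  have endB: "restrict (quotient_endo G H \<phi>) ?Qp \<in> End ?B ?R"
    by (rule Q.component_endo_End[OF quotient_endo_End[OF \<phi> H(1) inv]])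
  show ?thesis
    unfolding K_def[symmetric]
  proof (rule h_top_open_embedding[OF A.tdlc_abelian_group_axioms B.tdlc_abelian_group_axioms endA endB
        fhom finj fcont fopen])
    fix X assume "X \<in> carrier ?A"
    then obtain x where x: "x \<in> ?Gp" "X = K #> x" by (auto simp: carA)
    have xG: "x \<in> carrier G" using x GpG by auto
    have px: "\<phi> x \<in> ?Gp" using x p_component_invariant[OF \<phi>] by blast
    have "quotient_endo (p_component_group G T p) K (component_endo \<phi> p) X = K #> \<phi> x"
      using quotient_endo_r_coset[OF NK P.EndD(1)[OF component_endo_End[OF \<phi>]] Kinv, of x] x by simp
    then have "f (quotient_endo (p_component_group G T p) K (component_endo \<phi> p) X) = ?q (\<phi> x)"
      using f[OF px] by simp
    also have "\<dots> = quotient_endo G H \<phi> (?q x)"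
      using quotient_endo_r_coset[OF N EndD(1)[OF \<phi>] inv xG] by simp
    also have "\<dots> = restrict (quotient_endo G H \<phi>) ?Qp (f X)" using f[OF x(1)] qGp[OF x(1)] x(2) by simp
    finally show "f (quotient_endo (p_component_group G T p) K (component_endo \<phi> p) X)
        = restrict (quotient_endo G H \<phi>) ?Qp (f X)" .
  qed
qed

lemma h_top_quotient_has_sum:
  assumes \<phi>: "\<phi> \<in> End G T" and H: "subgroup H G" "closedin T H" and inv: "\<phi> ` H \<subseteq> H"
  shows "(component_quotient_h \<phi> H
    has_sum h_top (G Mod H) (quotient_topology H) (quotient_endo G H \<phi>)) {p. prime p}"
proof -
  interpret Q: tdlc_abelian_group "G Mod H" "quotient_topology H"
    by (rule tdlc_abelian_group_quotient[OF H])
  show ?thesis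
    using Q.h_top_has_sum[OF quotient_endo_End[OF \<phi> H(1) inv]]
    by (rule has_sum_cong[THEN iffD1, rotated])
      (simp add: h_top_quotient_component[OF \<phi> H inv])
qed

section \<open>The addition theorem and the components\<close>

text \<open>The addition formulas of the components are added over all primes.\<close>

theorem AT_if_AT_components:
  assumes AT: "\<And>p. prime p \<Longrightarrow> AT (p_component_group G T p) (p_component_topology G T p)"
  shows "AT G T"
  unfolding AT_def
proof (intro ballI allI impI)
  fix \<phi> H assume \<phi>: "\<phi> \<in> End G T" and "H \<lhd> G \<and> closedin T H \<and> \<phi> ` H \<subseteq> H"
  then have H: "subgroup H G" "closedin T H" and inv: "\<phi> ` H \<subseteq> H" by (auto intro: normal_imp_subgroup)
  have add: "component_h \<phi> p = component_subgroup_h \<phi> H p + component_quotient_h \<phi> H p" if p: "prime p" for p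
  proof -
    let ?K = "p_component G T p \<inter> H"
    interpret P: tdlc_abelian_group "p_component_group G T p" "p_component_topology G T p"
      by (rule tdlc_abelian_group_p_component)
    have "subgroup ?K (p_component_group G T p)"
      using subgroup_incl[OF subgroups_Inter_pair[OF subgroup_p_component H(1)] subgroup_p_component] by simp
    then have "?K \<lhd> p_component_group G T p" by (rule P.subgroup_imp_normal)
    moreover have "closedin (p_component_topology G T p) ?K" using H(2) by (auto simp: closedin_subtopology)
    moreover have "component_endo \<phi> p ` ?K \<subseteq> ?K" using inv p_component_invariant[OF \<phi>, of p] by auto
    ultimately have "component_h \<phi> p =
       h_top (p_component_group G T p\<lparr>carrier := ?K\<rparr>) (subtopology (p_component_topology G T p) ?K)
         (restrict (component_endo \<phi> p) ?K) + component_quotient_h \<phi> H p"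
      using AT[OF p] component_endo_End[OF \<phi>, of p] unfolding AT_def by blast
    moreover have "restrict (component_endo \<phi> p) ?K = restrict \<phi> ?K" by auto
    moreover have "subtopology (p_component_topology G T p) ?K = subtopology T ?K"
      by (simp add: subtopology_subtopology Int_absorb1)
    ultimately show ?thesis by simp
  qed
  have nonneg: "0 \<le> h_top (G\<lparr>carrier := H\<rparr>) (subtopology T H) (restrict \<phi> H)"
    "0 \<le> h_top (G Mod H) (quotient_topology H) (quotient_endo G H \<phi>)"
    by (rule tdlc_abelian_group.h_top_nonneg[OF tdlc_abelian_group_closed_subgroup[OF H] restrict_End[OF \<phi> H(1) inv]])
      (rule tdlc_abelian_group.h_top_nonneg[OF tdlc_abelian_group_quotient[OF H] quotient_endo_End[OF \<phi> H(1) inv]])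
  have "((\<lambda>p. component_subgroup_h \<phi> H p + component_quotient_h \<phi> H p) has_sum (h_top (G\<lparr>carrier := H\<rparr>) (subtopology T H) (restrict \<phi> H) +
       h_top (G Mod H) (quotient_topology H) (quotient_endo G H \<phi>))) {p. prime p}"
    by (rule has_sum_add_ereal_nonneg[OF h_top_subgroup_has_sum[OF \<phi> H inv]
        h_top_quotient_has_sum[OF \<phi> H inv] nonneg])
  then have S: "(component_h \<phi> has_sum (h_top (G\<lparr>carrier := H\<rparr>) (subtopology T H) (restrict \<phi> H) +
       h_top (G Mod H) (quotient_topology H) (quotient_endo G H \<phi>))) {p. prime p}"
    by (rule has_sum_cong[THEN iffD1, rotated]) (simp add: add)
  then show "h_top G T \<phi> = h_top (G\<lparr>carrier := H\<rparr>) (subtopology T H) (restrict \<phi> H) +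
       h_top (G Mod H) (quotient_topology H) (quotient_endo G H \<phi>)"
    using infsumI[OF h_top_has_sum[OF \<phi>]] infsumI[OF S] by simp
qed

text \<open>In a periodic group this puts every element into some compact open subgroup, where the primary
  decomposition is available.\<close>

lemma compact_subgroup_in_compact_open:
  assumes K: "subgroup K G" "compactin T K"
  shows "\<exists>W. compact_open_subgroup G T W \<and> K \<subseteq> W"
proof -
  obtain V where V: "compact_open_subgroup G T V" using ex_compact_open_subgroup by blast
  note VD = compact_open_subgroupD[OF V]
  have KG: "K \<subseteq> carrier G" by (rule subgroup.subset[OF K(1)])
  have S: "subgroup (K <#> V) G" by (rule mult_subgroups[OF K(1) VD(1)])
  have VS: "V \<subseteq> K <#> V"
  proof
    fix v assume v: "v \<in> V"
    then have "v = \<one> \<otimes> v" using VD(5) by auto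
    then show "v \<in> K <#> V" unfolding set_mult_def using v subgroup.one_closed[OF K(1)] by blast
  qed
  have KS: "K \<subseteq> K <#> V"
  proof
    fix k assume k: "k \<in> K"
    then have "k = k \<otimes> \<one>" using KG by auto
    then show "k \<in> K <#> V" unfolding set_mult_def using k VD(6) by blast
  qed
  have "V \<noteq> {}" using VD(6) by blast
  then have "openin T (K <#> V)" by (rule open_subgroupI[OF S VD(2) _ VS])
  moreover have "compactin T ((\<lambda>(x, y). x \<otimes> y) ` (K \<times> V))"
    using image_compactin[OF _ continuous_mult, of "K \<times> V"] K(2) VD(3) by (simp add: compactin_Times)
  moreover have "(\<lambda>(x, y). x \<otimes> y) ` (K \<times> V) = K <#> V" by (auto simp: set_mult_def)
  ultimately show ?thesis using S KS by (auto simp: compact_open_subgroup_def)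
qed

definition primary_part :: "nat \<Rightarrow> 'a \<Rightarrow> 'a" where
  "primary_part p x = (THE y. y \<in> p_component G T p \<and> x \<otimes> inv y \<in> coprime_component G T p)"

lemma subgroup_coprime_component: "subgroup (coprime_component G T p) G"
  by (rule subgroup_radical_component[OF mult_closed_coprime])

text \<open>The decomposition is unique, since the two components meet only in the identity.\<close>

lemma primary_part_eqI:
  assumes y: "y \<in> p_component G T p" and z: "z \<in> coprime_component G T p" and x: "x = y \<otimes> z"
  shows "primary_part p x = y"
  unfolding primary_part_def
proof (rule the_equality)
  have G: "y \<in> carrier G" "z \<in> carrier G"
    using y z p_component_subset by (auto simp: radical_component_def)
  then show "y \<in> p_component G T p \<and> x \<otimes> inv y \<in> coprime_component G T p"
    using y z x mult_inv_cancel_left[OF G] by simp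
  fix w assume w: "w \<in> p_component G T p \<and> x \<otimes> inv w \<in> coprime_component G T p"
  have wG: "w \<in> carrier G" using w p_component_subset by auto
  have "(y \<otimes> inv w) = (x \<otimes> inv w) \<otimes> inv z"
    using G wG x mult_inv_cancel_left[of z "inv w"] by (simp add: m_ac)
  then have "y \<otimes> inv w \<in> coprime_component G T p"
    using w z subgroup_coprime_component by (simp add: subgroup.m_closed subgroup.m_inv_closed)
  moreover have "y \<otimes> inv w \<in> p_component G T p"
    using w y subgroup_p_component by (simp add: subgroup.m_closed subgroup.m_inv_closed)
  ultimately have "y \<otimes> inv w = \<one>" by (intro p_component_Int_coprime_component)
  then show "w = y" using G wG by (metis inv_closed inv_equality inv_inv)
qed

lemma primary_part_self:
  assumes x: "x \<in> p_component G T p"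
  shows "primary_part p x = x"
proof (rule primary_part_eqI[OF x subgroup.one_closed[OF subgroup_coprime_component]])
  show "x = x \<otimes> \<one>" using x p_component_subset[of p] by auto
qed

lemma primary_part_coprime:
  assumes x: "x \<in> coprime_component G T p"
  shows "primary_part p x = \<one>"
proof (rule primary_part_eqI[OF subgroup.one_closed[OF subgroup_p_component] x])
  show "x = \<one> \<otimes> x" using x by (simp add: radical_component_def)
qed

lemma other_component_coprime:
  assumes "prime p" "prime q" "p \<noteq> q"
  shows "p_component G T q \<subseteq> coprime_component G T p"
proof -
  have "prime_powers q \<subseteq> coprime_numbers p" using assms by (auto simp: primes_coprime)
  then show ?thesis unfolding p_component_eq radical_component_def radical_def by blast
qed

lemma primary_part_in_subgroup:
  assumes "prime p" "compact_open_subgroup G T W" "x \<in> W"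
  shows "primary_part p x \<in> W"
  using primary_decomposition[OF assms] primary_part_eqI by (metis IntD1 IntD2)

context
  assumes periodic: "periodic_group G T"
begin

lemma periodic_decomposition:
  assumes p: "prime p" and x: "x \<in> carrier G"
  obtains y z where "y \<in> p_component G T p" "z \<in> coprime_component G T p" "x = y \<otimes> z"
proof -
  obtain K where K: "subgroup K G" "compactin T K" "x \<in> K"
    using periodic x unfolding periodic_group_def by blast
  obtain W where W: "compact_open_subgroup G T W" "K \<subseteq> W"
    using compact_subgroup_in_compact_open[OF K(1,2)] by blast
  then show ?thesis using primary_decomposition[OF p W(1), of x] K(3) that by blast
qed

lemma primary_part_hom:
  assumes p: "prime p"
  shows "primary_part p \<in> hom G (p_component_group G T p)"
proof (rule homI)
  fix x assume x: "x \<in> carrier G"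
  obtain y z where yz: "y \<in> p_component G T p" "z \<in> coprime_component G T p" "x = y \<otimes> z"
    using periodic_decomposition[OF p x] .
  then show "primary_part p x \<in> carrier (p_component_group G T p)" using primary_part_eqI[OF yz] by simp
  fix x' assume x': "x' \<in> carrier G"
  obtain y' z' where yz': "y' \<in> p_component G T p" "z' \<in> coprime_component G T p" "x' = y' \<otimes> z'"
    using periodic_decomposition[OF p x'] .
  have G: "y \<in> carrier G" "z \<in> carrier G" "y' \<in> carrier G" "z' \<in> carrier G"
    using yz yz' p_component_subset by (auto simp: radical_component_def)
  have "primary_part p (x \<otimes> x') = y \<otimes> y'"
  proof (rule primary_part_eqI)
    show "y \<otimes> y' \<in> p_component G T p" using yz yz' subgroup_p_component by (simp add: subgroup.m_closed)
    show "z \<otimes> z' \<in> coprime_component G T p"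
      using yz yz' subgroup_coprime_component by (simp add: subgroup.m_closed)
    show "x \<otimes> x' = (y \<otimes> y') \<otimes> (z \<otimes> z')" using yz(3) yz'(3) G by (simp add: m_ac)
  qed
  then show "primary_part p (x \<otimes> x') = primary_part p x \<otimes>\<^bsub>p_component_group G T p\<^esub> primary_part p x'"
    using primary_part_eqI[OF yz] primary_part_eqI[OF yz'] by simp
qed

text \<open>The projection maps each compact open subgroup into itself and is therefore continuous at the
  identity, hence everywhere.\<close>

lemma primary_part_continuous:
  assumes p: "prime p"
  shows "continuous_map T (p_component_topology G T p) (primary_part p)"
proof -
  have mem: "primary_part p x \<in> p_component G T p" if "x \<in> carrier G" for x
    using primary_part_hom[OF p] that by (auto simp: hom_def)
  have "openin T {x \<in> topspace T. primary_part p x \<in> U}" if U: "openin T U" for U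
  proof (subst openin_subopen, intro ballI)
    fix x assume "x \<in> {x \<in> topspace T. primary_part p x \<in> U}"
    then have x: "x \<in> carrier G" "primary_part p x \<in> U" by (auto simp: topspace_eq)
    let ?y = "primary_part p x"
    have yG: "?y \<in> carrier G" using mem[OF x(1)] p_component_subset by auto
    obtain W where W: "compact_open_subgroup G T W" "(?y <# W) \<inter> (carrier G - U) = {}"
      using compact_open_subgroup_avoiding[OF closedin_complement[OF U] yG] x by blast
    note WD = compact_open_subgroupD[OF W(1)]
    have "primary_part p (x \<otimes> w) \<in> U" if w: "w \<in> W" for w
    proof -
      have "primary_part p (x \<otimes> w) = ?y \<otimes> primary_part p w"
        using primary_part_hom[OF p] x(1) w WD(5) by (auto simp: hom_def)
      moreover have "primary_part p w \<in> W" by (rule primary_part_in_subgroup[OF p W(1) w])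
      ultimately have "primary_part p (x \<otimes> w) \<in> ?y <# W" by (auto simp: l_coset_def)
      then show ?thesis using W(2) l_coset_subset_carrier[OF yG WD(5)] by blast
    qed
    then have "x <# W \<subseteq> {x \<in> topspace T. primary_part p x \<in> U}"
      using x(1) WD(5) by (auto simp: l_coset_def topspace_eq)
    moreover have "x \<in> x <# W" using mem_l_coset_iff[OF x(1) x(1) WD(5)] WD(6) x(1) by simp
    ultimately show "\<exists>U'. openin T U' \<and> x \<in> U' \<and> U' \<subseteq> {x \<in> topspace T. primary_part p x \<in> U}"
      using openin_l_coset[OF x(1) WD(2)] by blast
  qed
  then have "continuous_map T T (primary_part p)"
    using mem p_component_subset by (auto simp: continuous_map_def topspace_eq)
  then show ?thesis using mem by (auto simp: continuous_map_in_subtopology topspace_eq)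
qed

text \<open>Extend \<open>\<phi>\<close> by the projection to the endomorphism \<open>\<psi>\<close> of \<open>G\<close>.  It is trivial on the other
  components and on their quotients, so each of the three entropies of \<open>\<psi>\<close> reduces to the one of
  \<open>\<phi>\<close>.\<close>

theorem AT_component_if_AT:
  assumes AT: "AT G T" and p: "prime p"
  shows "AT (p_component_group G T p) (p_component_topology G T p)"
  unfolding AT_def
proof (intro ballI allI impI)
  let ?Gp = "p_component G T p"
  interpret P: tdlc_abelian_group "p_component_group G T p" "p_component_topology G T p"
    by (rule tdlc_abelian_group_p_component)
  fix \<phi> H assume \<phi>: "\<phi> \<in> End (p_component_group G T p) (p_component_topology G T p)"
    and "H \<lhd> p_component_group G T p \<and> closedin (p_component_topology G T p) H \<and> \<phi> ` H \<subseteq> H"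
  then have N: "H \<lhd> p_component_group G T p" and HP: "subgroup H (p_component_group G T p)"
    and cl: "closedin (p_component_topology G T p) H" and inv: "\<phi> ` H \<subseteq> H"
    by (auto intro: normal_imp_subgroup)
  have HGp: "H \<subseteq> ?Gp" using subgroup.subset[OF HP] by simp
  then have int: "?Gp \<inter> H = H" by auto
  have H: "subgroup H G" "closedin T H"
    using incl_subgroup[OF subgroup_p_component HP] closedin_trans_full[OF cl closedin_p_component] by auto
  define \<psi> where "\<psi> = \<phi> \<circ> primary_part p"
  have pp: "primary_part p x \<in> ?Gp" if "x \<in> carrier G" for x
    using primary_part_hom[OF p] that by (auto simp: hom_def)
  have \<phi>Gp: "\<phi> x \<in> ?Gp" if "x \<in> ?Gp" for x using P.EndD(3)[OF \<phi>] that by simp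
  have \<psi>: "\<psi> \<in> End G T"
  proof -
    have "\<psi> \<in> hom G G"
      using primary_part_hom[OF p] P.EndD(1)[OF \<phi>] p_component_subset[of p]
      by (auto simp: hom_def \<psi>_def Pi_iff)
    moreover have "continuous_map T (p_component_topology G T p) \<psi>"
      unfolding \<psi>_def by (rule continuous_map_compose[OF primary_part_continuous[OF p] P.EndD(2)[OF \<phi>]])
    then have "continuous_map T T \<psi>" by (simp add: continuous_map_in_subtopology)
    ultimately show ?thesis by (simp add: End_def)
  qed
  have \<psi>eq: "\<psi> x = \<phi> x" if "x \<in> ?Gp" for x using that by (simp add: \<psi>_def primary_part_self)
  have \<psi>triv: "\<psi> x = \<one>" if q: "prime q" "q \<noteq> p" and x: "x \<in> p_component G T q" for q x
  proof -
    have "primary_part p x = \<one>"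
      by (rule primary_part_coprime) (use other_component_coprime[OF p q(1)] q(2) x in auto)
    then show ?thesis using P.EndD(5)[OF \<phi>] by (simp add: \<psi>_def)
  qed
  have \<psi>inv: "\<psi> ` H \<subseteq> H" using inv \<psi>eq HGp by auto
  have total: "h_top G T \<psi> = h_top (p_component_group G T p) (p_component_topology G T p) \<phi>"
  proof -
    have "component_h \<psi> q = 0" if q: "q \<in> {q. prime q}" "q \<noteq> p" for q
      using \<psi>triv[of q] q
      by (intro tdlc_abelian_group.h_top_trivial[OF tdlc_abelian_group_p_component component_endo_End[OF \<psi>]])
        simp
    then have "h_top G T \<psi> = component_h \<psi> p"
      by (intro has_sum_single[OF h_top_has_sum[OF \<psi>]]) (use p in auto)
    also have "\<dots> = h_top (p_component_group G T p) (p_component_topology G T p) \<phi>"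
      using \<psi>eq \<phi>Gp by (intro h_top_cong) auto
    finally show ?thesis .
  qed
  have sub: "h_top (G\<lparr>carrier := H\<rparr>) (subtopology T H) (restrict \<psi> H) =
    h_top (p_component_group G T p\<lparr>carrier := H\<rparr>) (subtopology (p_component_topology G T p) H) (restrict \<phi> H)"
  proof -
    have "restrict \<psi> H = restrict \<phi> H" using \<psi>eq HGp by (intro restrict_ext) auto
    then show ?thesis by (simp add: subtopology_subtopology int)
  qed
  have quot: "h_top (G Mod H) (quotient_topology H) (quotient_endo G H \<psi>) =
    h_top (p_component_group G T p Mod H)
      (quotient_group_topology (p_component_group G T p) (p_component_topology G T p) H)
      (quotient_endo (p_component_group G T p) H \<phi>)"
  proof -
    have "component_quotient_h \<psi> H q = 0" if q: "q \<in> {q. prime q}" "q \<noteq> p" for q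
    proof -
      let ?Gq = "p_component G T q" and ?K = "p_component G T q \<inter> H"
      interpret Q: tdlc_abelian_group "p_component_group G T q" "p_component_topology G T q"
        by (rule tdlc_abelian_group_p_component)
      have K: "subgroup ?K (p_component_group G T q)"
        using subgroup_incl[OF subgroups_Inter_pair[OF subgroup_p_component H(1)] subgroup_p_component] by simp
      have clK: "closedin (p_component_topology G T q) ?K" using H(2) by (auto simp: closedin_subtopology)
      have Kinv: "component_endo \<psi> q ` ?K \<subseteq> ?K" using \<psi>inv p_component_invariant[OF \<psi>, of q] by auto
      note \<psi>q = component_endo_End[OF \<psi>, of q]
      show ?thesis
      proof (rule tdlc_abelian_group.h_top_trivial[OF Q.tdlc_abelian_group_quotient[OF K clK]
            Q.quotient_endo_End[OF \<psi>q K Kinv]])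
        fix X assume "X \<in> carrier (p_component_group G T q Mod ?K)"
        then obtain x where x: "x \<in> ?Gq" "X = ?K #> x" by (auto simp: carrier_FactGroup)
        have "quotient_endo (p_component_group G T q) ?K (component_endo \<psi> q) X = ?K #> \<psi> x"
          using quotient_endo_r_coset[OF Q.subgroup_imp_normal[OF K] Q.EndD(1)[OF \<psi>q] Kinv, of x] x by simp
        also have "\<dots> = ?K #> \<one>" using \<psi>triv[of q x] q x by simp
        also have "\<dots> = ?K"
        proof -
          have "subgroup ?K G" by (rule subgroups_Inter_pair[OF subgroup_p_component H(1)])
          then show ?thesis by (intro coset_join2 one_closed subgroup.one_closed)
        qed
        finally show "quotient_endo (p_component_group G T q) ?K (component_endo \<psi> q) X
            = \<one>\<^bsub>p_component_group G T q Mod ?K\<^esub>" by simp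
      qed
    qed
    then have "h_top (G Mod H) (quotient_topology H) (quotient_endo G H \<psi>) = component_quotient_h \<psi> H p"
      by (intro has_sum_single[OF h_top_quotient_has_sum[OF \<psi> H \<psi>inv]]) (use p in auto)
    also have "\<dots> = h_top (p_component_group G T p Mod H)
      (quotient_group_topology (p_component_group G T p) (p_component_topology G T p) H)
      (quotient_endo (p_component_group G T p) H \<phi>)"
      unfolding int
    proof (rule h_top_cong)
      have \<psi>p: "component_endo \<psi> p \<in> End (p_component_group G T p) (p_component_topology G T p)"
        by (rule component_endo_End[OF \<psi>])
      have Hinv: "component_endo \<psi> p ` H \<subseteq> H" using \<psi>inv HGp by auto
      fix X assume X: "X \<in> carrier (p_component_group G T p Mod H)"
      then obtain x where x: "x \<in> ?Gp" "X = H #> x" by (auto simp: carrier_FactGroup)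
      show "quotient_endo (p_component_group G T p) H (component_endo \<psi> p) X
          = quotient_endo (p_component_group G T p) H \<phi> X"
        using quotient_endo_r_coset[OF N P.EndD(1)[OF \<psi>p] Hinv, of x]
          quotient_endo_r_coset[OF N P.EndD(1)[OF \<phi>] inv, of x] x \<psi>eq by simp
      have "quotient_endo (p_component_group G T p) H (component_endo \<psi> p)
          \<in> hom (p_component_group G T p Mod H) (p_component_group G T p Mod H)"
        using P.quotient_endo_End[OF \<psi>p HP Hinv] by (simp add: End_def)
      then show "quotient_endo (p_component_group G T p) H (component_endo \<psi> p) X
          \<in> carrier (p_component_group G T p Mod H)"
        using X by (auto simp: hom_def)
    qed
    finally show ?thesis .
  qed
  have "h_top G T \<psi> = h_top (G\<lparr>carrier := H\<rparr>) (subtopology T H) (restrict \<psi> H) +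
      h_top (G Mod H) (quotient_topology H) (quotient_endo G H \<psi>)"
    using AT \<psi> subgroup_imp_normal[OF H(1)] H(2) \<psi>inv unfolding AT_def by blast
  then show "h_top (p_component_group G T p) (p_component_topology G T p) \<phi> =
    h_top (p_component_group G T p\<lparr>carrier := H\<rparr>) (subtopology (p_component_topology G T p) H) (restrict \<phi> H) +
    h_top (p_component_group G T p Mod H)
      (quotient_group_topology (p_component_group G T p) (p_component_topology G T p) H)
      (quotient_endo (p_component_group G T p) H \<phi>)"
    unfolding total sub quot .
qed

end

end

theorem theorem1p8:
  fixes G :: "('a, 'b) monoid_scheme" and T :: "'a topology"
  assumes "tdlc_abelian_group G T"
  shows "(\<forall>\<phi>\<in>End G T.
            ((\<lambda>p. h_top (p_component_group G T p) (p_component_topology G T p)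
                    (restrict \<phi> (p_component G T p)))
              has_sum h_top G T \<phi>) {p::nat. prime p}) \<and>
         ((\<forall>p::nat. prime p \<longrightarrow> AT (p_component_group G T p) (p_component_topology G T p))
            \<longrightarrow> AT G T) \<and>
         (periodic_group G T \<longrightarrow>
           (AT G T \<longleftrightarrow>
             (\<forall>p::nat. prime p \<longrightarrow> AT (p_component_group G T p) (p_component_topology G T p))))"
proof -
  interpret tdlc_abelian_group G T by fact
  show ?thesis using h_top_has_sum AT_if_AT_components AT_component_if_AT by blast
qed

end
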